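(* Let $d\ge2$, $g\in C(\mathbb{S}^{d-1};(0,+\infty))$ even, $s\ge1$, and let $\{E_r\}_{r>0}\subset\mathfrak{C}$ with $E_r\to E$ in $\mathfrak{C}$ as $r\to0^+$ for some $E\in\mathfrak{C}$. Then for every $x\in\partial E\cap\partial E_r$ for all $r>0$, $$\lim_{r\to0^+}\frac{\mathcal K^{g,s}_r(x,E_r)}{\sigma^s(r)}=\mathcal K^{g,1}(x,E).$$
   Context: $\mathfrak{C}$ is the class of subsets of $\mathbb{R}^d$ which are closures of open sets with compact $C^2$ boundary; $E_r\to E$ in $\mathfrak{C}$ means there are diffeomorphisms $\Phi_r$ converging to the identity in $C^2$ with $\Phi_r(E)=E_r$. $k^s_r(t)=r^{-d-s}$ for $0\le t\le r$ and $k^s_r(t)=t^{-d-s}$ for $t>r$; $k^{g,s}_r(x):=g(x/|x|)k^s_r(|x|)$; $\mathcal K^{g,s}_r(x,E):=\int_{\mathbb{R}^d}(\chi_{\mathbb{R}^d\setminus E}(y)-\chi_E(y))k^{g,s}_r(x-y)\,dy$. $\sigma^s(r):=|\log r|$ if $s=1$, $\sigma^s(r):=\frac{d+s}{d+1}\frac{r^{1-s}}{s-1}$ if $s>1$. Anisotropic mean curvature: for $E\in\mathfrak{C}$ and $x\in\partial E$ with outer normal $\nu=\nu_E(x)$, near $x$ the set $E$ is $\{x+z+t\nu: z\perp\nu,\ t\le f(z)\}$ for a $C^2$ function $f$ on the hyperplane $\nu^\perp$ with $f(0)=0$, $Df(0)=0$; then $\mathcal K^{g,1}(x,E):=-\int_{\{\xi\in\mathbb{S}^{d-1}:\xi\cdot\nu=0\}}g(\xi)\,\xi^*D^2f(0)\xi\,d\mathcal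 H^{d-2}(\xi)$. *)

theory Defs
  imports "HOL-Analysis.Analysis"
begin

definition C2_with :: "('a::euclidean_space \<Rightarrow> 'b::euclidean_space)
     \<Rightarrow> ('a \<Rightarrow> ('a \<Rightarrow>\<^sub>L 'b)) \<Rightarrow> ('a \<Rightarrow> ('a \<Rightarrow>\<^sub>L ('a \<Rightarrow>\<^sub>L 'b))) \<Rightarrow> bool" where
  "C2_with f f' f'' \<longleftrightarrow>
     (\<forall>x. (f has_derivative blinfun_apply (f' x)) (at x)) \<and>
     (\<forall>x. (f' has_derivative blinfun_apply (f'' x)) (at x)) \<and>
     continuous_on UNIV f''"

definition C2_diffeo :: "('a::euclidean_space \<Rightarrow> 'a)
     \<Rightarrow> ('a \<Rightarrow> ('a \<Rightarrow>\<^sub>L 'a)) \<Rightarrow> ('a \<Rightarrow> ('a \<Rightarrow>\<^sub>L ('a \<Rightarrow>\<^sub>L 'a))) \<Rightarrow> bool" where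
  "C2_diffeo \<Phi> \<Phi>' \<Phi>'' \<longleftrightarrow> C2_with \<Phi> \<Phi>' \<Phi>'' \<and>
     (\<exists>\<Psi> \<Psi>' \<Psi>''. C2_with \<Psi> \<Psi>' \<Psi>'' \<and> (\<forall>y. \<Psi> (\<Phi> y) = y \<and> \<Phi> (\<Psi> y) = y))"

text \<open>Near x, E = {x + z + t nu : z orthogonal to nu, t \<le> f z}, where nu is the (unit)
  outer normal, f is C^2 (on the hyperplane; w.l.o.g. extended C^2 to the whole space,
  only its values on the hyperplane matter), f 0 = 0 and Df 0 = 0.\<close>
definition local_graph ::
  "'a::euclidean_space set \<Rightarrow> 'a \<Rightarrow> 'a \<Rightarrow> ('a \<Rightarrow> real)
     \<Rightarrow> ('a \<Rightarrow> ('a \<Rightarrow>\<^sub>L real)) \<Rightarrow> ('a \<Rightarrow> ('a \<Rightarrow>\<^sub>L ('a \<Rightarrow>\<^sub>L real))) \<Rightarrow> bool" where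
  "local_graph E x \<nu> f f' f'' \<longleftrightarrow>
     norm \<nu> = 1 \<and> C2_with f f' f'' \<and> f 0 = 0 \<and> f' 0 = 0 \<and>
     (\<exists>\<rho>>0. E \<inter> ball x \<rho> =
        {x + z + t *\<^sub>R \<nu> | z t. z \<bullet> \<nu> = 0 \<and> t \<le> f z} \<inter> ball x \<rho>)"

definition classC :: "'a::euclidean_space set set" where
  "classC = {E. (\<exists>U. open U \<and> E = closure U) \<and> compact (frontier E) \<and>
                 (\<forall>x\<in>frontier E. \<exists>\<nu> f f' f''. local_graph E x \<nu> f f' f'')}"

definition convC :: "(real \<Rightarrow> 'a::euclidean_space set) \<Rightarrow> 'a set \<Rightarrow> bool" where
  "convC F E \<longleftrightarrow> (\<exists>\<Phi> \<Phi>' \<Phi>''.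
     (\<forall>\<^sub>F r in at_right 0. C2_diffeo (\<Phi> r) (\<Phi>' r) (\<Phi>'' r) \<and> \<Phi> r ` E = F r) \<and>
     (\<forall>\<epsilon>>0. \<forall>\<^sub>F r in at_right 0. \<forall>y.
         norm (\<Phi> r y - y) \<le> \<epsilon> \<and> norm (\<Phi>' r y - id_blinfun) \<le> \<epsilon> \<and> norm (\<Phi>'' r y) \<le> \<epsilon>))"

definition kr :: "nat \<Rightarrow> real \<Rightarrow> real \<Rightarrow> real \<Rightarrow> real" where
  "kr d s r t = (if t \<le> r then r powr (-(real d + s)) else t powr (-(real d + s)))"

definition kgr :: "('a::euclidean_space \<Rightarrow> real) \<Rightarrow> real \<Rightarrow> real \<Rightarrow> 'a \<Rightarrow> real" where
  "kgr g s r x = g (x /\<^sub>R norm x) * kr DIM('a) s r (norm x)"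

definition Kgr :: "('a::euclidean_space \<Rightarrow> real) \<Rightarrow> real \<Rightarrow> real \<Rightarrow> 'a \<Rightarrow> 'a set \<Rightarrow> real" where
  "Kgr g s r x E = (\<integral>y. (indicator (- E) y - indicator E y) * kgr g s r (x - y) \<partial>lborel)"

definition sigma_s :: "nat \<Rightarrow> real \<Rightarrow> real \<Rightarrow> real" where
  "sigma_s d s r = (if s = 1 then \<bar>ln r\<bar>
                    else (real d + s) / (real d + 1) * r powr (1 - s) / (s - 1))"

definition hausdorff_pre :: "nat \<Rightarrow> real \<Rightarrow> 'a::euclidean_space set \<Rightarrow> ennreal" where
  "hausdorff_pre m \<delta> A = (INF C \<in> {C :: nat \<Rightarrow> 'a set. A \<subseteq> (\<Union>i. C i) \<and>
        (\<forall>i. bounded (C i) \<and> diameter (C i) \<le> \<delta>)}.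
      (\<Sum>i. (if C i = {} then 0
             else ennreal (unit_ball_vol (real m) * (diameter (C i) / 2) ^ m))))"

definition hausdorff_outer :: "nat \<Rightarrow> 'a::euclidean_space set \<Rightarrow> ennreal" where
  "hausdorff_outer m A = (SUP \<delta> \<in> {0<..}. hausdorff_pre m \<delta> A)"

definition hausdorff_measure :: "nat \<Rightarrow> 'a::euclidean_space measure" where
  "hausdorff_measure m = measure_of UNIV (sets borel) (hausdorff_outer m)"

definition aniso_curv :: "('a::euclidean_space \<Rightarrow> real) \<Rightarrow> 'a \<Rightarrow> 'a set \<Rightarrow> real" where
  "aniso_curv g x E = (THE k. \<exists>\<nu> f f' f''. local_graph E x \<nu> f f' f'' \<and>
      k = - (\<integral>\<xi>. indicator {\<xi>. norm \<xi> = 1 \<and> \<xi> \<bullet> \<nu> = 0} \<xi> *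
                  (g \<xi> * blinfun_apply (blinfun_apply (f'' 0) \<xi>) \<xi>)
             \<partial>hausdorff_measure (DIM('a) - 2)))"

end

theory Submission
  imports Defs
begin

text \<open>
Let \<open>\<nu>\<close> be the outer normal at \<open>x\<close>, and split \<open>h = z + t \<nu>\<close> with \<open>z\<close> orthogonal to \<open>\<nu>\<close>.
Uniformly for small \<open>r\<close>, the set \<open>F r\<close> is near \<open>x\<close> a sublevel set \<open>{v \<le> 0}\<close> with
\<open>v h = a \<bullet> h - f'' 0 z z / 2 + o(norm h ^ 2)\<close>, where \<open>a\<close> tends to \<open>\<nu>\<close>. As the kernel is even,
only the even part of the sign of \<open>v\<close> contributes to the integral; it lives on the wedge
\<open>\<bar>a \<bullet> h\<bar> < \<bar>f'' 0 z z\<bar> / 2\<close>, on which the kernel may be replaced by its value at \<open>z\<close>.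
Integrating along \<open>\<nu>\<close> and then in polar coordinates of the hyperplane gives the radial moment
\<open>\<integral> \<rho> ^ d * kr \<rho>\<close> over \<open>0 < \<rho> < \<delta>\<close>, which is asymptotic to \<open>sigma_s\<close>, times an integral
against the cone measure of the unit sphere of the hyperplane.

The cone measure coincides with the Hausdorff measure: the isodiametric inequality (from
Prekopa-Leindler, applied to gnomonic projections of small caps) gives one inequality, an
iterated Vitali covering by small caps the other one. Independence of the curvature of the chosen
local graph follows from uniqueness of the limit.
\<close>

section \<open>Slicing Lebesgue measure\<close>


text \<open>The normal of \<open>F r\<close> at \<open>x\<close> converges to \<open>\<nu>\<close>
  at no known rate, so at the quadratic scale of the curvature \<open>a \<bullet> h\<close> cannot
  be replaced by \<open>\<nu> \<bullet> h\<close>. Evenness of the kernel removes this obstacle: the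
  sign of \<open>a \<bullet> h\<close> is odd and cancels for every \<open>a\<close>, which survives
  only in the thickness \<open>2 * \<bar>q\<bar> / (a \<bullet> \<nu>)\<close> of the wedge over
  \<open>z\<close>, with \<open>q = - f'' 0 z z / 2\<close>. The 2 cancels the 1/2, so the curvature
  integral appears without a spare constant. In the radial moment the core
  \<open>\<rho> \<le> r\<close> gives \<open>r powr (1 - s) / (d + 1)\<close> and the tail, for
  \<open>s > 1\<close>, gives \<open>r powr (1 - s) / (s - 1)\<close> up to a constant; their sum
  explains the factor \<open>(d + s) / (d + 1)\<close> in \<open>sigma_s\<close>. For
  \<open>s = 1\<close> the core is constant and the tail logarithmic. Only upper bounds are proved:
  the lower bound is the upper bound for the negated sign function. Hausdorff covers use arbitrary
  sets, paid for by diameter, so agreement with the cone measure without a constant needs the sharp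
  isodiametric inequality on one side and covers that waste almost nothing on the other.\<close>

definition perp :: "'a::euclidean_space \<Rightarrow> 'a \<Rightarrow> 'a" where
  "perp e h = h - (h \<bullet> e) *\<^sub>R e"

definition slab :: "'a::euclidean_space \<Rightarrow> 'a set" where
  "slab e = {h. \<bar>h \<bullet> e\<bar> < 1/2}"

lemma perp_measurable [measurable]: "perp e \<in> borel_measurable borel"
  unfolding perp_def by measurable

lemma slab_sets [measurable]: "slab e \<in> sets borel"
  unfolding slab_def by measurable

lemma perp_add: "perp e (h + k) = perp e h + perp e k"
  by (simp add: perp_def algebra_simps)

lemma perp_scaleR: "perp e (c *\<^sub>R h) = c *\<^sub>R perp e h"
  by (simp add: perp_def algebra_simps)

lemma perp_inner: "norm e = 1 \<Longrightarrow> perp e h \<bullet> e = 0"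
  by (simp add: perp_def algebra_simps dot_square_norm)

lemma perp_self: "norm e = 1 \<Longrightarrow> perp e e = 0"
  by (simp add: perp_def dot_square_norm)

lemma perp_id: "h \<bullet> e = 0 \<Longrightarrow> perp e h = h"
  by (simp add: perp_def)

lemma perp_decomp: "h = perp e h + (h \<bullet> e) *\<^sub>R e"
  by (simp add: perp_def)

lemma norm_perp: "norm e = 1 \<Longrightarrow> (norm h)\<^sup>2 = (norm (perp e h))\<^sup>2 + (h \<bullet> e)\<^sup>2"
  unfolding power2_norm_eq_inner norm_eq_1
  by (simp add: perp_def algebra_simps inner_commute power2_eq_square)

lemma norm_perp_le: "norm e = 1 \<Longrightarrow> norm (perp e h) \<le> norm h"
  using norm_perp[of e h] by (metis abs_le_square_iff abs_norm_cancel le_add_same_cancel1 zero_le_power2)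

lemma nn_integral_lborel_translate:
  fixes \<Phi> :: "'a::euclidean_space \<Rightarrow> ennreal"
  assumes [measurable]: "\<Phi> \<in> borel_measurable borel"
  shows "(\<integral>\<^sup>+h. \<Phi> (c + h) \<partial>lborel) = (\<integral>\<^sup>+h. \<Phi> h \<partial>lborel)"
proof -
  have "(\<integral>\<^sup>+h. \<Phi> h \<partial>lborel) = (\<integral>\<^sup>+h. \<Phi> h \<partial>distr lborel borel ((+) c))"
    by (simp add: lborel_distr_plus)
  also have "\<dots> = (\<integral>\<^sup>+h. \<Phi> (c + h) \<partial>lborel)"
    by (subst nn_integral_distr) auto
  finally show ?thesis by simp
qed

lemma nn_integral_lborel_scale:
  fixes \<Phi> :: "'a::euclidean_space \<Rightarrow> ennreal"
  assumes [measurable]: "\<Phi> \<in> borel_measurable borel" and c: "c \<noteq> 0"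
  shows "(\<integral>\<^sup>+h. \<Phi> h \<partial>lborel) = ennreal (\<bar>c\<bar> ^ DIM('a)) * (\<integral>\<^sup>+h. \<Phi> (c *\<^sub>R h) \<partial>lborel)"
proof -
  have "(\<integral>\<^sup>+h. \<Phi> h \<partial>lborel) =
     (\<integral>\<^sup>+h. \<Phi> h \<partial>density (distr lborel borel (\<lambda>x. 0 + c *\<^sub>R x)) (\<lambda>_. \<bar>c\<bar> ^ DIM('a)))"
    using lborel_affine[of c "0::'a"] c by simp
  also have "\<dots> = ennreal (\<bar>c\<bar> ^ DIM('a)) * (\<integral>\<^sup>+h. \<Phi> (c *\<^sub>R h) \<partial>lborel)"
    by (subst nn_integral_density) (auto simp: nn_integral_distr nn_integral_cmult)
  finally show ?thesis .
qed

text \<open>Lebesgue measure on the hyperplane orthogonal to \<open>e\<close> is modelled by Lebesgue measure on the slab of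
  unit width around it: there is no type of dimension \<open>DIM('a) - 1\<close>, and with slabs Tonelli and
  translation invariance suffice, without rotating \<open>e\<close> into a coordinate direction.\<close>
lemma nn_integral_slice:
  fixes \<Phi> :: "'a::euclidean_space \<Rightarrow> ennreal"
  assumes [measurable]: "\<Phi> \<in> borel_measurable borel" and e: "norm e = 1"
  shows "(\<integral>\<^sup>+h. \<Phi> h \<partial>lborel) =
    (\<integral>\<^sup>+h. indicator (slab e) h * (\<integral>\<^sup>+t. \<Phi> (perp e h + t *\<^sub>R e) \<partial>lborel) \<partial>lborel)"
proof -
  have ee: "e \<bullet> e = 1" using e by (simp add: dot_square_norm)
  have "(\<integral>\<^sup>+h. indicator (slab e) h * (\<integral>\<^sup>+t. \<Phi> (perp e h + t *\<^sub>R e) \<partial>lborel) \<partial>lborel)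
      = (\<integral>\<^sup>+h. (\<integral>\<^sup>+t. indicator (slab e) h * \<Phi> (h + t *\<^sub>R e) \<partial>lborel) \<partial>lborel)"
  proof (rule nn_integral_cong)
    fix h :: 'a
    have "(\<integral>\<^sup>+t. \<Phi> (perp e h + t *\<^sub>R e) \<partial>lborel) = (\<integral>\<^sup>+t. \<Phi> (perp e h + (h \<bullet> e + t) *\<^sub>R e) \<partial>lborel)"
      by (rule nn_integral_lborel_translate[symmetric]) measurable
    also have "\<dots> = (\<integral>\<^sup>+t. \<Phi> (h + t *\<^sub>R e) \<partial>lborel)"
      by (simp add: perp_def algebra_simps)
    finally show "indicator (slab e) h * (\<integral>\<^sup>+t. \<Phi> (perp e h + t *\<^sub>R e) \<partial>lborel)
       = (\<integral>\<^sup>+t. indicator (slab e) h * \<Phi> (h + t *\<^sub>R e) \<partial>lborel)"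
      by (simp add: nn_integral_cmult)
  qed
  also have "\<dots> = (\<integral>\<^sup>+t. (\<integral>\<^sup>+h. indicator (slab e) h * \<Phi> (h + t *\<^sub>R e) \<partial>lborel) \<partial>lborel)"
    by (rule lborel_pair.Fubini') measurable
  \<comment> \<open>Translating by \<open>t *\<^sub>R e\<close> puts the shift on the slab. For
    fixed \<open>h\<close> the \<open>t\<close> with \<open>h - t *\<^sub>R e\<close> in the slab
    form an interval of length one, so the integral over \<open>t\<close> gives back
    \<open>\<Phi> h\<close>; this is why the slab has unit width.\<close>
  also have "\<dots> = (\<integral>\<^sup>+t. (\<integral>\<^sup>+h. indicator (slab e) (h - t *\<^sub>R e) * \<Phi> h \<partial>lborel) \<partial>lborel)"
  proof (rule nn_integral_cong)
    fix t :: real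
    have "(\<integral>\<^sup>+h. indicator (slab e) (h - t *\<^sub>R e) * \<Phi> h \<partial>lborel)
      = (\<integral>\<^sup>+h. indicator (slab e) ((t *\<^sub>R e + h) - t *\<^sub>R e) * \<Phi> (t *\<^sub>R e + h) \<partial>lborel)"
      by (rule nn_integral_lborel_translate[symmetric]) measurable
    then show "(\<integral>\<^sup>+h. indicator (slab e) h * \<Phi> (h + t *\<^sub>R e) \<partial>lborel)
      = (\<integral>\<^sup>+h. indicator (slab e) (h - t *\<^sub>R e) * \<Phi> h \<partial>lborel)"
      by (simp add: add.commute)
  qed
  also have "\<dots> = (\<integral>\<^sup>+h. (\<integral>\<^sup>+t. indicator (slab e) (h - t *\<^sub>R e) * \<Phi> h \<partial>lborel) \<partial>lborel)"
    by (rule lborel_pair.Fubini'[symmetric]) measurable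
  also have "\<dots> = (\<integral>\<^sup>+h. \<Phi> h \<partial>lborel)"
  proof (rule nn_integral_cong)
    fix h :: 'a
    have "(\<integral>\<^sup>+t. indicator (slab e) (h - t *\<^sub>R e) * \<Phi> h \<partial>lborel)
       = (\<integral>\<^sup>+t. indicator {h \<bullet> e - 1/2 <..< h \<bullet> e + 1/2} t * \<Phi> h \<partial>lborel)"
      by (rule nn_integral_cong) (auto simp: slab_def indicator_def inner_diff_left ee abs_if)
    also have "\<dots> = \<Phi> h"
      by (subst nn_integral_multc) auto
    finally show "(\<integral>\<^sup>+t. indicator (slab e) (h - t *\<^sub>R e) * \<Phi> h \<partial>lborel) = \<Phi> h" .
  qed
  finally show ?thesis by simp
qed

text \<open>On each line in direction \<open>e\<close> the integrand is constant, so only the length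
  of the interval cut out by the slab counts. Needed after dilations, which change the width of the
  slab.\<close>

lemma nn_integral_slab_width:
  fixes \<Phi> :: "'a::euclidean_space \<Rightarrow> ennreal"
  assumes [measurable]: "\<Phi> \<in> borel_measurable borel" and e: "norm e = 1" and a: "a \<ge> 0"
    and inv: "\<And>h t. \<Phi> (h + t *\<^sub>R e) = \<Phi> h"
  shows "(\<integral>\<^sup>+h. indicator {h. \<bar>h \<bullet> e\<bar> < a} h * \<Phi> h \<partial>lborel) =
    ennreal (2 * a) * (\<integral>\<^sup>+h. indicator (slab e) h * \<Phi> h \<partial>lborel)"
proof -
  have ee: "e \<bullet> e = 1" using e by (simp add: dot_square_norm)
  have [measurable]: "{h::'a. \<bar>h \<bullet> e\<bar> < a} \<in> sets borel" by measurable
  have ph: "\<Phi> (perp e h + t *\<^sub>R e) = \<Phi> h" for h t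
    using inv[of h "t - h \<bullet> e"] by (simp add: perp_def algebra_simps)
  have "(\<integral>\<^sup>+h. indicator {h. \<bar>h \<bullet> e\<bar> < a} h * \<Phi> h \<partial>lborel) =
    (\<integral>\<^sup>+h. indicator (slab e) h * (\<integral>\<^sup>+t. indicator {-a<..<a} t * \<Phi> h \<partial>lborel) \<partial>lborel)"
    apply (subst nn_integral_slice[OF _ e])
     apply measurable
    apply (intro nn_integral_cong arg_cong2[where f="(*)"] refl)
    apply (auto simp: ph indicator_def inner_add_left perp_inner[OF e] ee abs_less_iff)
    done
  also have "\<dots> = (\<integral>\<^sup>+h. ennreal (2 * a) * (indicator (slab e) h * \<Phi> h) \<partial>lborel)"
    using a by (intro nn_integral_cong, subst nn_integral_multc) (auto simp: ac_simps)
  also have "\<dots> = ennreal (2 * a) * (\<integral>\<^sup>+h. indicator (slab e) h * \<Phi> h \<partial>lborel)"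
    by (rule nn_integral_cmult) measurable
  finally show ?thesis .
qed

text \<open>The image of \<open>M\<close> under \<open>n\<close> and the measure with density
  \<open>C * p * \<rho> ^ (p - 1)\<close> on the half-line agree on all sets \<open>{..c}\<close>,
  hence on all Borel sets.\<close>

lemma nn_integral_radial:
  fixes n :: "'b \<Rightarrow> real" and \<kappa> :: "real \<Rightarrow> ennreal"
  assumes [measurable]: "n \<in> borel_measurable M" "\<kappa> \<in> borel_measurable borel"
    and n: "\<And>x. x \<in> space M \<Longrightarrow> n x \<ge> 0"
    and p: "p > 0" and C: "C \<ge> 0"
    and meas: "\<And>c. c > 0 \<Longrightarrow> emeasure M {x \<in> space M. n x \<le> c} = ennreal (C * c ^ p)"
  shows "(\<integral>\<^sup>+x. \<kappa> (n x) \<partial>M) =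
    (\<integral>\<^sup>+\<rho>. ennreal C * (ennreal (real p * \<rho> ^ (p - 1)) * indicator {0..} \<rho>) * \<kappa> \<rho> \<partial>lborel)"
proof -
  define D where "D = density lborel (\<lambda>\<rho>::real. ennreal C * (ennreal (real p * \<rho> ^ (p - 1)) * indicator {0..} \<rho>))"
  have [measurable]: "(\<lambda>\<rho>::real. ennreal C * (ennreal (real p * \<rho> ^ (p - 1)) * indicator {0..} \<rho>)) \<in> borel_measurable borel"
    by measurable
  have D: "emeasure D {..c} = ennreal (C * c ^ p)" if "c > 0" for c
  proof -
    have "emeasure D {..c} = (\<integral>\<^sup>+\<rho>. ennreal C * (ennreal (real p * \<rho> ^ (p - 1)) * indicator {0..} \<rho>) * indicator {..c} \<rho> \<partial>lborel)"
      unfolding D_def by (subst emeasure_density) auto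
    also have "\<dots> = (\<integral>\<^sup>+\<rho>. ennreal C * (ennreal (real p * \<rho> ^ (p - 1)) * indicator {0..c} \<rho>) \<partial>lborel)"
      by (rule nn_integral_cong) (auto simp: indicator_def)
    also have "\<dots> = ennreal C * (\<integral>\<^sup>+\<rho>. ennreal (real p * \<rho> ^ (p - 1)) * indicator {0..c} \<rho> \<partial>lborel)"
      by (rule nn_integral_cmult) measurable
    also have "(\<integral>\<^sup>+\<rho>. ennreal (real p * \<rho> ^ (p - 1)) * indicator {0..c} \<rho> \<partial>lborel) = ennreal (c ^ p - 0 ^ p)"
    proof (rule nn_integral_FTC_Icc)
      fix x :: real
      show "((\<lambda>x. x ^ p) has_real_derivative real p * x ^ (p - 1)) (at x)"
        by (auto intro!: derivative_eq_intros)
    qed (use that in auto)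
    finally show ?thesis using p C that by (simp add: ennreal_mult' zero_power)
  qed
  have eq: "distr M borel n = D"
  proof (rule measure_eqI_generator_eq[where E="range (\<lambda>c::real. {..c})" and \<Omega>=UNIV and A="\<lambda>i. {..real i}"])
    show "Int_stable (range (\<lambda>c::real. {..c}))"
      by (auto simp: Int_stable_def)
    have zero: "emeasure (distr M borel n) {..c} = emeasure D {..c}" for c
    proof -
      consider "c > 0" | "c = 0" | "c < 0" by linarith
      then show ?thesis
      proof cases
        case 1
        have "emeasure (distr M borel n) {..c} = emeasure M {x \<in> space M. n x \<le> c}"
          by (subst emeasure_distr) (auto intro!: arg_cong2[where f=emeasure])
        with 1 D meas show ?thesis by simp
      next
        \<comment> \<open>The hypothesis speaks of \<open>c > 0\<close> only; at 0 both measures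
          vanish by continuity from above along \<open>1 / Suc i\<close>.\<close>
        case 2
        have l: "(\<lambda>i::nat. ennreal (C * (1 / real (Suc i)) ^ p)) \<longlonglongrightarrow> ennreal 0"
        proof (rule tendsto_ennrealI)
          have "(\<lambda>i::nat. (1 / real (Suc i)) ^ p) \<longlonglongrightarrow> 0 ^ p"
            by (intro tendsto_power LIMSEQ_Suc lim_1_over_n)
          from tendsto_mult_left[OF this, of C] p show "(\<lambda>i::nat. C * (1 / real (Suc i)) ^ p) \<longlonglongrightarrow> 0" by (simp add: zero_power)
        qed
        have I: "(\<Inter>i::nat. {..1 / real (Suc i)}) = {..0::real}"
        proof safe
          fix x :: real assume "x \<in> (\<Inter>i::nat. {..1 / real (Suc i)})"
          then have "x \<le> 1 / real (Suc i)" for i by auto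
          then show "x \<le> 0" by (meson nat_approx_posE not_le)
        next
          fix x :: real and i :: nat assume "x \<le> 0"
          also have "0 \<le> 1 / real (Suc i)" by simp
          finally show "x \<le> 1 / real (Suc i)" .
        qed
        have gen: "emeasure N {..0::real} = 0" if N: "sets N = sets borel"
          "\<And>c. c > 0 \<Longrightarrow> emeasure N {..c} = ennreal (C * c ^ p)" for N
        proof -
          have "(\<lambda>i::nat. emeasure N {..1 / real (Suc i)}) \<longlonglongrightarrow> emeasure N (\<Inter>i::nat. {..1 / real (Suc i)})"
          proof (rule Lim_emeasure_decseq)
            show "decseq (\<lambda>i::nat. {..1 / real (Suc i)})"
              by (auto simp: decseq_def intro: order_trans frac_le)
          qed (auto simp: N)
          moreover have "(\<lambda>i::nat. emeasure N {..1 / real (Suc i)}) \<longlonglongrightarrow> 0"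
            using l by (simp add: N)
          ultimately show ?thesis unfolding I by (rule LIMSEQ_unique)
        qed
        have "emeasure (distr M borel n) {..c} = emeasure M {x \<in> space M. n x \<le> c}" for c
          by (subst emeasure_distr) (auto intro!: arg_cong2[where f=emeasure])
        with gen[of D] gen[of "distr M borel n"] D meas 2 show ?thesis
          by (simp add: D_def)
      next
        case 3
        have "n -` {..c} \<inter> space M = {}" using n 3 by force
        then have "emeasure (distr M borel n) {..c} = 0"
          by (subst emeasure_distr) auto
        moreover have "emeasure D {..c} = 0"
          unfolding D_def using 3
          by (subst emeasure_density) (auto simp: nn_integral_0_iff_AE indicator_def)
        ultimately show ?thesis by simp
      qed
    qed
    then show "emeasure (distr M borel n) X = emeasure D X" if "X \<in> range atMost" for X
      using that by auto
    show "sets (distr M borel n) = sigma_sets UNIV (range (\<lambda>c::real. {..c}))"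
      by (simp add: borel_eq_atMost)
    show "sets D = sigma_sets UNIV (range (\<lambda>c::real. {..c}))"
      by (simp add: D_def) (simp add: borel_eq_atMost)
    show "(\<Union>i. {..real i}) = UNIV"
      by (auto simp: real_arch_simple)
    show "emeasure (distr M borel n) {..real i} \<noteq> \<infinity>" for i
      unfolding zero using D[of "real i + 1"] emeasure_mono[of "{..real i}" "{..real i + 1}" D]
      by (auto simp: D_def top_unique)
  qed auto
  have "(\<integral>\<^sup>+x. \<kappa> (n x) \<partial>M) = (\<integral>\<^sup>+\<rho>. \<kappa> \<rho> \<partial>distr M borel n)"
    by (subst nn_integral_distr) auto
  also have "\<dots> = (\<integral>\<^sup>+\<rho>. \<kappa> \<rho> \<partial>D)" by (simp add: eq)
  also have "\<dots> = (\<integral>\<^sup>+\<rho>. ennreal C * (ennreal (real p * \<rho> ^ (p - 1)) * indicator {0..} \<rho>) * \<kappa> \<rho> \<partial>lborel)"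
    unfolding D_def by (subst nn_integral_density) auto
  finally show ?thesis .
qed

section \<open>Lebesgue measure on hyperplanes and the cone measure\<close>


lemma sgn_measurable [measurable]: "(sgn :: 'a::euclidean_space \<Rightarrow> 'a) \<in> borel_measurable borel"
  unfolding sgn_div_norm by measurable

lemma perp_slab_translate: "v \<bullet> e = 0 \<Longrightarrow> indicator (slab e) (h + t *\<^sub>R v) = indicator (slab e) h"
  by (simp add: slab_def indicator_def inner_add_left)

text \<open>Dilating the whole space contributes \<open>c ^ DIM('a)\<close>. The slab then has width
  \<open>1 / c\<close> in place of one, which takes back one factor and leaves the exponent of a
  hyperplane.\<close>

lemma nn_integral_slab_scale:
  fixes \<Phi> :: "'a::euclidean_space \<Rightarrow> ennreal"
  assumes [measurable]: "\<Phi> \<in> borel_measurable borel" and \<nu>: "norm \<nu> = 1" and c: "c > 0"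
  shows "(\<integral>\<^sup>+h. indicator (slab \<nu>) h * \<Phi> (perp \<nu> h) \<partial>lborel) =
     ennreal (c ^ (DIM('a) - 1)) * (\<integral>\<^sup>+h. indicator (slab \<nu>) h * \<Phi> (c *\<^sub>R perp \<nu> h) \<partial>lborel)"
proof -
  have "(\<integral>\<^sup>+h. indicator (slab \<nu>) h * \<Phi> (perp \<nu> h) \<partial>lborel) =
    ennreal (\<bar>c\<bar> ^ DIM('a)) * (\<integral>\<^sup>+h. indicator (slab \<nu>) (c *\<^sub>R h) * \<Phi> (perp \<nu> (c *\<^sub>R h)) \<partial>lborel)"
    by (rule nn_integral_lborel_scale) (use c in auto)
  also have "(\<integral>\<^sup>+h. indicator (slab \<nu>) (c *\<^sub>R h) * \<Phi> (perp \<nu> (c *\<^sub>R h)) \<partial>lborel) =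
    (\<integral>\<^sup>+h. indicator {h. \<bar>h \<bullet> \<nu>\<bar> < 1 / (2 * c)} h * \<Phi> (c *\<^sub>R perp \<nu> h) \<partial>lborel)"
    using c by (intro nn_integral_cong) (auto simp: perp_scaleR slab_def indicator_def abs_mult field_simps)
  also have "\<dots> = ennreal (2 * (1 / (2 * c))) * (\<integral>\<^sup>+h. indicator (slab \<nu>) h * \<Phi> (c *\<^sub>R perp \<nu> h) \<partial>lborel)"
    by (rule nn_integral_slab_width) (use c \<nu> in \<open>auto simp: perp_add perp_scaleR perp_self\<close>)
  also have "ennreal (\<bar>c\<bar> ^ DIM('a)) * \<dots> = ennreal (\<bar>c\<bar> ^ DIM('a) * (2 * (1 / (2 * c)))) * (\<integral>\<^sup>+h. indicator (slab \<nu>) h * \<Phi> (c *\<^sub>R perp \<nu> h) \<partial>lborel)"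
    using c by (subst ennreal_mult) (auto simp: mult.assoc)
  also have "\<bar>c\<bar> ^ DIM('a) * (2 * (1 / (2 * c))) = c ^ (DIM('a) - 1)"
    using c by (simp add: power_diff)
  finally show ?thesis .
qed

lemma perp_perp_translate:
  assumes "norm \<nu> = 1" "norm w = 1" "w \<bullet> \<nu> = 0"
  shows "perp w (perp \<nu> (h + t *\<^sub>R w)) = perp w (perp \<nu> h)" "perp w (perp \<nu> (h + t *\<^sub>R \<nu>)) = perp w (perp \<nu> h)"
  using assms by (auto simp: perp_add perp_scaleR perp_self perp_id inner_commute)

text \<open>Two orthogonal slabs model Lebesgue measure on the subspace of codimension two
  orthogonal to \<open>\<nu>\<close> and \<open>w\<close>; after a dilation each slab takes back one
  factor \<open>c\<close>.\<close>

lemma nn_integral_slab2_scale: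
  fixes \<Phi> :: "'a::euclidean_space \<Rightarrow> ennreal"
  assumes [measurable]: "\<Phi> \<in> borel_measurable borel" and \<nu>: "norm \<nu> = 1" and w: "norm w = 1" "w \<bullet> \<nu> = 0" and c: "c > 0"
    and d: "DIM('a) \<ge> 2"
  shows "(\<integral>\<^sup>+h. indicator (slab w) h * (indicator (slab \<nu>) h * \<Phi> (perp w (perp \<nu> h))) \<partial>lborel) =
     ennreal (c ^ (DIM('a) - 2)) * (\<integral>\<^sup>+h. indicator (slab w) h * (indicator (slab \<nu>) h * \<Phi> (c *\<^sub>R perp w (perp \<nu> h))) \<partial>lborel)"
proof -
  define T where "T v = {h :: 'a. \<bar>h \<bullet> v\<bar> < 1 / (2 * c)}" for v
  have [measurable]: "T v \<in> sets borel" for v unfolding T_def by measurable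
  define I where "I = (\<integral>\<^sup>+h. indicator (slab w) h * (indicator (slab \<nu>) h * \<Phi> (c *\<^sub>R perp w (perp \<nu> h))) \<partial>lborel)"
  have nw: "\<nu> \<bullet> w = 0" using w by (simp add: inner_commute)
  have "(\<integral>\<^sup>+h. indicator (slab w) h * (indicator (slab \<nu>) h * \<Phi> (perp w (perp \<nu> h))) \<partial>lborel) =
    ennreal (\<bar>c\<bar> ^ DIM('a)) * (\<integral>\<^sup>+h. indicator (slab w) (c *\<^sub>R h) * (indicator (slab \<nu>) (c *\<^sub>R h) * \<Phi> (perp w (perp \<nu> (c *\<^sub>R h)))) \<partial>lborel)"
    by (rule nn_integral_lborel_scale) (use c in auto)
  also have "(\<integral>\<^sup>+h. indicator (slab w) (c *\<^sub>R h) * (indicator (slab \<nu>) (c *\<^sub>R h) * \<Phi> (perp w (perp \<nu> (c *\<^sub>R h)))) \<partial>lborel) =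
    (\<integral>\<^sup>+h. indicator (T w) h * (indicator (T \<nu>) h * \<Phi> (c *\<^sub>R perp w (perp \<nu> h))) \<partial>lborel)"
    using c by (intro nn_integral_cong) (auto simp: perp_scaleR slab_def T_def indicator_def abs_mult field_simps)
  also have "\<dots> = ennreal (2 * (1 / (2 * c))) * (\<integral>\<^sup>+h. indicator (slab w) h * (indicator (T \<nu>) h * \<Phi> (c *\<^sub>R perp w (perp \<nu> h))) \<partial>lborel)"
    unfolding T_def[of w]
    by (rule nn_integral_slab_width)
       (use c \<nu> w in \<open>auto simp: perp_perp_translate T_def indicator_def inner_add_left\<close>)
  also have "(\<integral>\<^sup>+h. indicator (slab w) h * (indicator (T \<nu>) h * \<Phi> (c *\<^sub>R perp w (perp \<nu> h))) \<partial>lborel)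
      = (\<integral>\<^sup>+h. indicator (T \<nu>) h * (indicator (slab w) h * \<Phi> (c *\<^sub>R perp w (perp \<nu> h))) \<partial>lborel)"
    by (simp add: mult_ac)
  also have "\<dots> = ennreal (2 * (1 / (2 * c))) * (\<integral>\<^sup>+h. indicator (slab \<nu>) h * (indicator (slab w) h * \<Phi> (c *\<^sub>R perp w (perp \<nu> h))) \<partial>lborel)"
    unfolding T_def
    by (rule nn_integral_slab_width)
       (use c \<nu> w nw in \<open>auto simp: perp_perp_translate slab_def indicator_def inner_add_left\<close>)
  also have "(\<integral>\<^sup>+h. indicator (slab \<nu>) h * (indicator (slab w) h * \<Phi> (c *\<^sub>R perp w (perp \<nu> h))) \<partial>lborel) = I"
    unfolding I_def by (simp add: mult_ac)
  also have "ennreal (\<bar>c\<bar> ^ DIM('a)) * (ennreal (2 * (1 / (2 * c))) * (ennreal (2 * (1 / (2 * c))) * I)) =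
      ennreal (\<bar>c\<bar> ^ DIM('a) * ((2 * (1 / (2 * c))) * (2 * (1 / (2 * c))))) * I"
    using c by (subst (1 2) ennreal_mult) (auto simp: mult.assoc)
  also have "\<bar>c\<bar> ^ DIM('a) * ((2 * (1 / (2 * c))) * (2 * (1 / (2 * c)))) = c ^ (DIM('a) - 2)"
    using c d by (simp add: power_diff power2_eq_square)
  finally show ?thesis unfolding I_def .
qed

text \<open>Fubini inside the hyperplane: \<open>w\<close> is orthogonal to \<open>\<nu>\<close>, so
  moving along \<open>w\<close> does not leave or enter \<open>slab \<nu>\<close>.\<close>

lemma nn_integral_slab_slice:
  fixes \<Phi> :: "'a::euclidean_space \<Rightarrow> ennreal"
  assumes [measurable]: "\<Phi> \<in> borel_measurable borel" and \<nu>: "norm \<nu> = 1" and w: "norm w = 1" "w \<bullet> \<nu> = 0"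
  shows "(\<integral>\<^sup>+h. indicator (slab \<nu>) h * \<Phi> (perp \<nu> h) \<partial>lborel) =
    (\<integral>\<^sup>+h. indicator (slab w) h * (indicator (slab \<nu>) h * (\<integral>\<^sup>+u. \<Phi> (perp w (perp \<nu> h) + u *\<^sub>R w) \<partial>lborel)) \<partial>lborel)"
proof -
  have nw: "\<nu> \<bullet> w = 0" using w by (simp add: inner_commute)
  have 1: "indicator (slab \<nu>) (perp w h + u *\<^sub>R w) = (indicator (slab \<nu>) h :: ennreal)" for h :: 'a and u
    using w by (simp add: slab_def perp_def indicator_def inner_add_left inner_diff_left)
  have 2: "perp \<nu> (perp w h + u *\<^sub>R w) = perp w (perp \<nu> h) + u *\<^sub>R w" for h u
    using w nw by (simp add: perp_def algebra_simps)
  show ?thesis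
    apply (subst nn_integral_slice[OF _ w(1)])
     apply measurable
    apply (simp only: 1 2)
    apply (subst nn_integral_cmult)
     apply measurable
    done
qed

text \<open>Slicing a ball along \<open>e\<close> expresses its volume as a Beta integral times the volume \<open>X\<close> of the unit
  ball one dimension lower; comparison with the recursion for \<open>unit_ball_vol\<close> determines \<open>X\<close>.\<close>
lemma beta_step:
  fixes Wt :: "'a::euclidean_space \<Rightarrow> ennreal" and n :: "'a \<Rightarrow> real"
  assumes [measurable]: "Wt \<in> borel_measurable borel" "n \<in> borel_measurable borel"
    and e: "norm e = 1" and inv: "\<And>h t. Wt (h + t *\<^sub>R e) = Wt h"
    and n0: "\<And>h. n h \<ge> 0"
    and n: "\<And>h t. (n (perp e h + t *\<^sub>R e))\<^sup>2 = (n (perp e h))\<^sup>2 + t\<^sup>2"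
    and sc: "\<And>R. R > 0 \<Longrightarrow> (\<integral>\<^sup>+h. indicator (slab e) h * (Wt h * indicator {h. n (perp e h) \<le> R} h) \<partial>lborel)
       = ennreal (R ^ k) * X"
    and Y: "(\<integral>\<^sup>+h. Wt h * indicator {h. n h \<le> 1} h \<partial>lborel) = ennreal (unit_ball_vol (real (Suc k)))"
  shows "X = ennreal (unit_ball_vol (real k))"
proof -
  have inv': "Wt (perp e h + t *\<^sub>R e) = Wt h" for h t
    using inv[of h "t - h \<bullet> e"] by (simp add: perp_def algebra_simps)
  have "(\<integral>\<^sup>+h. Wt h * indicator {h. n h \<le> 1} h \<partial>lborel) =
     (\<integral>\<^sup>+h. indicator (slab e) h * (\<integral>\<^sup>+t. Wt h * (if (n (perp e h))\<^sup>2 + t\<^sup>2 \<le> 1 then 1 else 0) \<partial>lborel) \<partial>lborel)"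
  proof (subst nn_integral_slice[OF _ e])
    have *: "indicator {h. n h \<le> 1} (perp e h + t *\<^sub>R e) = (if (n (perp e h))\<^sup>2 + t\<^sup>2 \<le> 1 then 1 else 0 :: ennreal)" for h t
      unfolding n[symmetric] using n0[of "perp e h + t *\<^sub>R e"]
      by (simp add: indicator_def abs_square_le_1)
    show "(\<integral>\<^sup>+ h. indicator (slab e) h * (\<integral>\<^sup>+ t. Wt (perp e h + t *\<^sub>R e) * indicator {h. n h \<le> 1} (perp e h + t *\<^sub>R e) \<partial>lborel) \<partial>lborel) =
      (\<integral>\<^sup>+h. indicator (slab e) h * (\<integral>\<^sup>+t. Wt h * (if (n (perp e h))\<^sup>2 + t\<^sup>2 \<le> 1 then 1 else 0) \<partial>lborel) \<partial>lborel)"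
      by (simp only: * inv')
  qed measurable
  also have "\<dots> = (\<integral>\<^sup>+h. \<integral>\<^sup>+t. indicator (slab e) h * (Wt h * (if (n (perp e h))\<^sup>2 + t\<^sup>2 \<le> 1 then 1 else 0)) \<partial>lborel \<partial>lborel)"
    by (intro nn_integral_cong nn_integral_cmult[symmetric]) measurable
  also have "\<dots> = (\<integral>\<^sup>+t. \<integral>\<^sup>+h. indicator (slab e) h * (Wt h * (if (n (perp e h))\<^sup>2 + t\<^sup>2 \<le> 1 then 1 else 0)) \<partial>lborel \<partial>lborel)"
    by (rule lborel_pair.Fubini') measurable
  also have "\<dots> = (\<integral>\<^sup>+t. indicator {-1..1} t * sqrt (1 - t\<^sup>2) ^ k * X \<partial>lborel)"
  proof (rule nn_integral_cong_AE)
    \<comment> \<open>At \<open>t = 1\<close> and \<open>t = -1\<close> the radius of the slice may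
      be zero, which \<open>sc\<close> does not cover; two points are negligible.\<close>
    have "AE t in lborel. t \<noteq> (1::real) \<and> t \<noteq> -1"
      using AE_lborel_singleton[of "1::real"] AE_lborel_singleton[of "-1::real"] by auto
    then show "AE t in lborel. (\<integral>\<^sup>+h. indicator (slab e) h * (Wt h * (if (n (perp e h))\<^sup>2 + t\<^sup>2 \<le> 1 then 1 else 0)) \<partial>lborel)
        = indicator {-1..1} t * sqrt (1 - t\<^sup>2) ^ k * X"
    proof eventually_elim
      case (elim t)
      show ?case
      proof (cases "\<bar>t\<bar> < 1")
        case True
        then have t: "t\<^sup>2 < 1" by (simp add: abs_square_less_1)
        have "(n (perp e h))\<^sup>2 + t\<^sup>2 \<le> 1 \<longleftrightarrow> n (perp e h) \<le> sqrt (1 - t\<^sup>2)" for h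
          using n0[of "perp e h"] t
          by (metis diff_ge_0_iff_ge le_diff_eq less_eq_real_def real_le_rsqrt real_sqrt_ge_0_iff real_sqrt_le_iff real_sqrt_pow2 real_sqrt_unique)
        then have "(\<integral>\<^sup>+h. indicator (slab e) h * (Wt h * (if (n (perp e h))\<^sup>2 + t\<^sup>2 \<le> 1 then 1 else 0)) \<partial>lborel)
          = (\<integral>\<^sup>+h. indicator (slab e) h * (Wt h * indicator {h. n (perp e h) \<le> sqrt (1 - t\<^sup>2)} h) \<partial>lborel)"
          by (auto simp: indicator_def intro!: nn_integral_cong)
        also have "\<dots> = ennreal (sqrt (1 - t\<^sup>2) ^ k) * X" using t by (intro sc) auto
        finally show ?thesis using True by (auto simp: indicator_def)
      next
        case False
        then have "1 < \<bar>t\<bar>" using elim by (auto simp: abs_if split: if_splits)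
        then have "1 < t\<^sup>2" by (metis abs_square_le_1 not_le)
        then have "\<not> (n (perp e h))\<^sup>2 + t\<^sup>2 \<le> 1" for h
          by (smt (verit) zero_le_power2)
        with \<open>1 < \<bar>t\<bar>\<close> show ?thesis by (auto simp: indicator_def)
      qed
    qed
  qed
  also have "\<dots> = (\<integral>\<^sup>+t. indicator {-1..1} t * sqrt (1 - t\<^sup>2) ^ k \<partial>lborel) * X"
    by (rule nn_integral_multc) measurable
  also have "(\<integral>\<^sup>+t. indicator {-1..1} t * sqrt (1 - t\<^sup>2) ^ k \<partial>lborel) = ennreal (Beta (1/2) (real k / 2 + 1))"
    by (rule emeasure_cball_aux_integral)
  finally have "ennreal (unit_ball_vol (real (Suc k))) = ennreal (Beta (1/2) (real k / 2 + 1)) * X"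
    unfolding Y .
  moreover have "unit_ball_vol (real (Suc k)) = Beta (1/2) (real k / 2 + 1) * unit_ball_vol (real k)"
    by (auto simp: unit_ball_vol_def Beta_def Gamma_eq_zero_iff field_simps
          Gamma_one_half_real powr_half_sqrt [symmetric] powr_add [symmetric])
  moreover have B: "Beta (1/2) (real k / 2 + 1) > 0"
    by (auto simp: Beta_def intro!: divide_pos_pos mult_pos_pos Gamma_real_pos)
  ultimately have "ennreal (Beta (1/2) (real k / 2 + 1)) * X = ennreal (Beta (1/2) (real k / 2 + 1)) * ennreal (unit_ball_vol (real k))"
    by (simp add: ennreal_mult')
  with B show ?thesis by (subst (asm) ennreal_mult_cancel_left) auto
qed

lemma nn_integral_slab_ball:
  fixes \<nu> :: "'a::euclidean_space"
  assumes \<nu>: "norm \<nu> = 1"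
  shows "(\<integral>\<^sup>+h. indicator (slab \<nu>) h * indicator {h. norm (perp \<nu> h) \<le> 1} h \<partial>lborel) = ennreal (unit_ball_vol (real (DIM('a) - 1)))"
proof (rule beta_step[where Wt="\<lambda>_. 1" and n=norm and e=\<nu>])
  show "(norm (perp \<nu> h + t *\<^sub>R \<nu>))\<^sup>2 = (norm (perp \<nu> h))\<^sup>2 + t\<^sup>2" for h t
    using \<nu> norm_perp[of \<nu> "perp \<nu> h + t *\<^sub>R \<nu>"] perp_inner[OF \<nu>, of h]
    by (simp add: perp_add perp_scaleR perp_self perp_id inner_add_left dot_square_norm)
  show "(\<integral>\<^sup>+ h. indicator (slab \<nu>) h * (1 * indicator {h. norm (perp \<nu> h) \<le> R} h) \<partial>lborel) =
     ennreal (R ^ (DIM('a) - 1)) * (\<integral>\<^sup>+h. indicator (slab \<nu>) h * indicator {h. norm (perp \<nu> h) \<le> 1} h \<partial>lborel)" if R: "R > 0" for R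
    using nn_integral_slab_scale[of "indicator {h. norm h \<le> R}" \<nu> R] R \<nu>
    by (simp add: indicator_def)
  have "(\<integral>\<^sup>+ h. 1 * indicator {h::'a. norm h \<le> 1} h \<partial>lborel) = emeasure lborel (cball (0::'a) 1)"
    by (simp add: cball_def dist_norm)
  then show "(\<integral>\<^sup>+ h. 1 * indicator {h::'a. norm h \<le> 1} h \<partial>lborel) = ennreal (unit_ball_vol (real (Suc (DIM('a) - 1))))"
    by (simp add: emeasure_cball Suc_diff_le DIM_positive)
qed (use \<nu> in auto)

text \<open>The slicing step once more, now along \<open>w\<close> inside the hyperplane: the weight
  is the indicator of \<open>slab \<nu>\<close>, invariant along \<open>w\<close>, and the ball
  volume of the hyperplane plays the role of the known volume.\<close>

lemma nn_integral_slab2_ball: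
  fixes \<nu> :: "'a::euclidean_space"
  assumes \<nu>: "norm \<nu> = 1" and w: "norm w = 1" "w \<bullet> \<nu> = 0" and d: "DIM('a) \<ge> 2" and R: "R > 0"
  shows "(\<integral>\<^sup>+h. indicator (slab w) h * (indicator (slab \<nu>) h * indicator {y. norm y \<le> R} (perp w (perp \<nu> h))) \<partial>lborel)
    = ennreal (unit_ball_vol (real (DIM('a) - 2)) * R ^ (DIM('a) - 2))"
proof -
  define X where "X = (\<integral>\<^sup>+h. indicator (slab w) h * (indicator (slab \<nu>) h * indicator {y. norm y \<le> 1} (perp w (perp \<nu> h))) \<partial>lborel)"
  have nw: "\<nu> \<bullet> w = 0" using w by (simp add: inner_commute)
  have sc: "(\<integral>\<^sup>+h. indicator (slab w) h * (indicator (slab \<nu>) h * indicator {y. norm y \<le> R} (perp w (perp \<nu> h))) \<partial>lborel)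
      = ennreal (R ^ (DIM('a) - 2)) * X" if R: "R > 0" for R
    using nn_integral_slab2_scale[of "indicator {h. norm h \<le> R}" \<nu> w R] R \<nu> w d
    by (simp add: indicator_def X_def)
  have comm: "perp \<nu> (perp w h) = perp w (perp \<nu> h)" for h
    using w nw by (simp add: perp_def algebra_simps)
  have "X = ennreal (unit_ball_vol (real (DIM('a) - 2)))"
  proof (rule beta_step[where Wt="indicator (slab \<nu>)" and n="\<lambda>h. norm (perp \<nu> h)" and e=w])
    show "(norm (perp \<nu> (perp w h + t *\<^sub>R w)))\<^sup>2 = (norm (perp \<nu> (perp w h)))\<^sup>2 + t\<^sup>2" for h t
      using w norm_perp[OF w(1), of "perp w (perp \<nu> h) + t *\<^sub>R w"] perp_inner[OF w(1), of "perp \<nu> h"]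
      by (simp add: perp_add perp_scaleR perp_self perp_id inner_add_left dot_square_norm comm)
    show "(\<integral>\<^sup>+ h. indicator (slab w) h * (indicator (slab \<nu>) h * indicator {h. norm (perp \<nu> (perp w h)) \<le> R} h) \<partial>lborel) =
       ennreal (R ^ (DIM('a) - 2)) * X" if "R > 0" for R
      using sc[OF that] by (simp add: indicator_def comm)
    show "(\<integral>\<^sup>+ h. indicator (slab \<nu>) h * indicator {h. norm (perp \<nu> h) \<le> 1} h \<partial>lborel) =
        ennreal (unit_ball_vol (real (Suc (DIM('a) - 2))))"
      using nn_integral_slab_ball[OF \<nu>] d by (simp add: Suc_diff_le numeral_2_eq_2)
    show "indicator (slab \<nu>) (h + t *\<^sub>R w) = (indicator (slab \<nu>) h :: ennreal)" for h t
      by (rule perp_slab_translate) (rule w)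
  qed (use w in auto)
  then show ?thesis using sc[OF R] R by (simp add: ennreal_mult' mult.commute)
qed

text \<open>In a space of dimension \<open>DIM('a) - 1\<close> the solid cone over a set of unit
  directions has volume equal to the surface area divided by the dimension. The scale factor undoes
  this division, so this is the surface measure of the unit sphere of the hyperplane.\<close>

definition cone_measure :: "'a::euclidean_space \<Rightarrow> 'a measure" where
  "cone_measure \<nu> = scale_measure (of_nat (DIM('a) - 1))
     (distr (density lborel (\<lambda>h. indicator (slab \<nu>) h * indicator {h. norm (perp \<nu> h) \<le> 1} h)) borel (\<lambda>h. sgn (perp \<nu> h)))"

lemma sets_cone_measure [simp, measurable_cong]: "sets (cone_measure \<nu>) = sets borel"
  by (simp add: cone_measure_def)

lemma space_cone_measure [simp]: "space (cone_measure \<nu>) = UNIV"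
  by (simp add: cone_measure_def space_scale_measure)

lemma nn_integral_cone_measure:
  fixes \<nu> :: "'a::euclidean_space"
  assumes [measurable]: "\<psi> \<in> borel_measurable borel"
  shows "(\<integral>\<^sup>+\<omega>. \<psi> \<omega> \<partial>cone_measure \<nu>) = of_nat (DIM('a) - 1) *
     (\<integral>\<^sup>+h. indicator (slab \<nu>) h * (indicator {y. norm y \<le> 1} (perp \<nu> h) * \<psi> (sgn (perp \<nu> h))) \<partial>lborel)"
  unfolding cone_measure_def
  apply (subst nn_integral_scale_measure)
   apply measurable
  apply (subst nn_integral_distr)
    apply measurable
  apply (subst nn_integral_density)
    apply measurable
  apply (simp add: mult_ac indicator_def)
  done

text \<open>With the angular weight \<open>\<psi>\<close> put into the measure \<open>M\<close>, the
  mass of the ball of radius \<open>c\<close> is a multiple of \<open>c ^ (DIM('a) - 1)\<close>,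
  because dilations do not change \<open>sgn\<close>. The bound \<open>B\<close> makes the multiple
  finite, so that the radial formula applies.\<close>

lemma nn_integral_polar:
  fixes \<nu> :: "'a::euclidean_space"
  assumes [measurable]: "\<psi> \<in> borel_measurable borel" "\<kappa> \<in> borel_measurable borel"
    and \<nu>: "norm \<nu> = 1" and d: "DIM('a) \<ge> 2" and bd: "\<And>\<omega>. \<psi> \<omega> \<le> ennreal B"
  shows "(\<integral>\<^sup>+h. indicator (slab \<nu>) h * (\<psi> (sgn (perp \<nu> h)) * \<kappa> (norm (perp \<nu> h))) \<partial>lborel) =
    (\<integral>\<^sup>+\<omega>. \<psi> \<omega> \<partial>cone_measure \<nu>) * (\<integral>\<^sup>+\<rho>. ennreal (\<rho> ^ (DIM('a) - 2)) * indicator {0..} \<rho> * \<kappa> \<rho> \<partial>lborel)"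
proof -
  define M where "M = density lborel (\<lambda>h. indicator (slab \<nu>) h * \<psi> (sgn (perp \<nu> h)))"
  define X where "X = (\<integral>\<^sup>+h. indicator (slab \<nu>) h * (indicator {y. norm y \<le> 1} (perp \<nu> h) * \<psi> (sgn (perp \<nu> h))) \<partial>lborel)"
  have sX: "(\<integral>\<^sup>+\<omega>. \<psi> \<omega> \<partial>cone_measure \<nu>) = of_nat (DIM('a) - 1) * X"
    unfolding X_def by (rule nn_integral_cone_measure) fact
  have "X \<le> (\<integral>\<^sup>+h. ennreal B * (indicator (slab \<nu>) h * indicator {h. norm (perp \<nu> h) \<le> 1} h) \<partial>lborel)"
    unfolding X_def using bd by (intro nn_integral_mono) (auto simp: indicator_def)
  also have "\<dots> = ennreal B * (\<integral>\<^sup>+h. (indicator (slab \<nu>) h * indicator {h. norm (perp \<nu> h) \<le> 1} h) \<partial>lborel)"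
    by (rule nn_integral_cmult) measurable
  also have "\<dots> < top" unfolding nn_integral_slab_ball[OF \<nu>] by (simp add: ennreal_mult_less_top)
  finally obtain C where C: "X = ennreal C" "C \<ge> 0" by (cases X) auto
  have "(\<integral>\<^sup>+h. indicator (slab \<nu>) h * (\<psi> (sgn (perp \<nu> h)) * \<kappa> (norm (perp \<nu> h))) \<partial>lborel) = (\<integral>\<^sup>+h. \<kappa> (norm (perp \<nu> h)) \<partial>M)"
    unfolding M_def by (subst nn_integral_density) (auto simp: mult_ac)
  also have "\<dots> = (\<integral>\<^sup>+\<rho>. ennreal C * (ennreal (real (DIM('a) - 1) * \<rho> ^ (DIM('a) - 1 - 1)) * indicator {0..} \<rho>) * \<kappa> \<rho> \<partial>lborel)"
  proof (rule nn_integral_radial)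
    fix c :: real assume c: "c > 0"
    have "emeasure M {x \<in> space M. norm (perp \<nu> x) \<le> c} =
       (\<integral>\<^sup>+h. indicator (slab \<nu>) h * \<psi> (sgn (perp \<nu> h)) * indicator {h. norm (perp \<nu> h) \<le> c} h \<partial>lborel)"
      unfolding M_def by (subst emeasure_density) auto
    also have "\<dots> = (\<integral>\<^sup>+h. indicator (slab \<nu>) h * (indicator {y. norm y \<le> c} (perp \<nu> h) * \<psi> (sgn (perp \<nu> h))) \<partial>lborel)"
      by (simp add: indicator_def mult_ac)
    also have "\<dots> = ennreal (c ^ (DIM('a) - 1)) *
       (\<integral>\<^sup>+h. indicator (slab \<nu>) h * (indicator {y. norm y \<le> c} (c *\<^sub>R perp \<nu> h) * \<psi> (sgn (c *\<^sub>R perp \<nu> h))) \<partial>lborel)"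
      by (rule nn_integral_slab_scale) (use \<nu> c in auto)
    also have "(\<integral>\<^sup>+h. indicator (slab \<nu>) h * (indicator {y. norm y \<le> c} (c *\<^sub>R perp \<nu> h) * \<psi> (sgn (c *\<^sub>R perp \<nu> h))) \<partial>lborel) = X"
      unfolding X_def using c by (simp add: indicator_def sgn_scaleR)
    finally show "emeasure M {x \<in> space M. norm (perp \<nu> x) \<le> c} = ennreal (C * c ^ (DIM('a) - 1))"
      using c C by (simp add: ennreal_mult' mult.commute)
  qed (use C d in \<open>auto simp: M_def\<close>)
  also have "\<dots> = (\<integral>\<^sup>+\<rho>. (of_nat (DIM('a) - 1) * X) * (ennreal (\<rho> ^ (DIM('a) - 2)) * indicator {0..} \<rho> * \<kappa> \<rho>) \<partial>lborel)"
    by (intro nn_integral_cong) (auto simp: C ennreal_mult' ennreal_of_nat_eq_real_of_nat mult_ac indicator_def numeral_2_eq_2)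
  also have "\<dots> = (of_nat (DIM('a) - 1) * X) * (\<integral>\<^sup>+\<rho>. ennreal (\<rho> ^ (DIM('a) - 2)) * indicator {0..} \<rho> * \<kappa> \<rho> \<partial>lborel)"
    by (rule nn_integral_cmult) measurable
  finally show ?thesis unfolding sX .
qed

lemma emeasure_cone_measure_finite:
  fixes \<nu> :: "'a::euclidean_space"
  assumes "norm \<nu> = 1"
  shows "emeasure (cone_measure \<nu>) A < top"
proof -
  have "emeasure (cone_measure \<nu>) A \<le> emeasure (cone_measure \<nu>) UNIV"
    by (intro emeasure_mono) (auto simp: sets_eq_imp_space_eq[OF sets_cone_measure])
  also have "\<dots> = (\<integral>\<^sup>+\<omega>. 1 \<partial>cone_measure \<nu>)" by simp
  also have "\<dots> < top"
    using nn_integral_slab_ball[OF assms]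
    by (subst nn_integral_cone_measure) (auto simp: ennreal_mult_less_top indicator_def of_nat_less_top)
  finally show ?thesis .
qed

text \<open>A nonzero vector of the hyperplane has its direction on the equator; the exception is
  \<open>sgn 0 = 0\<close>. The line \<open>perp \<nu> h = 0\<close> has finite hyperplane mass
  \<open>X\<close> that dilation by 2 multiplies by \<open>2 ^ (DIM('a) - 1) > 1\<close>, so
  \<open>X = 0\<close>.\<close>

lemma cone_measure_concentrated:
  fixes \<nu> :: "'a::euclidean_space"
  assumes \<nu>: "norm \<nu> = 1" and d: "DIM('a) \<ge> 2"
  shows "emeasure (cone_measure \<nu>) (- {\<omega>. norm \<omega> = 1 \<and> \<omega> \<bullet> \<nu> = 0}) = 0"
proof -
  define X where "X = (\<integral>\<^sup>+h. indicator (slab \<nu>) h * indicator {0} (perp \<nu> h) \<partial>lborel)"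
  have "X = ennreal (2 ^ (DIM('a) - 1)) * (\<integral>\<^sup>+h. indicator (slab \<nu>) h * indicator {0} (2 *\<^sub>R perp \<nu> h) \<partial>lborel)"
    unfolding X_def by (rule nn_integral_slab_scale) (use \<nu> in auto)
  also have "(\<integral>\<^sup>+h. indicator (slab \<nu>) h * indicator {0} (2 *\<^sub>R perp \<nu> h) \<partial>lborel) = X"
    unfolding X_def by (simp add: indicator_def)
  finally have XX: "X = ennreal (2 ^ (DIM('a) - 1)) * X" .
  have "X \<le> (\<integral>\<^sup>+h. indicator (slab \<nu>) h * indicator {h. norm (perp \<nu> h) \<le> 1} h \<partial>lborel)"
    unfolding X_def by (intro nn_integral_mono) (auto simp: indicator_def)
  also have "\<dots> < top" unfolding nn_integral_slab_ball[OF \<nu>] by simp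
  finally obtain c where c: "X = ennreal c" "c \<ge> 0" by (cases X) auto
  have "c = 2 ^ (DIM('a) - 1) * c"
    using XX c by (simp add: ennreal_mult'[symmetric])
  moreover have "(2::real) ^ (DIM('a) - 1) > 1" using d by (intro one_less_power) auto
  ultimately have "c = 0" by auto
  then have X0: "X = 0" using c by simp
  have [measurable]: "- {\<omega>. norm \<omega> = 1 \<and> \<omega> \<bullet> \<nu> = 0} \<in> sets borel"
    by measurable
  have "emeasure (cone_measure \<nu>) (- {\<omega>. norm \<omega> = 1 \<and> \<omega> \<bullet> \<nu> = 0})
     = (\<integral>\<^sup>+\<omega>. indicator (- {\<omega>. norm \<omega> = 1 \<and> \<omega> \<bullet> \<nu> = 0}) \<omega> \<partial>cone_measure \<nu>)"
    by simp
  also have "\<dots> = of_nat (DIM('a) - 1) *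
     (\<integral>\<^sup>+h. indicator (slab \<nu>) h * (indicator {y. norm y \<le> 1} (perp \<nu> h) * indicator (- {\<omega>. norm \<omega> = 1 \<and> \<omega> \<bullet> \<nu> = 0}) (sgn (perp \<nu> h))) \<partial>lborel)"
    by (rule nn_integral_cone_measure) measurable
  also have "\<dots> \<le> of_nat (DIM('a) - 1) * X"
    unfolding X_def using perp_inner[OF \<nu>]
    by (intro mult_left_mono nn_integral_mono) (auto simp: indicator_def norm_sgn sgn_div_norm)
  finally show ?thesis using X0 by simp
qed

section \<open>The Prekopa-Leindler inequality\<close>


text \<open>One-dimensional Brunn-Minkowski glues two sets at their maxima. A Borel set need not
  have a maximum, so it is exhausted by pieces cut off at points of its own.\<close>

lemma real_set_cofinal_seq:
  fixes A :: "real set"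
  assumes "A \<noteq> {}"
  obtains a :: "nat \<Rightarrow> real" where "incseq a" "\<And>i. a i \<in> A" "A = (\<Union>i. A \<inter> {..a i})"
proof -
  have "\<exists>b::nat \<Rightarrow> real. (\<forall>i. b i \<in> A) \<and> (\<forall>x\<in>A. \<exists>i. x \<le> b i)"
  proof (cases "\<exists>m\<in>A. \<forall>x\<in>A. x \<le> m")
    case True
    then obtain m where "m \<in> A" "\<forall>x\<in>A. x \<le> m" by blast
    then show ?thesis by (intro exI[of _ "\<lambda>_. m"]) auto
  next
    case nomax: False
    show ?thesis
    proof (cases "bdd_above A")
      case True
      have "\<exists>y. y \<in> A \<and> y > Sup A - 1 / real (Suc i)" for i
        using less_cSup_iff[OF assms True, of "Sup A - 1 / real (Suc i)"] by auto
      then obtain b where b: "\<And>i. b i \<in> A \<and> b i > Sup A - 1 / real (Suc i)" by metis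
      have "\<exists>i. x \<le> b i" if "x \<in> A" for x
      proof -
        obtain y where "y \<in> A" "x < y" using nomax \<open>x \<in> A\<close> by (auto simp: not_le)
        then have "x < Sup A" using cSup_upper[OF _ True, of y] by auto
        then obtain i where "1 / real (Suc i) < Sup A - x"
          using nat_approx_posE[of "Sup A - x"] by auto
        with b[of i] show ?thesis by (intro exI[of _ i]) linarith
      qed
      with b show ?thesis by blast
    next
      case False
      then have "\<exists>y. y \<in> A \<and> y > real i" for i by (auto simp: bdd_above_def not_le)
      then obtain b where b: "\<And>i. b i \<in> A \<and> b i > real i" by metis
      have "\<exists>i. x \<le> b i" for x
        using b real_arch_simple[of x] by (meson less_imp_le order_trans)
      with b show ?thesis by blast
    qed
  qed
  then obtain b :: "nat \<Rightarrow> real" where b: "\<And>i. b i \<in> A" "\<And>x. x \<in> A \<Longrightarrow> \<exists>i. x \<le> b i" by blast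
  \<comment> \<open>Running maxima make the sequence monotone without leaving
    \<open>A\<close>.\<close>
  define a where "a i = Max (b ` {..i})" for i
  have "a i \<in> A" for i
    using Max_in[of "b ` {..i}"] b(1) unfolding a_def by fastforce
  moreover have "incseq a"
    unfolding incseq_def a_def by (auto intro!: Max_mono)
  moreover have "A = (\<Union>i. A \<inter> {..a i})"
  proof (intro equalityI subsetI)
    fix x assume x: "x \<in> A"
    then obtain i where "x \<le> b i" using b(2) by blast
    also have "b i \<le> a i" unfolding a_def by (intro Max_ge) auto
    finally show "x \<in> (\<Union>i. A \<inter> {..a i})" using x by blast
  qed auto
  ultimately show ?thesis using that by blast
qed

lemma ennreal_double_half: "2 * (ennreal (1/2) * x) = x"
proof -
  have "2 * (ennreal (1/2) * x) = (ennreal 2 * ennreal (1/2)) * x" by (simp add: mult.assoc)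
  also have "ennreal 2 * ennreal (1/2) = 1" by (subst ennreal_mult'[symmetric]) auto
  finally show ?thesis by simp
qed

lemma ennreal_mult_strict_mono':
  fixes a b c d :: ennreal
  assumes "a < b" "c < d"
  shows "a * c < b * d"
proof (cases "b = top \<or> d = top")
  case True
  have "a < top" "c < top" using assms less_le_trans top_greatest by blast+
  then have "a * c < top" by (simp add: ennreal_mult_less_top)
  moreover have "b * d = top" using True assms by (auto simp: ennreal_mult_eq_top_iff)
  ultimately show ?thesis by simp
next
  case False
  have "a < top" "c < top" using assms less_le_trans top_greatest by blast+
  with False show ?thesis using assms
    by (cases a; cases b; cases c; cases d)
       (auto simp: ennreal_mult[symmetric] ennreal_less_iff intro!: mult_strict_mono)
qed

lemma emeasure_lborel_real_affine_preimage:
  fixes c t :: real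
  assumes [measurable]: "D \<in> sets borel" and c: "c \<noteq> 0"
  shows "ennreal \<bar>c\<bar> * emeasure lborel {x. t + c * x \<in> D} = emeasure lborel D"
proof -
  have [measurable]: "{x. t + c * x \<in> D} \<in> sets borel" by measurable
  have "emeasure lborel D = (\<integral>\<^sup>+x. indicator D x \<partial>lborel)" by simp
  also have "\<dots> = ennreal \<bar>c\<bar> * (\<integral>\<^sup>+x. indicator D (t + c * x) \<partial>lborel)"
    by (rule nn_integral_real_affine) (use c in auto)
  also have "(\<integral>\<^sup>+x. indicator D (t + c * x) \<partial>lborel) = (\<integral>\<^sup>+x. indicator {x. t + c * x \<in> D} x \<partial>lborel)"
    by (auto simp: indicator_def intro!: nn_integral_cong)
  finally show ?thesis by simp
qed

text \<open>Let \<open>\<alpha>\<close> and \<open>\<beta>\<close> be the maxima of the truncated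
  sets. Pairing each point of \<open>A\<close> with \<open>\<beta>\<close> gives half differences at
  most \<open>(\<alpha> - \<beta>) / 2\<close>, pairing \<open>\<alpha>\<close> with each point of
  \<open>B\<close> gives half differences at least that. The two halved copies overlap in one point
  at most.\<close>

lemma brunn_minkowski_real:
  fixes A B C :: "real set"
  assumes [measurable]: "A \<in> sets borel" "B \<in> sets borel" "C \<in> sets borel"
    and ne: "A \<noteq> {}" "B \<noteq> {}"
    and sub: "\<And>x y. x \<in> A \<Longrightarrow> y \<in> B \<Longrightarrow> (x - y) / 2 \<in> C"
  shows "emeasure lborel A + emeasure lborel B \<le> 2 * emeasure lborel C"
proof -
  have step: "emeasure lborel (A \<inter> {..\<alpha>}) + emeasure lborel (B \<inter> {..\<beta>}) \<le> 2 * emeasure lborel C"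
    if ab: "\<alpha> \<in> A" "\<beta> \<in> B" for \<alpha> \<beta>
  proof -
    define D1 where "D1 = C \<inter> {..(\<alpha> - \<beta>) / 2}"
    define D2 where "D2 = C \<inter> {(\<alpha> - \<beta>) / 2<..}"
    have [measurable]: "D1 \<in> sets borel" "D2 \<in> sets borel" by (auto simp: D1_def D2_def)
    have "emeasure lborel (A \<inter> {..\<alpha>}) \<le> emeasure lborel {x. - \<beta> / 2 + (1/2) * x \<in> D1}"
    proof (rule emeasure_mono)
      show "A \<inter> {..\<alpha>} \<subseteq> {x. - \<beta> / 2 + (1/2) * x \<in> D1}"
        using sub[OF _ ab(2)] by (auto simp: D1_def field_simps)
    qed measurable
    also have "\<dots> = 2 * (ennreal \<bar>1/2\<bar> * emeasure lborel {x. - \<beta> / 2 + (1/2) * x \<in> D1})"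
      by (simp only: abs_divide abs_one abs_numeral ennreal_double_half)
    also have "ennreal \<bar>1/2\<bar> * emeasure lborel {x. - \<beta> / 2 + (1/2) * x \<in> D1} = emeasure lborel D1"
      by (rule emeasure_lborel_real_affine_preimage) auto
    finally have 1: "emeasure lborel (A \<inter> {..\<alpha>}) \<le> 2 * emeasure lborel D1" .
    \<comment> \<open>The singleton pays for the common endpoint
      \<open>(\<alpha> - \<beta>) / 2\<close>, which is counted in \<open>D1\<close> and excluded
      from \<open>D2\<close>.\<close>
    have "emeasure lborel (B \<inter> {..\<beta>}) \<le> emeasure lborel ({x. \<alpha> / 2 + (-1/2) * x \<in> D2} \<union> {\<beta>})"
    proof (rule emeasure_mono)
      have "B \<inter> {..\<beta>} - {\<beta>} \<subseteq> {x. \<alpha> / 2 + (-1/2) * x \<in> D2}"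
        using sub[OF ab(1)] by (auto simp: D2_def field_simps)
      then show "B \<inter> {..\<beta>} \<subseteq> {x. \<alpha> / 2 + (-1/2) * x \<in> D2} \<union> {\<beta>}" by blast
    qed measurable
    also have "\<dots> \<le> emeasure lborel {x. \<alpha> / 2 + (-1/2) * x \<in> D2} + emeasure lborel {\<beta>}"
      by (rule emeasure_subadditive) measurable
    also have "\<dots> = 2 * (ennreal \<bar>-1/2\<bar> * emeasure lborel {x. \<alpha> / 2 + (-1/2) * x \<in> D2})"
      by (simp only: abs_divide abs_minus_cancel abs_one abs_numeral ennreal_double_half emeasure_lborel_singleton add_0_right)
    also have "ennreal \<bar>-1/2\<bar> * emeasure lborel {x. \<alpha> / 2 + (-1/2) * x \<in> D2} = emeasure lborel D2"
      by (rule emeasure_lborel_real_affine_preimage) auto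
    finally have 2: "emeasure lborel (B \<inter> {..\<beta>}) \<le> 2 * emeasure lborel D2" .
    have "emeasure lborel D1 + emeasure lborel D2 = emeasure lborel (D1 \<union> D2)"
      by (rule plus_emeasure) (auto simp: D1_def D2_def)
    also have "D1 \<union> D2 = C" by (auto simp: D1_def D2_def)
    finally show ?thesis using add_mono[OF 1 2] by (simp add: distrib_left[symmetric])
  qed
  obtain a where a: "incseq a" "\<And>i. a i \<in> A" "A = (\<Union>i. A \<inter> {..a i})"
    using real_set_cofinal_seq[OF ne(1)] by blast
  obtain b where b: "incseq b" "\<And>i. b i \<in> B" "B = (\<Union>i. B \<inter> {..b i})"
    using real_set_cofinal_seq[OF ne(2)] by blast
  have A: "emeasure lborel A = (SUP i. emeasure lborel (A \<inter> {..a i}))"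
    using a(1) by (subst a(3), subst SUP_emeasure_incseq) (auto simp: incseq_def intro: order_trans)
  have B: "emeasure lborel B = (SUP i. emeasure lborel (B \<inter> {..b i}))"
    using b(1) by (subst b(3), subst SUP_emeasure_incseq) (auto simp: incseq_def intro: order_trans)
  have "emeasure lborel A + emeasure lborel B
     = (SUP i. emeasure lborel (A \<inter> {..a i}) + emeasure lborel (B \<inter> {..b i}))"
    unfolding A B
    by (rule ennreal_SUP_add[symmetric]) (use a(1) b(1) in \<open>force simp: incseq_def intro!: emeasure_mono\<close>)+
  also have "\<dots> \<le> 2 * emeasure lborel C"
    by (intro SUP_least step a b)
  finally show ?thesis .
qed

text \<open>Levels stop at 1 because Brunn-Minkowski needs nonempty superlevel sets. Functions
  bounded by 1 lose nothing under \<open>min 1\<close>, and for the majorant \<open>h\<close> the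
  loss goes in the harmless direction.\<close>

lemma layer_cake_min1:
  fixes f :: "real \<Rightarrow> ennreal"
  assumes [measurable]: "f \<in> borel_measurable borel"
  shows "(\<integral>\<^sup>+t. indicator {0<..<1} t * emeasure lborel {x. ennreal t < f x} \<partial>lborel)
     = (\<integral>\<^sup>+x. min 1 (f x) \<partial>lborel)"
proof -
  have "(\<integral>\<^sup>+t. indicator {0<..<1} t * emeasure lborel {x. ennreal t < f x} \<partial>lborel)
     = (\<integral>\<^sup>+t. \<integral>\<^sup>+x. indicator {0<..<1} t * (if ennreal t < f x then 1 else 0) \<partial>lborel \<partial>lborel)"
  proof (rule nn_integral_cong)
    fix t :: real
    have [measurable]: "{x. ennreal t < f x} \<in> sets borel" by measurable
    have "emeasure lborel {x. ennreal t < f x} = (\<integral>\<^sup>+x. indicator {x. ennreal t < f x} x \<partial>lborel)"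
      by simp
    also have "\<dots> = (\<integral>\<^sup>+x. (if ennreal t < f x then 1 else 0) \<partial>lborel)"
      by (auto simp: indicator_def intro!: nn_integral_cong)
    finally show "indicator {0<..<1} t * emeasure lborel {x. ennreal t < f x}
      = (\<integral>\<^sup>+x. indicator {0<..<1} t * (if ennreal t < f x then 1 else 0) \<partial>lborel)"
      by (simp add: nn_integral_cmult)
  qed
  also have "\<dots> = (\<integral>\<^sup>+x. \<integral>\<^sup>+t. indicator {0<..<1} t * (if ennreal t < f x then 1 else 0) \<partial>lborel \<partial>lborel)"
    by (rule lborel_pair.Fubini') measurable
  also have "\<dots> = (\<integral>\<^sup>+x. min 1 (f x) \<partial>lborel)"
  proof (rule nn_integral_cong)
    fix x
    show "(\<integral>\<^sup>+t. indicator {0<..<1} t * (if ennreal t < f x then 1 else 0) \<partial>lborel) = min 1 (f x)"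
    proof (cases "f x \<ge> 1")
      case True
      have "(\<integral>\<^sup>+t. indicator {0<..<1::real} t * (if ennreal t < f x then 1 else 0) \<partial>lborel)
        = (\<integral>\<^sup>+t. indicator {0<..<1::real} t \<partial>lborel)"
        using True by (intro nn_integral_cong) (auto simp: indicator_def dest!: order_trans[OF True] simp: not_less)
      with True show ?thesis by (simp add: min_def)
    next
      case False
      then obtain c where c: "f x = ennreal c" "0 \<le> c" "c < 1"
        by (cases "f x") (auto simp: not_le ennreal_less_one_iff)
      have "(\<integral>\<^sup>+t. indicator {0<..<1::real} t * (if ennreal t < f x then 1 else 0) \<partial>lborel)
        = (\<integral>\<^sup>+t. indicator {0<..<c} t \<partial>lborel)"
        using c by (intro nn_integral_cong) (auto simp: indicator_def ennreal_less_iff)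
      with c False show ?thesis by (simp add: min_def)
    qed
  qed
  finally show ?thesis .
qed

text \<open>If \<open>f x\<close> and \<open>g y\<close> exceed \<open>t\<close>, then so does
  \<open>h\<close> at the half difference. With both suprema equal to 1 the superlevel sets at every
  \<open>t < 1\<close> are nonempty, and integrating Brunn-Minkowski over \<open>t\<close> gives an
  arithmetic-mean inequality, stronger than the geometric one.\<close>

lemma prekopa_leindler_normalized:
  fixes f g h :: "real \<Rightarrow> ennreal"
  assumes [measurable]: "f \<in> borel_measurable borel" "g \<in> borel_measurable borel" "h \<in> borel_measurable borel"
    and le1: "\<And>x. f x \<le> 1" "\<And>x. g x \<le> 1"
    and sup: "\<And>t. t < 1 \<Longrightarrow> \<exists>x. t < f x" "\<And>t. t < 1 \<Longrightarrow> \<exists>x. t < g x"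
    and fgh: "\<And>x y. f x * g y \<le> (h ((x - y) / 2))\<^sup>2"
  shows "(\<integral>\<^sup>+x. f x \<partial>lborel) + (\<integral>\<^sup>+x. g x \<partial>lborel) \<le> 2 * (\<integral>\<^sup>+x. h x \<partial>lborel)"
proof -
  define lc where "lc f t = emeasure lborel {x. ennreal t < f x}" for f :: "real \<Rightarrow> ennreal" and t
  have lc_meas [measurable]: "lc u \<in> borel_measurable borel" if [measurable]: "u \<in> borel_measurable borel" for u
    unfolding lc_def by measurable
  have le: "lc f t + lc g t \<le> 2 * lc h t" if t: "0 < t" "t < 1" for t
    unfolding lc_def
  proof (rule brunn_minkowski_real)
    have "ennreal t < 1" using t by (simp add: ennreal_less_one_iff)
    then show "{x. ennreal t < f x} \<noteq> {}" "{x. ennreal t < g x} \<noteq> {}" using sup by blast+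
    fix x y assume xy: "x \<in> {x. ennreal t < f x}" "y \<in> {x. ennreal t < g x}"
    have "ennreal t * ennreal t < f x * g y"
      using xy by (intro ennreal_mult_strict_mono') auto
    also have "\<dots> \<le> (h ((x - y) / 2))\<^sup>2" by (rule fgh)
    finally have "(ennreal t)\<^sup>2 < (h ((x - y) / 2))\<^sup>2" by (simp add: power2_eq_square)
    then show "(x - y) / 2 \<in> {x. ennreal t < h x}"
      using power_mono[of "h ((x - y) / 2)" "ennreal t" 2] by (auto simp: not_less[symmetric])
  qed measurable
  have "(\<integral>\<^sup>+x. f x \<partial>lborel) + (\<integral>\<^sup>+x. g x \<partial>lborel)
     = (\<integral>\<^sup>+x. min 1 (f x) \<partial>lborel) + (\<integral>\<^sup>+x. min 1 (g x) \<partial>lborel)"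
    using le1 by (simp add: min_absorb2)
  also have "\<dots> = (\<integral>\<^sup>+t. indicator {0<..<1} t * lc f t \<partial>lborel) + (\<integral>\<^sup>+t. indicator {0<..<1} t * lc g t \<partial>lborel)"
    by (simp add: layer_cake_min1 lc_def)
  also have "\<dots> = (\<integral>\<^sup>+t. indicator {0<..<1} t * lc f t + indicator {0<..<1} t * lc g t \<partial>lborel)"
    by (rule nn_integral_add[symmetric]) measurable
  also have "\<dots> \<le> (\<integral>\<^sup>+t. 2 * (indicator {0<..<1} t * lc h t) \<partial>lborel)"
    using le by (intro nn_integral_mono) (auto simp: indicator_def)
  also have "\<dots> = 2 * (\<integral>\<^sup>+t. indicator {0<..<1} t * lc h t \<partial>lborel)"
    by (rule nn_integral_cmult) measurable
  also have "(\<integral>\<^sup>+t. indicator {0<..<1} t * lc h t \<partial>lborel) = (\<integral>\<^sup>+x. min 1 (h x) \<partial>lborel)"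
    by (simp add: layer_cake_min1 lc_def)
  also have "\<dots> \<le> (\<integral>\<^sup>+x. h x \<partial>lborel)"
    by (intro nn_integral_mono) auto
  finally show ?thesis by (simp add: mult_left_mono)
qed

text \<open>Dividing \<open>f\<close> and \<open>g\<close> by their suprema \<open>a\<close> and
  \<open>b\<close>, and \<open>h\<close> by \<open>sqrt (a * b)\<close>, preserves the hypothesis.
  The normalized inequality and \<open>4 * u * v \<le> (u + v) ^ 2\<close> then give the product
  form, in which the scaling factors cancel.\<close>

lemma prekopa_leindler_bounded:
  fixes f g h :: "real \<Rightarrow> ennreal"
  assumes [measurable]: "f \<in> borel_measurable borel" "g \<in> borel_measurable borel" "h \<in> borel_measurable borel"
    and bd: "\<And>x. f x \<le> ennreal N" "\<And>x. g x \<le> ennreal N"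
    and fgh: "\<And>x y. f x * g y \<le> (h ((x - y) / 2))\<^sup>2"
  shows "(\<integral>\<^sup>+x. f x \<partial>lborel) * (\<integral>\<^sup>+x. g x \<partial>lborel) \<le> (\<integral>\<^sup>+x. h x \<partial>lborel)\<^sup>2"
proof -
  have "(SUP x. f x) \<le> ennreal N" "(SUP x. g x) \<le> ennreal N" using bd by (auto intro: SUP_least)
  then have fin: "(SUP x. f x) < top" "(SUP x. g x) < top"
    using ennreal_less_top le_less_trans by blast+
  obtain a where a: "(SUP x. f x) = ennreal a" "a \<ge> 0" using fin(1) by (cases "SUP x. f x") auto
  obtain b where b: "(SUP x. g x) = ennreal b" "b \<ge> 0" using fin(2) by (cases "SUP x. g x") auto
  have fa: "f x \<le> ennreal a" for x using SUP_upper[of x UNIV f] a by auto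
  have gb: "g x \<le> ennreal b" for x using SUP_upper[of x UNIV g] b by auto
  show ?thesis
  proof (cases "a = 0 \<or> b = 0")
    case True
    with fa gb have "(\<forall>x. f x = 0) \<or> (\<forall>x. g x = 0)" by auto
    then show ?thesis by auto
  next
    case False
    then have pos: "a > 0" "b > 0" using a b by auto
    define q where "q = sqrt (a * b)"
    have q: "q > 0" "q * q = a * b" using pos by (auto simp: q_def)
    have sup1: "\<exists>x. t < ennreal (1/c) * u x"
      if "t < 1" and c: "c > 0" "(SUP x. u x) = ennreal c" for t c and u :: "real \<Rightarrow> ennreal"
    proof -
      have "(SUP x. ennreal (1/c) * u x) = ennreal (1/c) * ennreal c"
        unfolding c(2)[symmetric] by (rule SUP_mult_left_ennreal[symmetric])
      also have "\<dots> = 1" using c by (simp add: ennreal_mult'[symmetric])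
      finally show ?thesis using \<open>t < 1\<close> less_SUP_iff[of t "\<lambda>x. ennreal (1/c) * u x" UNIV] by auto
    qed
    have "(\<integral>\<^sup>+x. ennreal (1/a) * f x \<partial>lborel) + (\<integral>\<^sup>+x. ennreal (1/b) * g x \<partial>lborel)
        \<le> 2 * (\<integral>\<^sup>+x. ennreal (1/q) * h x \<partial>lborel)"
    proof (rule prekopa_leindler_normalized)
      show "ennreal (1/a) * f x \<le> 1" for x
        using mult_left_mono[OF fa[of x], of "ennreal (1/a)"] pos by (simp add: ennreal_mult'[symmetric])
      show "ennreal (1/b) * g x \<le> 1" for x
        using mult_left_mono[OF gb[of x], of "ennreal (1/b)"] pos by (simp add: ennreal_mult'[symmetric])
      fix x y
      have "ennreal (1/a) * f x * (ennreal (1/b) * g y) = ennreal (1/q) * ennreal (1/q) * (f x * g y)"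
        using pos q by (simp add: ennreal_mult'[symmetric] mult_ac)
      also have "\<dots> \<le> ennreal (1/q) * ennreal (1/q) * (h ((x - y) / 2))\<^sup>2"
        by (intro mult_left_mono fgh) auto
      finally show "ennreal (1/a) * f x * (ennreal (1/b) * g y) \<le> (ennreal (1/q) * h ((x - y) / 2))\<^sup>2"
        by (simp add: power2_eq_square mult_ac)
    qed (use sup1 a b pos in auto)
    then have main: "ennreal (1/a) * (\<integral>\<^sup>+x. f x \<partial>lborel) + ennreal (1/b) * (\<integral>\<^sup>+x. g x \<partial>lborel)
        \<le> 2 * (ennreal (1/q) * (\<integral>\<^sup>+x. h x \<partial>lborel))"
      by (simp add: nn_integral_cmult)
    show ?thesis
    proof (cases "(\<integral>\<^sup>+x. h x \<partial>lborel)")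
      case top
      then show ?thesis by (simp add: power2_eq_square)
    next
      case (real Z)
      then have "ennreal (1/a) * (\<integral>\<^sup>+x. f x \<partial>lborel) + ennreal (1/b) * (\<integral>\<^sup>+x. g x \<partial>lborel) < top"
        by (intro le_less_trans[OF main]) (simp add: ennreal_mult_less_top)
      then have "(\<integral>\<^sup>+x. f x \<partial>lborel) < top" "(\<integral>\<^sup>+x. g x \<partial>lborel) < top"
        using pos by (auto simp: ennreal_mult_less_top less_top)
      then obtain X Y where XY: "(\<integral>\<^sup>+x. f x \<partial>lborel) = ennreal X" "X \<ge> 0" "(\<integral>\<^sup>+x. g x \<partial>lborel) = ennreal Y" "Y \<ge> 0"
        by (cases "\<integral>\<^sup>+x. f x \<partial>lborel"; cases "\<integral>\<^sup>+x. g x \<partial>lborel") auto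
      have "ennreal (X / a + Y / b) \<le> ennreal (2 * (Z / q))"
        using main real XY pos q by (simp add: ennreal_mult'[symmetric] ennreal_plus[symmetric] flip: ennreal_numeral del: ennreal_plus)
      then have "X / a + Y / b \<le> 2 * (Z / q)" using real q by (subst (asm) ennreal_le_iff) auto
      moreover have "0 \<le> X / a + Y / b" using XY pos by auto
      ultimately have "(X / a + Y / b)\<^sup>2 \<le> (2 * (Z / q))\<^sup>2" by (rule power_mono)
      moreover have "4 * (X / a) * (Y / b) \<le> (X / a + Y / b)\<^sup>2"
        using zero_le_power2[of "X / a - Y / b"] unfolding power2_sum power2_diff by linarith
      ultimately have "4 * (X / a) * (Y / b) \<le> (2 * (Z / q))\<^sup>2" by linarith
      also have "\<dots> = 4 * (Z * Z) / (a * b)" using q by (simp add: power2_eq_square)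
      finally have "X * Y \<le> Z * Z" using pos by (simp add: field_simps)
      then show ?thesis using XY real by (simp add: power2_eq_square ennreal_mult'[symmetric])
    qed
  qed
qed

lemma nn_integral_SUP_min:
  fixes f :: "real \<Rightarrow> ennreal"
  assumes [measurable]: "f \<in> borel_measurable borel"
  shows "(\<integral>\<^sup>+x. f x \<partial>lborel) = (SUP n. (\<integral>\<^sup>+x. min (f x) (of_nat n) \<partial>lborel))"
proof -
  have "(SUP n. min c (of_nat n)) = c" for c :: ennreal
  proof -
    have "(SUP n. min c (of_nat n)) = min c (SUP n. of_nat n)"
      by (simp add: inf_SUP flip: inf_min)
    then show ?thesis by (simp add: ennreal_SUP_of_nat_eq_top)
  qed
  then have "(\<integral>\<^sup>+x. f x \<partial>lborel) = (\<integral>\<^sup>+x. (SUP n. min (f x) (of_nat n)) \<partial>lborel)" by simp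
  also have "\<dots> = (SUP n. (\<integral>\<^sup>+x. min (f x) (of_nat n) \<partial>lborel))"
    by (rule nn_integral_monotone_convergence_SUP)
       (auto simp: incseq_def le_fun_def min_le_iff_disj)
  finally show ?thesis .
qed

text \<open>Truncating \<open>f\<close> and \<open>g\<close> from above only decreases the left side
  of the hypothesis; monotone convergence removes the truncation.\<close>

lemma prekopa_leindler_real:
  fixes f g h :: "real \<Rightarrow> ennreal"
  assumes [measurable]: "f \<in> borel_measurable borel" "g \<in> borel_measurable borel" "h \<in> borel_measurable borel"
    and fgh: "\<And>x y. f x * g y \<le> (h ((x - y) / 2))\<^sup>2"
  shows "(\<integral>\<^sup>+x. f x \<partial>lborel) * (\<integral>\<^sup>+x. g x \<partial>lborel) \<le> (\<integral>\<^sup>+x. h x \<partial>lborel)\<^sup>2"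
proof -
  have "(\<integral>\<^sup>+x. min (f x) (of_nat i) \<partial>lborel) * (\<integral>\<^sup>+x. min (g x) (of_nat j) \<partial>lborel) \<le> (\<integral>\<^sup>+x. h x \<partial>lborel)\<^sup>2" for i j
  proof (rule prekopa_leindler_bounded[where N="real (max i j)"])
    fix x y
    show "min (f x) (of_nat i) \<le> ennreal (real (max i j))" "min (g x) (of_nat j) \<le> ennreal (real (max i j))"
      unfolding ennreal_of_nat_eq_real_of_nat by (auto intro!: min.coboundedI2 ennreal_leI)
    show "min (f x) (of_nat i) * min (g y) (of_nat j) \<le> (h ((x - y) / 2))\<^sup>2"
      by (rule order_trans[OF mult_mono fgh]) auto
  qed measurable
  then show ?thesis
    unfolding nn_integral_SUP_min[of f, simplified] nn_integral_SUP_min[of g, simplified]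
      SUP_mult_left_ennreal SUP_mult_right_ennreal
    by (intro SUP_least) auto
qed

text \<open>The hypothesis survives integrating out one coordinate: applied to one-dimensional
  slices, the inequality itself says that the slice integrals satisfy the same hypothesis in the
  remaining coordinates.\<close>

lemma prekopa_leindler_PiM:
  fixes f g h :: "('i \<Rightarrow> real) \<Rightarrow> ennreal"
  assumes "finite I"
    and "f \<in> borel_measurable (Pi\<^sub>M I (\<lambda>_. lborel))" "g \<in> borel_measurable (Pi\<^sub>M I (\<lambda>_. lborel))"
      "h \<in> borel_measurable (Pi\<^sub>M I (\<lambda>_. lborel))"
    and "\<And>x y. x \<in> extensional I \<Longrightarrow> y \<in> extensional I \<Longrightarrow> f x * g y \<le> (h (\<lambda>i\<in>I. (x i - y i) / 2))\<^sup>2"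
  shows "(\<integral>\<^sup>+x. f x \<partial>Pi\<^sub>M I (\<lambda>_. lborel)) * (\<integral>\<^sup>+x. g x \<partial>Pi\<^sub>M I (\<lambda>_. lborel)) \<le> (\<integral>\<^sup>+x. h x \<partial>Pi\<^sub>M I (\<lambda>_. lborel))\<^sup>2"
  using assms
proof (induction I arbitrary: f g h rule: finite_induct)
  case empty
  interpret product_sigma_finite "\<lambda>_::'i. lborel :: real measure" by standard
  have "(\<integral>\<^sup>+x. u x \<partial>Pi\<^sub>M {} (\<lambda>_. lborel :: real measure)) = u (\<lambda>_. undefined)" for u :: "('i \<Rightarrow> real) \<Rightarrow> ennreal"
    by (simp add: PiM_empty nn_integral_count_space_finite)
  moreover have "(\<lambda>i\<in>{}. ((\<lambda>_. undefined) i - (\<lambda>_. undefined) i) / 2) = (\<lambda>_::'i. undefined :: real)"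
    by (auto simp: restrict_def)
  ultimately show ?case using empty(4)[of "\<lambda>_. undefined" "\<lambda>_. undefined"] by (auto simp: restrict_def)
next
  case (insert i I)
  interpret product_sigma_finite "\<lambda>_::'i. lborel :: real measure" by standard
  note [measurable] = insert.prems(1-3)
  define sl where "sl u x = (\<integral>\<^sup>+t. u (x(i := t)) \<partial>lborel)" for u :: "('i \<Rightarrow> real) \<Rightarrow> ennreal" and x
  have sl: "(\<integral>\<^sup>+x. u x \<partial>Pi\<^sub>M (insert i I) (\<lambda>_. lborel)) = (\<integral>\<^sup>+x. sl u x \<partial>Pi\<^sub>M I (\<lambda>_. lborel))"
    if "u \<in> borel_measurable (Pi\<^sub>M (insert i I) (\<lambda>_. lborel))" for u
    unfolding sl_def by (rule product_nn_integral_insert) (use insert.hyps that in auto)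
  have slm [measurable]: "sl u \<in> borel_measurable (Pi\<^sub>M I (\<lambda>_. lborel))"
    if [measurable]: "u \<in> borel_measurable (Pi\<^sub>M (insert i I) (\<lambda>_. lborel))" for u
    unfolding sl_def by measurable
  have "(\<integral>\<^sup>+x. sl f x \<partial>Pi\<^sub>M I (\<lambda>_. lborel)) * (\<integral>\<^sup>+x. sl g x \<partial>Pi\<^sub>M I (\<lambda>_. lborel))
      \<le> (\<integral>\<^sup>+x. sl h x \<partial>Pi\<^sub>M I (\<lambda>_. lborel))\<^sup>2"
  proof (rule insert.IH)
    fix x y :: "'i \<Rightarrow> real" assume xy: "x \<in> extensional I" "y \<in> extensional I"
    have m: "(\<lambda>t. u (z(i := t))) \<in> borel_measurable borel"
      if [measurable]: "u \<in> borel_measurable (Pi\<^sub>M (insert i I) (\<lambda>_. lborel))" and z: "z \<in> extensional I" for u and z :: "'i \<Rightarrow> real"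
    proof -
      have "z \<in> space (Pi\<^sub>M I (\<lambda>_. lborel :: real measure))" using z by (simp add: space_PiM PiE_def)
      then have "(\<lambda>t. z(i := t)) \<in> lborel \<rightarrow>\<^sub>M Pi\<^sub>M (insert i I) (\<lambda>_. lborel :: real measure)"
        using insert.hyps by (intro measurable_component_update) auto
      then have "(\<lambda>t. u (z(i := t))) \<in> borel_measurable lborel"
        by (rule measurable_compose) (rule that(1))
      then show ?thesis by simp
    qed
    show "sl f x * sl g y \<le> (sl h (\<lambda>i\<in>I. (x i - y i) / 2))\<^sup>2"
      unfolding sl_def
    proof (rule prekopa_leindler_real)
      fix s t :: real
      have "f (x(i := s)) * g (y(i := t)) \<le> (h (\<lambda>j\<in>insert i I. ((x(i := s)) j - (y(i := t)) j) / 2))\<^sup>2"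
        using xy by (intro insert.prems(4)) (auto simp: extensional_def)
      also have "(\<lambda>j\<in>insert i I. ((x(i := s)) j - (y(i := t)) j) / 2) = (\<lambda>j\<in>I. (x j - y j) / 2)(i := (s - t) / 2)"
        using insert.hyps by (auto simp: fun_eq_iff restrict_def)
      finally show "f (x(i := s)) * g (y(i := t)) \<le> (h ((\<lambda>j\<in>I. (x j - y j) / 2)(i := (s - t) / 2)))\<^sup>2" .
    qed (rule m; use xy insert.prems(1-3) in \<open>simp add: extensional_def restrict_def\<close>)+
  qed measurable
  then show ?case by (simp add: sl insert.prems(1-3))
qed

theorem prekopa_leindler:
  fixes f g h :: "'a::euclidean_space \<Rightarrow> ennreal"
  assumes [measurable]: "f \<in> borel_measurable borel" "g \<in> borel_measurable borel" "h \<in> borel_measurable borel"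
    and fgh: "\<And>x y. f x * g y \<le> (h ((1/2) *\<^sub>R (x - y)))\<^sup>2"
  shows "(\<integral>\<^sup>+x. f x \<partial>lborel) * (\<integral>\<^sup>+x. g x \<partial>lborel) \<le> (\<integral>\<^sup>+x. h x \<partial>lborel)\<^sup>2"
proof -
  define \<iota> where "\<iota> x = (\<Sum>b\<in>Basis. x b *\<^sub>R b)" for x :: "'a \<Rightarrow> real"
  have [measurable]: "\<iota> \<in> borel_measurable (Pi\<^sub>M Basis (\<lambda>_. lborel))"
    unfolding \<iota>_def by measurable
  have eq: "(\<integral>\<^sup>+x. u x \<partial>lborel) = (\<integral>\<^sup>+x. u (\<iota> x) \<partial>Pi\<^sub>M Basis (\<lambda>_. lborel))"
    if [measurable]: "u \<in> borel_measurable borel" for u :: "'a \<Rightarrow> ennreal"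
    by (subst lborel_eq) (simp add: nn_integral_distr \<iota>_def[symmetric])
  show ?thesis
    unfolding eq[OF assms(1)] eq[OF assms(2)] eq[OF assms(3)]
  proof (rule prekopa_leindler_PiM)
    fix x y :: "'a \<Rightarrow> real"
    have "\<iota> (\<lambda>i\<in>Basis. (x i - y i) / 2) = (1/2) *\<^sub>R (\<iota> x - \<iota> y)"
      by (simp add: \<iota>_def scaleR_sum_right sum_subtractf[symmetric] scaleR_diff_left scaleR_diff_right diff_divide_distrib)
    then show "f (\<iota> x) * g (\<iota> y) \<le> (h (\<iota> (\<lambda>i\<in>Basis. (x i - y i) / 2)))\<^sup>2"
      using fgh[of "\<iota> x" "\<iota> y"] by simp
  qed auto
qed

text \<open>The inequality for \<open>f = g = indicator A\<close> and
  \<open>h = indicator C\<close>. The Borel set \<open>C\<close> stands in for the half difference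
  set of \<open>A\<close>, which may fail to be Borel.\<close>

corollary emeasure_half_difference_ge:
  fixes A C :: "'a::euclidean_space set"
  assumes [measurable]: "A \<in> sets borel" "C \<in> sets borel"
    and sub: "\<And>x y. x \<in> A \<Longrightarrow> y \<in> A \<Longrightarrow> (1/2) *\<^sub>R (x - y) \<in> C"
  shows "emeasure lborel A \<le> emeasure lborel C"
proof -
  have "(\<integral>\<^sup>+x. indicator A x \<partial>lborel) * (\<integral>\<^sup>+x. indicator A x \<partial>lborel) \<le> (\<integral>\<^sup>+x. indicator C x \<partial>(lborel :: 'a measure))\<^sup>2"
    by (rule prekopa_leindler) (use sub in \<open>auto simp: indicator_def\<close>)
  then have "(emeasure lborel A)\<^sup>2 \<le> (emeasure lborel C)\<^sup>2" by (simp add: power2_eq_square)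
  then show ?thesis
    using ennreal_mult_strict_mono'[of "emeasure lborel C" "emeasure lborel A" "emeasure lborel C" "emeasure lborel A"]
    by (auto simp: power2_eq_square not_less[symmetric])
qed

section \<open>Caps of the equator\<close>


lemma perp_diff: "perp e (h - k) = perp e h - perp e k"
  by (simp add: perp_def algebra_simps)

text \<open>Replacing a set by its half differences does not decrease the volume and makes it
  symmetric about 0, so a set of diameter \<open>D\<close> ends up inside a ball of radius
  \<open>D / 2\<close>. Both slabs are convex and symmetric, hence stable under half
  differences.\<close>

lemma isodiametric_slab2:
  fixes \<nu> :: "'a::euclidean_space"
  assumes [measurable]: "G \<in> sets borel" and \<nu>: "norm \<nu> = 1" and w: "norm w = 1" "w \<bullet> \<nu> = 0" and d: "DIM('a) \<ge> 2"
    and D: "D \<ge> 0"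
    and diam: "\<And>y y'. y \<in> G \<Longrightarrow> y' \<in> G \<Longrightarrow> y \<bullet> w = 0 \<Longrightarrow> y' \<bullet> w = 0 \<Longrightarrow> norm (y - y') \<le> D"
  shows "(\<integral>\<^sup>+h. indicator (slab w) h * (indicator (slab \<nu>) h * indicator G (perp w (perp \<nu> h))) \<partial>lborel)
    \<le> ennreal (unit_ball_vol (real (DIM('a) - 2)) * (D / 2) ^ (DIM('a) - 2))"
proof -
  define A where "A = {h \<in> slab w \<inter> slab \<nu>. perp w (perp \<nu> h) \<in> G}"
  have [measurable]: "A \<in> sets borel" unfolding A_def by measurable
  have LA: "(\<integral>\<^sup>+h. indicator (slab w) h * (indicator (slab \<nu>) h * indicator G (perp w (perp \<nu> h))) \<partial>lborel) = emeasure lborel A"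
  proof -
    have "(\<integral>\<^sup>+h. indicator (slab w) h * (indicator (slab \<nu>) h * indicator G (perp w (perp \<nu> h))) \<partial>lborel) = (\<integral>\<^sup>+h. indicator A h \<partial>lborel)"
      by (rule nn_integral_cong) (auto simp: A_def indicator_def)
    then show ?thesis by simp
  qed
  \<comment> \<open>A slightly larger \<open>D'\<close> keeps the radius positive, as the ball
    formula requires; \<open>D' \<rightarrow> D\<close> then also settles
    \<open>D = 0\<close>.\<close>
  have pos: "emeasure lborel A \<le> ennreal (unit_ball_vol (real (DIM('a) - 2)) * (D' / 2) ^ (DIM('a) - 2))" if D': "D' > D" for D'
  proof -
    define C where "C = {h \<in> slab w \<inter> slab \<nu>. norm (perp w (perp \<nu> h)) \<le> D' / 2}"
    have [measurable]: "C \<in> sets borel" unfolding C_def by measurable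
    have "emeasure lborel A \<le> emeasure lborel C"
    proof (rule emeasure_half_difference_ge)
      fix x y assume xy: "x \<in> A" "y \<in> A"
      have "norm (perp w (perp \<nu> x) - perp w (perp \<nu> y)) \<le> D"
        using xy by (intro diam) (auto simp: A_def perp_inner w)
      then show "(1/2) *\<^sub>R (x - y) \<in> C"
        using xy D' by (auto simp: C_def A_def slab_def perp_scaleR perp_diff inner_diff_left)
    qed measurable
    also have "emeasure lborel C = (\<integral>\<^sup>+h. indicator C h \<partial>lborel)" by simp
    also have "\<dots> = (\<integral>\<^sup>+h. indicator (slab w) h * (indicator (slab \<nu>) h * indicator {y. norm y \<le> D' / 2} (perp w (perp \<nu> h))) \<partial>lborel)"
      by (rule nn_integral_cong) (auto simp: C_def indicator_def)
    also have "\<dots> = ennreal (unit_ball_vol (real (DIM('a) - 2)) * (D' / 2) ^ (DIM('a) - 2))"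
      by (rule nn_integral_slab2_ball) (use \<nu> w d D D' in auto)
    finally show ?thesis .
  qed
  have "emeasure lborel A \<le> ennreal (unit_ball_vol (real (DIM('a) - 2)) * (D / 2) ^ (DIM('a) - 2))"
  proof (rule tendsto_lowerbound)
    show "((\<lambda>D'. ennreal (unit_ball_vol (real (DIM('a) - 2)) * (D' / 2) ^ (DIM('a) - 2))) \<longlongrightarrow>
        ennreal (unit_ball_vol (real (DIM('a) - 2)) * (D / 2) ^ (DIM('a) - 2))) (at_right D)"
      by (intro tendsto_ennrealI tendsto_intros) auto
    show "\<forall>\<^sub>F D' in at_right D. emeasure lborel A \<le> ennreal (unit_ball_vol (real (DIM('a) - 2)) * (D' / 2) ^ (DIM('a) - 2))"
      using pos eventually_at_right_less[of D] by (auto elim!: eventually_mono)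
  qed simp
  then show ?thesis unfolding LA .
qed

lemma emeasure_cone_measure_slice:
  fixes \<nu> :: "'a::euclidean_space"
  assumes [measurable]: "A \<in> sets borel" and \<nu>: "norm \<nu> = 1" and w: "norm w = 1" "w \<bullet> \<nu> = 0"
  shows "emeasure (cone_measure \<nu>) A = of_nat (DIM('a) - 1) *
    (\<integral>\<^sup>+h. indicator (slab w) h * (indicator (slab \<nu>) h *
       (\<integral>\<^sup>+u. indicator {y. norm y \<le> 1} (perp w (perp \<nu> h) + u *\<^sub>R w) * indicator A (sgn (perp w (perp \<nu> h) + u *\<^sub>R w)) \<partial>lborel)) \<partial>lborel)"
proof -
  have "emeasure (cone_measure \<nu>) A = (\<integral>\<^sup>+\<omega>. indicator A \<omega> \<partial>cone_measure \<nu>)" by simp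
  also have "\<dots> = of_nat (DIM('a) - 1) *
     (\<integral>\<^sup>+h. indicator (slab \<nu>) h * (indicator {y. norm y \<le> 1} (perp \<nu> h) * indicator A (sgn (perp \<nu> h))) \<partial>lborel)"
    by (rule nn_integral_cone_measure) measurable
  also have "(\<integral>\<^sup>+h. indicator (slab \<nu>) h * (indicator {y. norm y \<le> 1} (perp \<nu> h) * indicator A (sgn (perp \<nu> h))) \<partial>lborel) =
    (\<integral>\<^sup>+h. indicator (slab w) h * (indicator (slab \<nu>) h *
       (\<integral>\<^sup>+u. indicator {y. norm y \<le> 1} (perp w (perp \<nu> h) + u *\<^sub>R w) * indicator A (sgn (perp w (perp \<nu> h) + u *\<^sub>R w)) \<partial>lborel)) \<partial>lborel)"
    by (rule nn_integral_slab_slice) (use \<nu> w in auto)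
  finally show ?thesis .
qed

text \<open>Volume of a straight cone: the slice at height \<open>u\<close> is \<open>u\<close>
  times the base and has measure proportional to \<open>u ^ (DIM('a) - 2)\<close>. Integrating over
  heights up to \<open>k\<close> produces \<open>1 / (DIM('a) - 1)\<close>, which the prefactor
  cancels.\<close>

lemma nn_integral_cone_over_base:
  fixes \<nu> :: "'a::euclidean_space"
  assumes [measurable]: "G \<in> sets borel" and \<nu>: "norm \<nu> = 1" and w: "norm w = 1" "w \<bullet> \<nu> = 0" and d: "DIM('a) \<ge> 2"
    and k: "k > 0"
  shows "of_nat (DIM('a) - 1) * (\<integral>\<^sup>+h. indicator (slab w) h * (indicator (slab \<nu>) h *
     (\<integral>\<^sup>+u. indicator {0<..k} u * indicator G ((1/u) *\<^sub>R perp w (perp \<nu> h)) \<partial>lborel)) \<partial>lborel) =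
    ennreal (k ^ (DIM('a) - 1)) * (\<integral>\<^sup>+h. indicator (slab w) h * (indicator (slab \<nu>) h * indicator G (perp w (perp \<nu> h))) \<partial>lborel)"
proof -
  define X where "X = (\<integral>\<^sup>+h. indicator (slab w) h * (indicator (slab \<nu>) h * indicator G (perp w (perp \<nu> h))) \<partial>(lborel :: 'a measure))"
  have "(\<integral>\<^sup>+h. indicator (slab w) h * (indicator (slab \<nu>) h *
     (\<integral>\<^sup>+u. indicator {0<..k} u * indicator G ((1/u) *\<^sub>R perp w (perp \<nu> h)) \<partial>lborel)) \<partial>lborel) =
    (\<integral>\<^sup>+h. \<integral>\<^sup>+u. indicator {0<..k} u * (indicator (slab w) h * (indicator (slab \<nu>) h * indicator G ((1/u) *\<^sub>R perp w (perp \<nu> h)))) \<partial>lborel \<partial>lborel)"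
  proof (rule nn_integral_cong)
    fix h
    have [measurable]: "(\<lambda>u. indicator {0<..k} u * indicator G ((1/u) *\<^sub>R perp w (perp \<nu> h)) :: ennreal) \<in> borel_measurable lborel" by measurable
    show "indicator (slab w) h * (indicator (slab \<nu>) h * (\<integral>\<^sup>+u. indicator {0<..k} u * indicator G ((1/u) *\<^sub>R perp w (perp \<nu> h)) \<partial>lborel)) =
      (\<integral>\<^sup>+u. indicator {0<..k} u * (indicator (slab w) h * (indicator (slab \<nu>) h * indicator G ((1/u) *\<^sub>R perp w (perp \<nu> h)))) \<partial>lborel)"
      unfolding mult.left_commute[of "indicator {0<..k} _"]
      by (simp add: nn_integral_cmult)
  qed
  also have "\<dots> = (\<integral>\<^sup>+u. \<integral>\<^sup>+h. indicator {0<..k} u * (indicator (slab w) h * (indicator (slab \<nu>) h * indicator G ((1/u) *\<^sub>R perp w (perp \<nu> h)))) \<partial>lborel \<partial>lborel)"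
    by (rule lborel_pair.Fubini') measurable
  also have "\<dots> = (\<integral>\<^sup>+u. (ennreal (u ^ (DIM('a) - 2)) * indicator {0<..k} u) * X \<partial>lborel)"
  proof (rule nn_integral_cong)
    fix u :: real
    show "(\<integral>\<^sup>+h. indicator {0<..k} u * (indicator (slab w) h * (indicator (slab \<nu>) h * indicator G ((1/u) *\<^sub>R perp w (perp \<nu> h)))) \<partial>lborel)
      = (ennreal (u ^ (DIM('a) - 2)) * indicator {0<..k} u) * X"
    proof (cases "0 < u \<and> u \<le> k")
      case True
      have "(\<integral>\<^sup>+h. indicator (slab w) h * (indicator (slab \<nu>) h * indicator G ((1/u) *\<^sub>R perp w (perp \<nu> h))) \<partial>(lborel :: 'a measure)) =
         ennreal (u ^ (DIM('a) - 2)) * (\<integral>\<^sup>+h. indicator (slab w) h * (indicator (slab \<nu>) h * indicator G ((1/u) *\<^sub>R (u *\<^sub>R perp w (perp \<nu> h)))) \<partial>(lborel :: 'a measure))"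
        by (rule nn_integral_slab2_scale[where \<Phi>="\<lambda>y. indicator G ((1/u) *\<^sub>R y)"]) (use True \<nu> w d in auto)
      with True show ?thesis by (simp add: X_def)
    qed auto
  qed
  also have "\<dots> = (\<integral>\<^sup>+u. ennreal (u ^ (DIM('a) - 2)) * indicator {0<..k} u \<partial>lborel) * X"
    by (rule nn_integral_multc) measurable
  also have "(\<integral>\<^sup>+u. ennreal (u ^ (DIM('a) - 2)) * indicator {0<..k} u \<partial>lborel) = (\<integral>\<^sup>+u. ennreal (u ^ (DIM('a) - 2)) * indicator {0..k} u \<partial>lborel)"
    using AE_lborel_singleton[of "0::real"] by (intro nn_integral_cong_AE) (auto simp: indicator_def elim!: eventually_mono)
  also have "\<dots> = ennreal (k ^ (DIM('a) - 1) / real (DIM('a) - 1) - 0 ^ (DIM('a) - 1) / real (DIM('a) - 1))"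
  proof (rule nn_integral_FTC_Icc)
    fix x :: real
    show "((\<lambda>x. x ^ (DIM('a) - 1) / real (DIM('a) - 1)) has_real_derivative x ^ (DIM('a) - 2)) (at x)"
      using d by (auto intro!: derivative_eq_intros simp: numeral_2_eq_2)
  qed (use k in auto)
  finally have "(\<integral>\<^sup>+h. indicator (slab w) h * (indicator (slab \<nu>) h *
     (\<integral>\<^sup>+u. indicator {0<..k} u * indicator G ((1/u) *\<^sub>R perp w (perp \<nu> h)) \<partial>lborel)) \<partial>lborel) =
     ennreal (k ^ (DIM('a) - 1) / real (DIM('a) - 1)) * X"
    using d by (simp add: zero_power)
  moreover have "of_nat (DIM('a) - 1) * (ennreal (k ^ (DIM('a) - 1) / real (DIM('a) - 1)) * X) = ennreal (k ^ (DIM('a) - 1)) * X"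
    using d k by (simp add: ennreal_of_nat_eq_real_of_nat mult.assoc[symmetric] ennreal_mult'[symmetric] del: of_nat_diff)
  ultimately show ?thesis by (simp add: X_def)
qed

text \<open>A point of the unit ball whose direction lies in \<open>A\<close> has height
  \<open>u\<close> above the subspace orthogonal to \<open>w\<close> with
  \<open>0 < u \<le> 1\<close>; division by \<open>u\<close> moves it to the tangent plane at
  \<open>w\<close> and keeps its direction. So the solid cone over \<open>A\<close> lies in the
  straight cone of height one over the gnomonic image.\<close>

lemma emeasure_cone_measure_le_gnomonic:
  fixes \<nu> :: "'a::euclidean_space"
  assumes [measurable]: "A \<in> sets borel" and \<nu>: "norm \<nu> = 1" and w: "norm w = 1" "w \<bullet> \<nu> = 0" and d: "DIM('a) \<ge> 2"
    and A: "\<And>\<omega>. \<omega> \<in> A \<Longrightarrow> \<omega> \<bullet> w > 0"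
  shows "emeasure (cone_measure \<nu>) A \<le>
    (\<integral>\<^sup>+h. indicator (slab w) h * (indicator (slab \<nu>) h * indicator {y. sgn (y + w) \<in> A} (perp w (perp \<nu> h))) \<partial>lborel)"
proof -
  have [measurable]: "{y. sgn (y + w) \<in> A} \<in> sets borel" by measurable
  have "emeasure (cone_measure \<nu>) A \<le> of_nat (DIM('a) - 1) * (\<integral>\<^sup>+h. indicator (slab w) h * (indicator (slab \<nu>) h *
     (\<integral>\<^sup>+u. indicator {0<..1} u * indicator {y. sgn (y + w) \<in> A} ((1/u) *\<^sub>R perp w (perp \<nu> h)) \<partial>lborel)) \<partial>lborel)"
    unfolding emeasure_cone_measure_slice[OF assms(1) \<nu> w]
  proof (intro mult_left_mono nn_integral_mono)
    fix h :: 'a and u :: real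
    define y where "y = perp w (perp \<nu> h)"
    have yw: "y \<bullet> w = 0" unfolding y_def by (rule perp_inner) fact
    have ww: "w \<bullet> w = 1" using w by (simp add: dot_square_norm)
    show "indicator {y. norm y \<le> 1} (y + u *\<^sub>R w) * indicator A (sgn (y + u *\<^sub>R w))
       \<le> (indicator {0<..1} u * indicator {y. sgn (y + w) \<in> A} ((1/u) *\<^sub>R y) :: ennreal)"
    proof (cases "norm (y + u *\<^sub>R w) \<le> 1 \<and> sgn (y + u *\<^sub>R w) \<in> A")
      case True
      have u: "(y + u *\<^sub>R w) \<bullet> w = u" using yw ww by (simp add: inner_add_left)
      have "\<bar>u\<bar> \<le> norm (y + u *\<^sub>R w) * norm w" using Cauchy_Schwarz_ineq2[of "y + u *\<^sub>R w" w] u by simp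
      with True w have u1: "u \<le> 1" by auto
      have "0 < sgn (y + u *\<^sub>R w) \<bullet> w" using A True by blast
      then have u0: "u > 0"
        using u by (auto simp: sgn_div_norm zero_less_mult_iff)
      have "y + u *\<^sub>R w = u *\<^sub>R ((1/u) *\<^sub>R y + w)" using u0 by (simp add: algebra_simps)
      then have "sgn (y + u *\<^sub>R w) = sgn ((1/u) *\<^sub>R y + w)" using u0 by (simp add: sgn_scaleR)
      with True u0 u1 show ?thesis by (auto simp: indicator_def)
    qed (auto simp: indicator_def)
  qed auto
  also have "\<dots> = ennreal (1 ^ (DIM('a) - 1)) * (\<integral>\<^sup>+h. indicator (slab w) h * (indicator (slab \<nu>) h * indicator {y. sgn (y + w) \<in> A} (perp w (perp \<nu> h))) \<partial>lborel)"
    by (rule nn_integral_cone_over_base) (use \<nu> w d in auto)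
  finally show ?thesis by simp
qed

text \<open>The gnomonic projection is \<open>y + w = \<omega> / (\<omega> \<bullet> w)\<close>, and
  \<open>\<omega> \<bullet> w\<close> equals 1 up to half the squared distance from
  \<open>w\<close>. On a cap of size \<open>\<delta>\<close> it therefore stretches distances by a
  factor close to 1.\<close>

lemma gnomonic_lipschitz:
  fixes w \<omega> \<omega>' y y' :: "'a::euclidean_space"
  assumes w: "norm w = 1" and yw: "y \<bullet> w = 0" "y' \<bullet> w = 0" and sg: "sgn (y + w) = \<omega>" "sgn (y' + w) = \<omega>'"
    and D: "norm (\<omega> - w) \<le> D" "norm (\<omega>' - w) \<le> D" "norm (\<omega> - \<omega>') \<le> D" and Dd: "D \<le> \<delta>" "\<delta> \<le> 1/4" "6 * \<delta> \<le> \<epsilon>"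
  shows "norm (y - y') \<le> (1 + \<epsilon>) * D"
proof -
  have ww: "w \<bullet> w = 1" using w by (simp add: dot_square_norm)
  have D0: "0 \<le> D" using D(1) norm_ge_zero order_trans by blast
  have key: "norm \<theta> = 1 \<and> \<theta> \<bullet> w = 1 - (norm (\<theta> - w))\<^sup>2 / 2 \<and> 1 - \<delta> \<le> \<theta> \<bullet> w \<and> v + w = (1 / (\<theta> \<bullet> w)) *\<^sub>R \<theta>"
    if v: "v \<bullet> w = 0" "sgn (v + w) = \<theta>" "norm (\<theta> - w) \<le> D" for v \<theta>
  proof -
    have vw: "(v + w) \<bullet> w = 1" using v ww by (simp add: inner_add_left)
    then have "v + w \<noteq> 0" by auto
    then have n: "norm \<theta> = 1" "v + w = norm (v + w) *\<^sub>R \<theta>" using v(2) by (auto simp: norm_sgn sgn_div_norm)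
    have "\<theta> \<bullet> \<theta> = 1" using n(1) by (simp add: dot_square_norm)
    then have c: "\<theta> \<bullet> w = 1 - (norm (\<theta> - w))\<^sup>2 / 2"
      unfolding power2_norm_eq_inner using ww by (simp add: inner_diff_left inner_diff_right inner_commute field_simps)
    have "(norm (\<theta> - w))\<^sup>2 \<le> \<delta>\<^sup>2" using v(3) Dd D0 by (intro power_mono) auto
    also have "\<delta>\<^sup>2 \<le> \<delta>" using Dd D0 by (simp add: power2_eq_square mult_left_le)
    finally have c2: "1 - \<delta> \<le> \<theta> \<bullet> w" using c Dd D0 by auto
    have "norm (v + w) * (\<theta> \<bullet> w) = 1" using vw n(2) by (metis inner_scaleR_left)
    then have "norm (v + w) = 1 / (\<theta> \<bullet> w)" by (metis mult_eq_0_iff nonzero_eq_divide_eq zero_neq_one)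
    with n c c2 show ?thesis by simp
  qed
  define c where "c = \<omega> \<bullet> w"
  define c' where "c' = \<omega>' \<bullet> w"
  have k1: "norm \<omega> = 1" "c = 1 - (norm (\<omega> - w))\<^sup>2 / 2" "1 - \<delta> \<le> c" "y + w = (1 / c) *\<^sub>R \<omega>"
    using key[OF yw(1) sg(1) D(1)] by (auto simp: c_def)
  have k2: "norm \<omega>' = 1" "c' = 1 - (norm (\<omega>' - w))\<^sup>2 / 2" "1 - \<delta> \<le> c'" "y' + w = (1 / c') *\<^sub>R \<omega>'"
    using key[OF yw(2) sg(2) D(2)] by (auto simp: c'_def)
  have pos: "c > 0" "c' > 0" using k1 k2 Dd by auto
  \<comment> \<open>Factoring the difference of squares makes the bound proportional to
    \<open>D\<close>; a bound in \<open>\<delta>\<close> alone would not give a multiplicative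
    distortion.\<close>
  have cc: "\<bar>c' - c\<bar> \<le> D * \<delta>"
  proof -
    have "c' - c = ((norm (\<omega> - w))\<^sup>2 - (norm (\<omega>' - w))\<^sup>2) / 2" using k1 k2 by (simp add: field_simps)
    also have "\<dots> = (norm (\<omega> - w) - norm (\<omega>' - w)) * (norm (\<omega> - w) + norm (\<omega>' - w)) / 2"
      by (simp add: power2_eq_square algebra_simps)
    finally have e: "c' - c = (norm (\<omega> - w) - norm (\<omega>' - w)) * (norm (\<omega> - w) + norm (\<omega>' - w)) / 2" .
    have "\<bar>c' - c\<bar> = \<bar>norm (\<omega> - w) - norm (\<omega>' - w)\<bar> * (norm (\<omega> - w) + norm (\<omega>' - w)) / 2"
      unfolding e by (simp add: abs_mult)
    also have "\<dots> \<le> D * (2 * \<delta>) / 2"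
    proof (intro divide_right_mono mult_mono)
      have "\<bar>norm (\<omega> - w) - norm (\<omega>' - w)\<bar> \<le> norm ((\<omega> - w) - (\<omega>' - w))" by (rule norm_triangle_ineq3)
      with D(3) show "\<bar>norm (\<omega> - w) - norm (\<omega>' - w)\<bar> \<le> D" by simp
    qed (use D Dd D0 in auto)
    finally show ?thesis by simp
  qed
  have "y - y' = (y + w) - (y' + w)" by simp
  also have "\<dots> = (1 / c) *\<^sub>R (\<omega> - \<omega>') + (1 / c - 1 / c') *\<^sub>R \<omega>'"
    unfolding k1(4) k2(4) by (simp add: algebra_simps)
  finally have "norm (y - y') \<le> (1 / c) * norm (\<omega> - \<omega>') + \<bar>1 / c - 1 / c'\<bar>"
    using norm_triangle_ineq[of "(1 / c) *\<^sub>R (\<omega> - \<omega>')" "(1 / c - 1 / c') *\<^sub>R \<omega>'"] pos k2(1) by simp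
  also have "1 / c - 1 / c' = (c' - c) / (c * c')" using pos by (simp add: field_simps)
  also have "\<bar>(c' - c) / (c * c')\<bar> = \<bar>c' - c\<bar> / (c * c')" using pos by simp
  also have "(1 / c) * norm (\<omega> - \<omega>') + \<bar>c' - c\<bar> / (c * c') \<le> (1 / (1 - \<delta>)\<^sup>2) * D + (D * \<delta>) / (1 - \<delta>)\<^sup>2"
  proof (intro add_mono mult_mono frac_le)
    have "(1 - \<delta>)\<^sup>2 \<le> 1 - \<delta>" using Dd D0 by (simp add: power2_eq_square mult_left_le)
    then show "(1 - \<delta>)\<^sup>2 \<le> c" using k1 by linarith
    show "(1 - \<delta>)\<^sup>2 \<le> c * c'" unfolding power2_eq_square using k1 k2 Dd by (intro mult_mono) auto
  qed (use D D0 Dd cc in auto)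
  also have "\<dots> = (1 + \<delta>) / (1 - \<delta>)\<^sup>2 * D" by (simp add: add_divide_distrib algebra_simps)
  also have "\<dots> \<le> (1 + \<epsilon>) * D"
  proof (intro mult_right_mono D0)
    have "0 \<le> \<delta>" using D0 Dd by auto
    \<comment> \<open>Origin of the constants: \<open>\<delta> \<le> 1/4\<close> lets half of
      \<open>\<epsilon>\<close> absorb \<open>2 * \<epsilon> * \<delta>\<close>, and the other half
      is at least \<open>3 * \<delta>\<close>, which covers the remaining \<open>\<delta>\<close>
      and \<open>2 * \<delta>\<close>.\<close>
    then have "\<epsilon> * (2 * \<delta>) \<le> \<epsilon> * (1/2)" using Dd by (intro mult_left_mono) auto
    then have "1 + \<delta> \<le> (1 + \<epsilon>) * (1 - 2 * \<delta>)" using Dd by (simp add: algebra_simps)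
    also have "\<dots> \<le> (1 + \<epsilon>) * (1 - \<delta>)\<^sup>2"
      using Dd \<open>0 \<le> \<delta>\<close> by (intro mult_left_mono) (auto simp: power2_eq_square algebra_simps)
    finally show "(1 + \<delta>) / (1 - \<delta>)\<^sup>2 \<le> 1 + \<epsilon>" using Dd by (subst pos_divide_le_eq) auto
  qed
  finally show ?thesis .
qed

text \<open>The isodiametric inequality in the tangent plane at a point \<open>w\<close> of
  \<open>A\<close> itself: small diameter keeps \<open>A\<close> in the open hemisphere around
  \<open>w\<close>, and the gnomonic projection increases the diameter by at most the factor
  \<open>1 + \<epsilon>\<close>.\<close>

lemma emeasure_cone_measure_le_diameter:
  fixes \<nu> :: "'a::euclidean_space"
  assumes [measurable]: "A \<in> sets borel" and \<nu>: "norm \<nu> = 1" and d: "DIM('a) \<ge> 2"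
    and A: "A \<subseteq> {\<omega>. norm \<omega> = 1 \<and> \<omega> \<bullet> \<nu> = 0}" "A \<noteq> {}"
    and D: "\<And>a b. a \<in> A \<Longrightarrow> b \<in> A \<Longrightarrow> dist a b \<le> D" and Dd: "D \<le> \<delta>" "\<delta> \<le> 1/4" "6 * \<delta> \<le> \<epsilon>"
  shows "emeasure (cone_measure \<nu>) A \<le> ennreal ((1 + \<epsilon>) ^ (DIM('a) - 2) * (unit_ball_vol (real (DIM('a) - 2)) * (D / 2) ^ (DIM('a) - 2)))"
proof -
  obtain w where wA: "w \<in> A" using A by blast
  then have w: "norm w = 1" "w \<bullet> \<nu> = 0" using A by auto
  have ww: "w \<bullet> w = 1" using w by (simp add: dot_square_norm)
  have D0: "0 \<le> D" using D[OF wA wA] by simp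
  have "emeasure (cone_measure \<nu>) A \<le>
    (\<integral>\<^sup>+h. indicator (slab w) h * (indicator (slab \<nu>) h * indicator {y. sgn (y + w) \<in> A} (perp w (perp \<nu> h))) \<partial>lborel)"
  proof (rule emeasure_cone_measure_le_gnomonic)
    fix \<omega> assume "\<omega> \<in> A"
    then have "norm (\<omega> - w) \<le> D" "norm \<omega> = 1" using D[of \<omega> w] wA A by (auto simp: dist_norm)
    then have "(norm (\<omega> - w))\<^sup>2 \<le> 1\<^sup>2" using Dd by (intro power_mono) auto
    moreover have "(norm (\<omega> - w))\<^sup>2 = 2 - 2 * (\<omega> \<bullet> w)"
      using \<open>norm \<omega> = 1\<close> ww unfolding norm_eq_1 power2_norm_eq_inner
      by (simp add: inner_diff_left inner_diff_right inner_commute)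
    ultimately show "\<omega> \<bullet> w > 0" by simp
  qed (use \<nu> w d in auto)
  also have "\<dots> \<le> ennreal (unit_ball_vol (real (DIM('a) - 2)) * (((1 + \<epsilon>) * D) / 2) ^ (DIM('a) - 2))"
  proof (rule isodiametric_slab2)
    fix y y' assume y: "y \<in> {y. sgn (y + w) \<in> A}" "y' \<in> {y. sgn (y + w) \<in> A}" "y \<bullet> w = 0" "y' \<bullet> w = 0"
    show "norm (y - y') \<le> (1 + \<epsilon>) * D"
      by (rule gnomonic_lipschitz[OF w(1) y(3,4) refl refl _ _ _ Dd])
         (use y wA D in \<open>auto simp: dist_norm\<close>)
  qed (use \<nu> w d D0 Dd in auto)
  finally show ?thesis by (simp add: power_mult_distrib power_divide mult_ac)
qed

text \<open>The converse inclusion: the straight cone over the tangent ball of radius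
  \<open>s\<close>, cut at height \<open>1 / sqrt (1 + s ^ 2)\<close>, stays in the unit ball, and
  its directions lie in the cap because a chord is shorter than the corresponding tangent
  segment.\<close>

lemma emeasure_cone_measure_cball_ge:
  fixes \<nu> :: "'a::euclidean_space"
  assumes \<nu>: "norm \<nu> = 1" and d: "DIM('a) \<ge> 2" and w: "norm w = 1" "w \<bullet> \<nu> = 0" and s: "s > 0"
  shows "emeasure (cone_measure \<nu>) (cball w s) \<ge>
     ennreal ((1 / sqrt (1 + s\<^sup>2)) ^ (DIM('a) - 1) * (unit_ball_vol (real (DIM('a) - 2)) * s ^ (DIM('a) - 2)))"
proof -
  define k where "k = 1 / sqrt (1 + s\<^sup>2)"
  have k: "k > 0" "k\<^sup>2 * (1 + s\<^sup>2) = 1"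
    using s by (auto simp: k_def power_divide add_nonneg_nonneg) (metis add_pos_nonneg less_irrefl zero_le_power2 zero_less_one)+
  have ww: "w \<bullet> w = 1" using w by (simp add: dot_square_norm)
  have "of_nat (DIM('a) - 1) * (\<integral>\<^sup>+h. indicator (slab w) h * (indicator (slab \<nu>) h *
     (\<integral>\<^sup>+u. indicator {0<..k} u * indicator {y. norm y \<le> s} ((1/u) *\<^sub>R perp w (perp \<nu> h)) \<partial>lborel)) \<partial>lborel) \<le> emeasure (cone_measure \<nu>) (cball w s)"
    unfolding emeasure_cone_measure_slice[OF borel_closed[OF closed_cball] \<nu> w]
  proof (intro mult_left_mono nn_integral_mono)
    fix h :: 'a and u :: real
    define y where "y = perp w (perp \<nu> h)"
    have yw: "y \<bullet> w = 0" unfolding y_def by (rule perp_inner) fact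
    show "(indicator {0<..k} u * indicator {y. norm y \<le> s} ((1/u) *\<^sub>R y) :: ennreal)
      \<le> indicator {y. norm y \<le> 1} (y + u *\<^sub>R w) * indicator (cball w s) (sgn (y + u *\<^sub>R w))"
    proof (cases "0 < u \<and> u \<le> k \<and> norm ((1/u) *\<^sub>R y) \<le> s")
      case True
      define z where "z = (1/u) *\<^sub>R y + w"
      have zz: "y + u *\<^sub>R w = u *\<^sub>R z" using True by (simp add: z_def algebra_simps)
      have zw: "z \<bullet> w = 1" using yw ww by (simp add: z_def inner_add_left)
      have nz: "(norm z)\<^sup>2 = 1 + (norm ((1/u) *\<^sub>R y))\<^sup>2"
        unfolding z_def power2_norm_eq_inner using yw ww by (simp add: inner_add_left inner_add_right inner_commute)
      have "1 \<le> (norm z)\<^sup>2" using nz by simp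
      then have z1: "1 \<le> norm z" by (metis abs_norm_cancel abs_square_less_1 not_le)
      have "(norm ((1/u) *\<^sub>R y))\<^sup>2 \<le> s\<^sup>2" using True by (intro power_mono) auto
      then have "(norm (u *\<^sub>R z))\<^sup>2 \<le> k\<^sup>2 * (1 + s\<^sup>2)"
        using True nz by (auto simp: power_mult_distrib intro!: mult_mono power_mono)
      then have n1: "norm (y + u *\<^sub>R w) \<le> 1" using k zz by (simp add: abs_square_le_1)
      have sg: "sgn (y + u *\<^sub>R w) = sgn z" using True unfolding zz by (simp add: sgn_scaleR)
      have "z \<noteq> 0" using z1 by auto
      then have zsg: "z = norm z *\<^sub>R sgn z" by (simp add: sgn_div_norm)
      have nsg: "sgn z \<bullet> sgn z = 1" using z1 by (metis dot_square_norm norm_sgn norm_zero not_one_le_zero one_power2)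
      define \<beta> where "\<beta> = sgn z \<bullet> w"
      have nb: "norm z * \<beta> = 1" using zw zsg unfolding \<beta>_def by (metis inner_scaleR_left)
      have b1: "\<beta> \<le> 1" using Cauchy_Schwarz_ineq2[of "sgn z" w] w by (auto simp: \<beta>_def norm_sgn split: if_splits)
      have b0: "\<beta> > 0" using nb z1 by (metis less_le_trans zero_less_mult_pos zero_less_one)
      have "(norm (sgn z - w))\<^sup>2 = 2 - 2 * \<beta>"
        unfolding power2_norm_eq_inner \<beta>_def using nsg ww by (simp add: inner_diff_left inner_diff_right inner_commute)
      also have "\<dots> \<le> (norm z)\<^sup>2 - 1"
      proof -
        have "(norm z)\<^sup>2 = 1 / \<beta>\<^sup>2" using nb b0 by (simp add: field_simps power_mult_distrib[symmetric])
        \<comment> \<open>Chord against tangent: for the cosine \<open>\<beta>\<close>, the squared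
          chord is \<open>2 - 2 * \<beta>\<close> and the squared tangent
          \<open>1 / \<beta> ^ 2 - 1\<close>.\<close>
        moreover have "3 - 2 * \<beta> \<le> 1 / \<beta>\<^sup>2"
        proof -
          have "(3 - 2 * \<beta>) * \<beta>\<^sup>2 \<le> 1"
          proof -
            have "1 - (3 - 2 * \<beta>) * \<beta>\<^sup>2 = (1 - \<beta>)\<^sup>2 * (1 + 2 * \<beta>)" by (simp add: power2_eq_square algebra_simps)
            also have "\<dots> \<ge> 0" using b0 by simp
            finally show ?thesis by simp
          qed
          then show ?thesis using b0 by (simp add: field_simps)
        qed
        ultimately show ?thesis by simp
      qed
      also have "\<dots> \<le> s\<^sup>2" using nz \<open>(norm ((1/u) *\<^sub>R y))\<^sup>2 \<le> s\<^sup>2\<close> by simp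
      finally have "norm (sgn z - w) \<le> s" using s by (simp add: power2_le_iff_abs_le)
      then show ?thesis using n1 sg True by (auto simp: indicator_def dist_norm norm_minus_commute)
    qed (auto simp: indicator_def)
  qed auto
  moreover have "of_nat (DIM('a) - 1) * (\<integral>\<^sup>+h. indicator (slab w) h * (indicator (slab \<nu>) h *
     (\<integral>\<^sup>+u. indicator {0<..k} u * indicator {y. norm y \<le> s} ((1/u) *\<^sub>R perp w (perp \<nu> h)) \<partial>lborel)) \<partial>lborel) =
     ennreal (k ^ (DIM('a) - 1)) * (\<integral>\<^sup>+h. indicator (slab w) h * (indicator (slab \<nu>) h * indicator {y. norm y \<le> s} (perp w (perp \<nu> h))) \<partial>lborel)"
    by (rule nn_integral_cone_over_base) (use \<nu> w d k in auto)
  moreover have "(\<integral>\<^sup>+h. indicator (slab w) h * (indicator (slab \<nu>) h * indicator {y. norm y \<le> s} (perp w (perp \<nu> h))) \<partial>lborel)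
    = ennreal (unit_ball_vol (real (DIM('a) - 2)) * s ^ (DIM('a) - 2))"
    by (rule nn_integral_slab2_ball) (use \<nu> w d s in auto)
  ultimately show ?thesis
    using k s by (simp add: ennreal_mult'[symmetric] k_def[symmetric])
qed

section \<open>Hausdorff measure\<close>


text \<open>The case distinction matters for \<open>m = 0\<close>: there \<open>0 ^ 0 = 1\<close>
  would charge one unit for every empty member of a cover.\<close>

definition hcost :: "nat \<Rightarrow> 'a::euclidean_space set \<Rightarrow> ennreal" where
  "hcost m A = (if A = {} then 0 else ennreal (unit_ball_vol (real m) * (diameter A / 2) ^ m))"

definition hcover :: "real \<Rightarrow> 'a::euclidean_space set \<Rightarrow> (nat \<Rightarrow> 'a set) set" where
  "hcover \<delta> A = {C. A \<subseteq> (\<Union>i. C i) \<and> (\<forall>i. bounded (C i) \<and> diameter (C i) \<le> \<delta>)}"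

lemma hausdorff_pre_alt: "hausdorff_pre m \<delta> A = (INF C \<in> hcover \<delta> A. \<Sum>i. hcost m (C i))"
  unfolding hausdorff_pre_def hcover_def hcost_def ..

lemma hausdorff_pre_le: "C \<in> hcover \<delta> A \<Longrightarrow> hausdorff_pre m \<delta> A \<le> (\<Sum>i. hcost m (C i))"
  unfolding hausdorff_pre_alt by (rule INF_lower)

lemma hausdorff_pre_le_outer: "\<delta> > 0 \<Longrightarrow> hausdorff_pre m \<delta> A \<le> hausdorff_outer m A"
  unfolding hausdorff_outer_def by (rule SUP_upper) auto

lemma hausdorff_pre_mono: "A \<subseteq> B \<Longrightarrow> hausdorff_pre m \<delta> A \<le> hausdorff_pre m \<delta> B"
  unfolding hausdorff_pre_alt by (rule INF_superset_mono) (auto simp: hcover_def)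

lemma hausdorff_pre_antimono: "\<delta> \<le> \<delta>' \<Longrightarrow> hausdorff_pre m \<delta>' A \<le> hausdorff_pre m \<delta> A"
  unfolding hausdorff_pre_alt by (rule INF_superset_mono) (auto simp: hcover_def intro: order_trans)

lemma hausdorff_pre_empty: "\<delta> \<ge> 0 \<Longrightarrow> hausdorff_pre m \<delta> {} = 0"
  using hausdorff_pre_le[of "\<lambda>_. {}" \<delta> "{}" m] by (simp add: hcover_def hcost_def)

lemma hausdorff_pre_countably_subadditive:
  fixes A :: "nat \<Rightarrow> 'a::euclidean_space set"
  assumes \<delta>: "\<delta> \<ge> 0"
  shows "hausdorff_pre m \<delta> (\<Union>i. A i) \<le> (\<Sum>i. hausdorff_pre m \<delta> (A i))"
proof (rule ennreal_le_epsilon)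
  fix e :: real assume fin: "(\<Sum>i. hausdorff_pre m \<delta> (A i)) < top" and e: "0 < e"
  have "\<exists>C. C \<in> hcover \<delta> (A n) \<and> (\<Sum>i. hcost m (C i)) \<le> hausdorff_pre m \<delta> (A n) + ennreal (e * (1/2) ^ Suc n)" for n
  proof -
    have "hausdorff_pre m \<delta> (A n) \<noteq> top"
      using ennreal_suminf_lessD[OF fin, of n] by simp
    then have "hausdorff_pre m \<delta> (A n) < hausdorff_pre m \<delta> (A n) + ennreal (e * (1/2) ^ Suc n)"
      using e by (cases "hausdorff_pre m \<delta> (A n)") (auto simp: ennreal_less_iff simp flip: ennreal_plus)
    then obtain C where "C \<in> hcover \<delta> (A n)" "(\<Sum>i. hcost m (C i)) < hausdorff_pre m \<delta> (A n) + ennreal (e * (1/2) ^ Suc n)"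
      by (subst (asm) hausdorff_pre_alt) (auto simp: INF_less_iff)
    then show ?thesis by (auto intro: less_imp_le)
  qed
  then obtain C where C: "\<And>n. C n \<in> hcover \<delta> (A n)"
    "\<And>n. (\<Sum>i. hcost m (C n i)) \<le> hausdorff_pre m \<delta> (A n) + ennreal (e * (1/2) ^ Suc n)"
    by metis
  define B where "B = (\<lambda>(i, j). C i j) \<circ> prod_decode"
  have "B \<in> hcover \<delta> (\<Union>i. A i)"
  proof -
    have "(\<Union>i. A i) \<subseteq> (\<Union>k. B k)"
    proof
      fix x assume "x \<in> (\<Union>i. A i)"
      then obtain i where "x \<in> A i" by blast
      then obtain j where "x \<in> C i j" using C(1)[of i] by (auto simp: hcover_def)
      then have "x \<in> B (prod_encode (i, j))" by (simp add: B_def)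
      then show "x \<in> (\<Union>k. B k)" by blast
    qed
    then show ?thesis using C(1) by (auto simp: hcover_def B_def split: prod.splits)
  qed
  then have "hausdorff_pre m \<delta> (\<Union>i. A i) \<le> (\<Sum>k. hcost m (B k))" by (rule hausdorff_pre_le)
  also have "\<dots> = (\<Sum>n. \<Sum>i. hcost m (C n i))"
    using suminf_ennreal_2dimen[where f="\<lambda>(i, j). hcost m (C i j)" and g="\<lambda>n. \<Sum>i. hcost m (C n i)"]
    by (simp add: B_def comp_def split_beta)
  also have "\<dots> \<le> (\<Sum>n. hausdorff_pre m \<delta> (A n) + ennreal (e * (1/2) ^ Suc n))"
    by (intro suminf_le C) auto
  also have "\<dots> = (\<Sum>n. hausdorff_pre m \<delta> (A n)) + (\<Sum>n. ennreal (e * (1/2) ^ Suc n))"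
    by (rule suminf_add[symmetric]) auto
  also have "(\<Sum>n. ennreal (e * (1/2) ^ Suc n)) = ennreal e"
  proof -
    have "(\<lambda>n. e * (1/2) ^ Suc n) sums (e * 1)"
      by (intro sums_mult power_half_series)
    then show ?thesis using e by (intro suminf_ennreal_eq) auto
  qed
  finally show "hausdorff_pre m \<delta> (\<Union>i. A i) \<le> (\<Sum>i. hausdorff_pre m \<delta> (A i)) + ennreal e" .
qed

lemma hausdorff_outer_mono: "A \<subseteq> B \<Longrightarrow> hausdorff_outer m A \<le> hausdorff_outer m B"
  unfolding hausdorff_outer_def by (intro SUP_mono) (auto intro: hausdorff_pre_mono)

lemma hausdorff_outer_empty: "hausdorff_outer m {} = 0"
  unfolding hausdorff_outer_def by (auto simp: hausdorff_pre_empty intro!: antisym SUP_least)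

lemma hausdorff_outer_countably_subadditive:
  "hausdorff_outer m (\<Union>i. A i) \<le> (\<Sum>i. hausdorff_outer m (A i))"
proof -
  have "hausdorff_pre m \<delta> (\<Union>i. A i) \<le> (\<Sum>i. hausdorff_outer m (A i))" if "\<delta> > 0" for \<delta>
    using hausdorff_pre_countably_subadditive[of \<delta> m A] that
    by (auto intro!: suminf_le hausdorff_pre_le_outer elim!: order_trans)
  then show ?thesis
    by (subst hausdorff_outer_def) (auto intro: SUP_least)
qed

lemma hausdorff_pre_subadditive:
  assumes "\<delta> \<ge> 0" shows "hausdorff_pre m \<delta> (A \<union> B) \<le> hausdorff_pre m \<delta> A + hausdorff_pre m \<delta> B"
proof -
  have "hausdorff_pre m \<delta> (A \<union> B) = hausdorff_pre m \<delta> (\<Union>i. binaryset A B i)"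
    by (simp add: UN_binaryset_eq)
  also have "\<dots> \<le> (\<Sum>i. hausdorff_pre m \<delta> (binaryset A B i))"
    using assms by (rule hausdorff_pre_countably_subadditive)
  also have "\<dots> = hausdorff_pre m \<delta> A + hausdorff_pre m \<delta> B"
    by (rule suminf_binaryset_eq) (rule hausdorff_pre_empty[OF assms])
  finally show ?thesis .
qed

lemma hausdorff_outer_subadditive:
  "hausdorff_outer m (A \<union> B) \<le> hausdorff_outer m A + hausdorff_outer m B"
  unfolding hausdorff_outer_def[of m "A \<union> B"]
  by (auto intro!: SUP_least order_trans[OF hausdorff_pre_subadditive] add_mono hausdorff_pre_le_outer)

text \<open>A set of diameter below \<open>r\<close> cannot meet both \<open>A\<close> and
  \<open>B\<close>, so every sufficiently fine cover of the union splits into a cover of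
  \<open>A\<close> and a cover of \<open>B\<close> without sharing cost.\<close>

lemma hausdorff_outer_separated:
  fixes A B :: "'a::euclidean_space set"
  assumes r: "r > 0" and sep: "\<And>x y. x \<in> A \<Longrightarrow> y \<in> B \<Longrightarrow> dist x y \<ge> r"
  shows "hausdorff_outer m A + hausdorff_outer m B \<le> hausdorff_outer m (A \<union> B)"
proof -
  have *: "hausdorff_pre m \<delta> A + hausdorff_pre m \<delta>' B \<le> hausdorff_outer m (A \<union> B)"
    if "\<delta> > 0" "\<delta>' > 0" for \<delta> \<delta>'
  proof -
    define \<eta> where "\<eta> = min (min \<delta> \<delta>') (r / 2)"
    have \<eta>: "\<eta> > 0" "\<eta> \<le> \<delta>" "\<eta> \<le> \<delta>'" "\<eta> < r" using that r by (auto simp: \<eta>_def)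
    have "hausdorff_pre m \<eta> A + hausdorff_pre m \<eta> B \<le> (\<Sum>i. hcost m (C i))"
      if C: "C \<in> hcover \<eta> (A \<union> B)" for C
    proof -
      define CA where "CA i = (if C i \<inter> A = {} then {} else C i)" for i
      define CB where "CB i = (if C i \<inter> B = {} then {} else C i)" for i
      have CA: "CA \<in> hcover \<eta> A" "CB \<in> hcover \<eta> B"
        using C \<eta>(1) unfolding hcover_def CA_def CB_def by (fastforce split: if_splits)+
      have disj: "C i \<inter> A = {} \<or> C i \<inter> B = {}" for i
      proof (rule ccontr)
        assume "\<not> (C i \<inter> A = {} \<or> C i \<inter> B = {})"
        then obtain x y where xy: "x \<in> C i" "x \<in> A" "y \<in> C i" "y \<in> B" by blast
        then have "dist x y \<le> diameter (C i)"
          using C by (intro diameter_bounded_bound) (auto simp: hcover_def)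
        also have "\<dots> < r" using C \<eta>(4) by (auto simp: hcover_def intro: le_less_trans)
        finally show False using sep xy by fastforce
      qed
      have "hausdorff_pre m \<eta> A + hausdorff_pre m \<eta> B \<le> (\<Sum>i. hcost m (CA i)) + (\<Sum>i. hcost m (CB i))"
        by (intro add_mono hausdorff_pre_le CA)
      also have "\<dots> = (\<Sum>i. hcost m (CA i) + hcost m (CB i))" by (rule suminf_add) auto
      also have "\<dots> \<le> (\<Sum>i. hcost m (C i))"
      proof (rule suminf_le)
        show "hcost m (CA i) + hcost m (CB i) \<le> hcost m (C i)" for i
          using disj[of i] by (auto simp: CA_def CB_def hcost_def)
      qed auto
      finally show ?thesis .
    qed
    then have "hausdorff_pre m \<eta> A + hausdorff_pre m \<eta> B \<le> hausdorff_pre m \<eta> (A \<union> B)"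
      unfolding hausdorff_pre_alt[of m \<eta> "A \<union> B"] by (intro INF_greatest) auto
    also have "\<dots> \<le> hausdorff_outer m (A \<union> B)" by (rule hausdorff_pre_le_outer) fact
    finally show ?thesis
      using hausdorff_pre_antimono[OF \<eta>(2), of m A] hausdorff_pre_antimono[OF \<eta>(3), of m B]
      by (meson add_mono order_trans)
  qed
  have "hausdorff_outer m A + hausdorff_outer m B = (SUP \<delta>\<in>{0<..}. hausdorff_pre m \<delta> A) + hausdorff_outer m B"
    by (simp add: hausdorff_outer_def)
  also have "\<dots> = (SUP \<delta>\<in>{0<..}. hausdorff_pre m \<delta> A + hausdorff_outer m B)"
    by (subst ennreal_SUP_add_left[symmetric]) auto
  also have "\<dots> \<le> hausdorff_outer m (A \<union> B)"
  proof (rule SUP_least)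
    fix \<delta> :: real assume \<delta>: "\<delta> \<in> {0<..}"
    have "hausdorff_pre m \<delta> A + hausdorff_outer m B = (SUP \<delta>'\<in>{0<..}. hausdorff_pre m \<delta> A + hausdorff_pre m \<delta>' B)"
      unfolding hausdorff_outer_def by (subst ennreal_SUP_add_right) auto
    also have "\<dots> \<le> hausdorff_outer m (A \<union> B)"
      using \<delta> by (intro SUP_least *) auto
    finally show "hausdorff_pre m \<delta> A + hausdorff_outer m B \<le> hausdorff_outer m (A \<union> B)" .
  qed
  finally show ?thesis .
qed

text \<open>Consecutive shells touch, so additivity is available only among the even and among the
  odd ones; the two bounds add up to \<open>2 * K\<close>.\<close>

lemma shells_subadditive_sum:
  fixes f :: "nat \<Rightarrow> ennreal"
  assumes "\<And>n. (\<Sum>i<n. f (2 * i)) \<le> K" "\<And>n. (\<Sum>i<n. f (2 * i + 1)) \<le> K"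
  shows "(\<Sum>i. f i) \<le> 2 * K"
proof -
  have "(\<Sum>i<2 * n. f i) = (\<Sum>i<n. f (2 * i)) + (\<Sum>i<n. f (2 * i + 1))" for n
    by (induction n) (auto simp: algebra_simps)
  then have "(\<Sum>i<2 * n. f i) \<le> 2 * K" for n
    using add_mono[OF assms(1)[of n] assms(2)[of n]] by (simp add: mult_2)
  moreover have "(\<Sum>i<n. f i) \<le> (\<Sum>i<2 * n. f i)" for n
    by (rule sum_mono2) auto
  ultimately have "(\<Sum>i<n. f i) \<le> 2 * K" for n by (meson order_trans)
  then show ?thesis by (simp add: suminf_eq_SUP SUP_least)
qed

lemma ennreal_suminf_tail_tendsto_zero:
  fixes f :: "nat \<Rightarrow> ennreal"
  assumes fin: "(\<Sum>i. f i) \<noteq> top"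
  shows "(\<lambda>n. \<Sum>i. f (i + n)) \<longlonglongrightarrow> 0"
proof -
  define g where "g i = enn2real (f i)" for i
  have f: "f i = ennreal (g i)" for i
    using ennreal_suminf_lessD[of f top i] fin by (simp add: g_def less_top)
  have g0: "g i \<ge> 0" for i by (simp add: g_def)
  have sg: "summable g"
    using fin unfolding f by (rule summable_suminf_not_top[OF g0])
  have "(\<lambda>n. suminf g - (\<Sum>i<n. g i)) \<longlonglongrightarrow> suminf g - suminf g"
    by (intro tendsto_diff tendsto_const summable_LIMSEQ sg)
  then have "(\<lambda>n. \<Sum>i. g (i + n)) \<longlonglongrightarrow> 0"
    using suminf_minus_initial_segment[OF sg] by simp
  then have "(\<lambda>n. ennreal (\<Sum>i. g (i + n))) \<longlonglongrightarrow> ennreal 0"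
    by (rule tendsto_ennrealI)
  moreover have "ennreal (\<Sum>i. g (i + n)) = (\<Sum>i. f (i + n))" for n
    unfolding f using g0 sg by (intro suminf_ennreal2[symmetric]) (auto simp: summable_iff_shift)
  ultimately show ?thesis by simp
qed

text \<open>Caratheodory's criterion for metric outer measures. The part \<open>G n\<close> of
  \<open>T\<close> at distance at least \<open>1 / Suc n\<close> from \<open>F\<close> is separated
  from \<open>T \<inter> F\<close>; the rest of \<open>T - F\<close> consists of shells
  \<open>R i\<close> with \<open>i \<ge> n\<close>, whose measures have a finite sum and hence a
  vanishing tail.\<close>

lemma hausdorff_outer_closed_caratheodory:
  fixes F T :: "'a::euclidean_space set"
  assumes F: "closed F"
  shows "hausdorff_outer m (T \<inter> F) + hausdorff_outer m (T - F) \<le> hausdorff_outer m T"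
proof (cases "F = {} \<or> hausdorff_outer m T = top")
  case True
  then show ?thesis by (auto simp: hausdorff_outer_empty)
next
  case False
  define \<mu> where "\<mu> = (hausdorff_outer m :: 'a set \<Rightarrow> ennreal)"
  have Fne: "F \<noteq> {}" and fin: "\<mu> T \<noteq> top" using False by (auto simp: \<mu>_def)
  define G where "G n = {x \<in> T. infdist x F \<ge> 1 / real (Suc n)}" for n
  define R where "R n = {x \<in> T. 1 / real (Suc (Suc n)) \<le> infdist x F \<and> infdist x F < 1 / real (Suc n)}" for n
  have sepF: "dist x y \<ge> 1 / real (Suc n)" if "x \<in> T \<inter> F" "y \<in> G n" for x y n
    using that infdist_le[of x F y] by (auto simp: G_def dist_commute)
  have 1: "\<mu> (T \<inter> F) + \<mu> (G n) \<le> \<mu> T" for n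
  proof -
    have "\<mu> (T \<inter> F) + \<mu> (G n) \<le> \<mu> (T \<inter> F \<union> G n)"
      unfolding \<mu>_def by (rule hausdorff_outer_separated[of "1 / real (Suc n)"]) (use sepF in auto)
    also have "\<dots> \<le> \<mu> T" unfolding \<mu>_def by (rule hausdorff_outer_mono) (auto simp: G_def)
    finally show ?thesis .
  qed
  have sepR: "dist x y \<ge> 1 / real (Suc (Suc i)) - 1 / real (Suc j)" if "x \<in> R i" "y \<in> R j" for x y i j
  proof -
    have "infdist x F \<le> infdist y F + dist x y" by (rule infdist_triangle)
    with that show ?thesis by (auto simp: R_def)
  qed
  have shells: "(\<Sum>i<n. \<mu> (R (2 * i + k))) \<le> \<mu> T" for n k
  proof -
    have "(\<Sum>i<n. \<mu> (R (2 * i + k))) \<le> \<mu> (\<Union>i<n. R (2 * i + k))"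
    proof (induction n)
      case 0
      then show ?case by simp
    next
      case (Suc n)
      show ?case
      proof (cases "n = 0")
        case True
        then show ?thesis by (simp add: lessThan_Suc)
      next
        case False
        have "(\<Sum>i<Suc n. \<mu> (R (2 * i + k))) \<le> \<mu> (\<Union>i<n. R (2 * i + k)) + \<mu> (R (2 * n + k))"
          using Suc by (simp add: add_mono)
        also have "\<dots> \<le> \<mu> ((\<Union>i<n. R (2 * i + k)) \<union> R (2 * n + k))"
          unfolding \<mu>_def
        \<comment> \<open>Points of the earlier shells are at distance at least
          \<open>1 / (2 * n + k)\<close> from \<open>F\<close>, those of shell
          \<open>2 * n + k\<close> at distance below \<open>1 / (2 * n + k + 1)\<close>: skipping
          every second shell opens this gap. For \<open>n = 0\<close> and \<open>k = 0\<close> the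
          gap would read \<open>1 / 0 = 0\<close>, hence the separate case.\<close>
        proof (rule hausdorff_outer_separated[of "1 / real (2 * n + k) - 1 / real (Suc (2 * n + k))"])
          show "0 < 1 / real (2 * n + k) - 1 / real (Suc (2 * n + k))"
            using False frac_less2[of 1 1 "real (2 * n + k)" "real (Suc (2 * n + k))"] by simp
          fix x y assume "x \<in> (\<Union>i<n. R (2 * i + k))" "y \<in> R (2 * n + k)"
          then obtain i where i: "i < n" "x \<in> R (2 * i + k)" and y: "y \<in> R (2 * n + k)" by auto
          have "1 / real (2 * n + k) \<le> 1 / real (Suc (Suc (2 * i + k)))"
            using i by (intro divide_left_mono) auto
          with sepR[OF i(2) y] show "1 / real (2 * n + k) - 1 / real (Suc (2 * n + k)) \<le> dist x y"
            by linarith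
        qed
        also have "(\<Union>i<n. R (2 * i + k)) \<union> R (2 * n + k) = (\<Union>i<Suc n. R (2 * i + k))"
          by (auto simp: lessThan_Suc)
        finally show ?thesis .
      qed
    qed
    also have "\<dots> \<le> \<mu> T" unfolding \<mu>_def by (rule hausdorff_outer_mono) (auto simp: R_def)
    finally show ?thesis .
  qed
  have sumR: "(\<Sum>i. \<mu> (R i)) \<le> 2 * \<mu> T"
  proof (rule shells_subadditive_sum)
    show "(\<Sum>i<n. \<mu> (R (2 * i))) \<le> \<mu> T" "(\<Sum>i<n. \<mu> (R (2 * i + 1))) \<le> \<mu> T" for n
      using shells[where n=n and k=0] shells[where n=n and k=1] by simp_all
  qed
  then have "(\<Sum>i. \<mu> (R i)) \<noteq> top" using fin by (auto simp: ennreal_mult_eq_top_iff top_unique)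
  have dec: "T - F \<subseteq> G n \<union> (\<Union>i. R (i + n))" for n
  proof
    fix x assume x: "x \<in> T - F"
    then have pos: "infdist x F > 0"
      using in_closed_iff_infdist_zero[OF F Fne, of x] infdist_nonneg[of x F] by auto
    show "x \<in> G n \<union> (\<Union>i. R (i + n))"
    proof (cases "infdist x F \<ge> 1 / real (Suc n)")
      case True
      then show ?thesis using x by (auto simp: G_def)
    next
      case False
      obtain N where N: "1 / real (Suc N) < infdist x F" using nat_approx_posE[OF pos] .
      define j where "j = (LEAST j. 1 / real (Suc j) \<le> infdist x F)"
      have j: "1 / real (Suc j) \<le> infdist x F"
        unfolding j_def by (rule LeastI[of _ N]) (use N in simp)
      have "j > n"
      proof (rule ccontr)
        assume "\<not> j > n"
        then have "1 / real (Suc n) \<le> 1 / real (Suc j)" by (intro divide_left_mono) auto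
        with j False show False by linarith
      qed
      then obtain i where i: "j = Suc (i + n)" using less_iff_Suc_add[of n j] by (auto simp: add.commute)
      have "\<not> 1 / real (Suc (i + n)) \<le> infdist x F"
        using not_less_Least[of "i + n" "\<lambda>j. 1 / real (Suc j) \<le> infdist x F"] i by (auto simp: j_def)
      then have "x \<in> R (i + n)" using x j i by (auto simp: R_def)
      then show ?thesis by blast
    qed
  qed
  have tail: "(\<lambda>n. \<Sum>i. \<mu> (R (i + n))) \<longlonglongrightarrow> 0"
    using \<open>(\<Sum>i. \<mu> (R i)) \<noteq> top\<close> by (rule ennreal_suminf_tail_tendsto_zero)
  have "\<mu> (T \<inter> F) + \<mu> (T - F) \<le> \<mu> T + (\<Sum>i. \<mu> (R (i + n)))" for n
  proof -
    have "\<mu> (T - F) \<le> \<mu> (G n) + \<mu> (\<Union>i. R (i + n))"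
      unfolding \<mu>_def using dec by (intro order_trans[OF hausdorff_outer_mono hausdorff_outer_subadditive])
    also have "\<dots> \<le> \<mu> (G n) + (\<Sum>i. \<mu> (R (i + n)))"
      unfolding \<mu>_def by (intro add_left_mono hausdorff_outer_countably_subadditive)
    finally have "\<mu> (T \<inter> F) + \<mu> (T - F) \<le> \<mu> (T \<inter> F) + (\<mu> (G n) + (\<Sum>i. \<mu> (R (i + n))))"
      by (rule add_left_mono)
    also have "\<dots> \<le> \<mu> T + (\<Sum>i. \<mu> (R (i + n)))"
      using add_right_mono[OF 1[of n]] by (simp add: add.assoc)
    finally show ?thesis .
  qed
  moreover have "(\<lambda>n. \<mu> T + (\<Sum>i. \<mu> (R (i + n)))) \<longlonglongrightarrow> \<mu> T + 0"
    by (intro tendsto_add tendsto_const tail)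
  ultimately have "\<mu> (T \<inter> F) + \<mu> (T - F) \<le> \<mu> T + 0"
    by (intro LIMSEQ_le_const) auto
  then show ?thesis by (simp add: \<mu>_def)
qed

text \<open>\<open>measure_of\<close> returns the given set function only once it is known to be
  countably additive on the sigma-algebra. Closed sets satisfy Caratheodory's condition and generate
  the Borel sets.\<close>

theorem emeasure_hausdorff_measure:
  fixes A :: "'a::euclidean_space set"
  assumes "A \<in> sets borel"
  shows "emeasure (hausdorff_measure m) A = hausdorff_outer m A"
proof -
  interpret sigma_algebra "UNIV :: 'a set" "Pow UNIV" by (rule sigma_algebra_Pow)
  define L where "L = lambda_system (UNIV :: 'a set) (Pow UNIV) (hausdorff_outer m)"
  have om: "outer_measure_space (Pow UNIV) (hausdorff_outer m :: 'a set \<Rightarrow> ennreal)"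
    unfolding outer_measure_space_def positive_def increasing_def countably_subadditive_def
    by (auto simp: hausdorff_outer_empty intro: hausdorff_outer_mono hausdorff_outer_countably_subadditive)
  then have ms: "measure_space UNIV L (hausdorff_outer m)"
    unfolding L_def by (rule caratheodory_lemma)
  have sa: "sigma_algebra UNIV L" using ms by (simp add: measure_space_def)
  have "closed F \<Longrightarrow> F \<in> L" for F
  proof -
    assume F: "closed F"
    show "F \<in> L"
      unfolding L_def lambda_system_eq
    proof (clarsimp)
      fix T
      show "hausdorff_outer m (T \<inter> F) + hausdorff_outer m (T - F) = hausdorff_outer m T"
        using hausdorff_outer_closed_caratheodory[OF F, of m T]
          hausdorff_outer_subadditive[of m "T \<inter> F" "T - F"]
        by (simp add: Int_Diff_Un antisym)
    qed
  qed
  then have "sigma_sets UNIV (Collect closed) \<subseteq> L"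
    using sa by (intro sigma_algebra.sigma_sets_subset) auto
  then have "sets borel \<subseteq> L" by (simp add: borel_eq_closed)
  then have "measure_space UNIV (sets borel) (hausdorff_outer m :: 'a set \<Rightarrow> ennreal)"
    using ms sets.sigma_algebra_axioms[of "borel :: 'a measure"] by (intro measure_down[OF ms]) auto
  then show ?thesis
    unfolding hausdorff_measure_def
    using assms by (intro emeasure_measure_of_sigma) (auto simp: measure_space_def)
qed

lemma sets_hausdorff_measure [simp, measurable_cong]: "sets (hausdorff_measure m) = sets borel"
  unfolding hausdorff_measure_def using sets.sets_measure_of_eq[of borel] by simp


section \<open>Comparison of cone measure and Hausdorff measure on the equator\<close>

definition equator :: "'a::euclidean_space \<Rightarrow> 'a set" where
  "equator \<nu> = {\<xi>. norm \<xi> = 1 \<and> \<xi> \<bullet> \<nu> = 0}"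

lemma closed_equator: "closed (equator \<nu>)"
  unfolding equator_def by (intro closed_Collect_conj closed_Collect_eq continuous_intros)

lemma equator_sets [measurable]: "equator \<nu> \<in> sets borel"
  using closed_equator by (rule borel_closed)

lemma finite_measure_cone_measure: "norm \<nu> = 1 \<Longrightarrow> finite_measure (cone_measure \<nu>)"
  using emeasure_cone_measure_finite[of \<nu> UNIV] by (intro finite_measureI) auto

lemma emeasure_cone_measure_Int_equator:
  fixes \<nu> :: "'a::euclidean_space"
  assumes "norm \<nu> = 1" "DIM('a) \<ge> 2" and A: "A \<in> sets borel"
  shows "emeasure (cone_measure \<nu>) (A \<inter> equator \<nu>) = emeasure (cone_measure \<nu>) A"
proof -
  have "AE x in cone_measure \<nu>. x \<in> equator \<nu>"
    using cone_measure_concentrated[OF assms(1,2)]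
    by (intro AE_I[where N="- equator \<nu>"]) (auto simp: equator_def[symmetric] intro: borel_comp)
  then show ?thesis using A by (intro emeasure_eq_AE) auto
qed

text \<open>Members of a cover need be neither Borel nor on the equator. Replacing
  \<open>C i\<close> by \<open>closure (C i) \<inter> equator \<nu>\<close> achieves both without
  increasing the diameter, and then the isodiametric bound for caps applies to each member.\<close>

lemma cone_measure_le_hausdorff_pre:
  fixes \<nu> :: "'a::euclidean_space"
  assumes \<nu>: "norm \<nu> = 1" and d: "DIM('a) \<ge> 2" and A: "A \<in> sets borel" "A \<subseteq> equator \<nu>"
    and \<delta>: "\<delta> > 0" "\<delta> \<le> 1/4" "6 * \<delta> \<le> \<epsilon>"
  shows "emeasure (cone_measure \<nu>) A \<le> ennreal ((1 + \<epsilon>) ^ (DIM('a) - 2)) * hausdorff_pre (DIM('a) - 2) \<delta> A"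
proof -
  let ?m = "DIM('a) - 2"
  have "emeasure (cone_measure \<nu>) A \<le> ennreal ((1 + \<epsilon>) ^ ?m) * (\<Sum>i. hcost ?m (C i))" if C: "C \<in> hcover \<delta> A" for C
  proof -
    define B where "B i = closure (C i) \<inter> equator \<nu>" for i
    have [measurable]: "B i \<in> sets borel" for i unfolding B_def by (intro sets.Int borel_closed closed_equator) auto
    have "A \<subseteq> (\<Union>i. C i)" using C by (simp add: hcover_def)
    moreover have "C i \<inter> equator \<nu> \<subseteq> B i" for i
      unfolding B_def by (intro Int_mono closure_subset order_refl)
    ultimately have "A \<subseteq> (\<Union>i. B i)" using A(2) by blast
    then have "emeasure (cone_measure \<nu>) A \<le> emeasure (cone_measure \<nu>) (\<Union>i. B i)"
      by (intro emeasure_mono) auto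
    also have "\<dots> \<le> (\<Sum>i. emeasure (cone_measure \<nu>) (B i))"
      by (rule emeasure_subadditive_countably) auto
    also have "\<dots> \<le> (\<Sum>i. ennreal ((1 + \<epsilon>) ^ ?m) * hcost ?m (C i))"
    proof (rule suminf_le)
      fix i
      show "emeasure (cone_measure \<nu>) (B i) \<le> ennreal ((1 + \<epsilon>) ^ ?m) * hcost ?m (C i)"
      proof (cases "B i = {}")
        case False
        then have Cne: "C i \<noteq> {}" by (auto simp: B_def)
        have bd: "bounded (C i)" "diameter (C i) \<le> \<delta>" using C by (auto simp: hcover_def)
        have "emeasure (cone_measure \<nu>) (B i) \<le> ennreal ((1 + \<epsilon>) ^ ?m * (unit_ball_vol (real ?m) * (diameter (C i) / 2) ^ ?m))"
        proof (rule emeasure_cone_measure_le_diameter)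
          show "B i \<subseteq> {\<omega>. norm \<omega> = 1 \<and> \<omega> \<bullet> \<nu> = 0}" by (auto simp: B_def equator_def)
          fix a b assume "a \<in> B i" "b \<in> B i"
          then have "dist a b \<le> diameter (closure (C i))"
            using bd by (intro diameter_bounded_bound bounded_closure) (auto simp: B_def)
          then show "dist a b \<le> diameter (C i)" using bd by (simp add: diameter_closure)
        qed (use \<nu> d False bd \<delta> in auto)
        then show ?thesis using Cne \<delta> by (simp add: hcost_def ennreal_mult')
      qed simp
    qed auto
    also have "\<dots> = ennreal ((1 + \<epsilon>) ^ ?m) * (\<Sum>i. hcost ?m (C i))" by simp
    finally show ?thesis .
  qed
  note bound = this
  define k where "k = (1 + \<epsilon>) ^ ?m"
  have k: "k > 0" unfolding k_def using \<delta> by (intro zero_less_power) auto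
  then have kk: "ennreal k * ennreal (1 / k) = 1" "ennreal (1 / k) * ennreal k = 1"
    by (auto simp: ennreal_mult'[symmetric])
  \<comment> \<open>The factor is moved to the other side because the infimum over covers is bounded
    below member by member.\<close>
  have "ennreal (1 / k) * emeasure (cone_measure \<nu>) A \<le> hausdorff_pre ?m \<delta> A"
    unfolding hausdorff_pre_alt
  proof (rule INF_greatest)
    fix C assume "C \<in> hcover \<delta> A"
    from mult_left_mono[OF bound[OF this], of "ennreal (1 / k)"]
    show "ennreal (1 / k) * emeasure (cone_measure \<nu>) A \<le> (\<Sum>i. hcost ?m (C i))"
      by (simp add: k_def[symmetric] mult.assoc[symmetric] kk)
  qed
  from mult_left_mono[OF this, of "ennreal k"] show ?thesis
    by (simp add: k_def[symmetric] mult.assoc[symmetric] kk)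
qed

lemma cone_measure_le_hausdorff_outer:
  fixes \<nu> :: "'a::euclidean_space"
  assumes \<nu>: "norm \<nu> = 1" and d: "DIM('a) \<ge> 2" and A: "A \<in> sets borel" "A \<subseteq> equator \<nu>"
  shows "emeasure (cone_measure \<nu>) A \<le> hausdorff_outer (DIM('a) - 2) A"
proof (cases "hausdorff_outer (DIM('a) - 2) A")
  case top
  then show ?thesis by simp
next
  case (real c)
  have "emeasure (cone_measure \<nu>) A \<le> ennreal ((1 + \<epsilon>) ^ (DIM('a) - 2) * c)" if \<epsilon>: "\<epsilon> > 0" for \<epsilon>
  proof -
    have "emeasure (cone_measure \<nu>) A \<le> ennreal ((1 + \<epsilon>) ^ (DIM('a) - 2)) * hausdorff_pre (DIM('a) - 2) (min (1/4) (\<epsilon> / 6)) A"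
      by (rule cone_measure_le_hausdorff_pre) (use \<nu> d A \<epsilon> in auto)
    also have "\<dots> \<le> ennreal ((1 + \<epsilon>) ^ (DIM('a) - 2)) * ennreal c"
      unfolding real(2)[symmetric] using \<epsilon> by (intro mult_left_mono hausdorff_pre_le_outer) auto
    finally show ?thesis using \<epsilon> real by (simp add: ennreal_mult')
  qed
  note bound = this
  have "emeasure (cone_measure \<nu>) A \<le> ennreal ((1 + 0) ^ (DIM('a) - 2) * c)"
  proof (rule tendsto_lowerbound)
    show "((\<lambda>\<epsilon>. ennreal ((1 + \<epsilon>) ^ (DIM('a) - 2) * c)) \<longlongrightarrow> ennreal ((1 + 0) ^ (DIM('a) - 2) * c)) (at_right 0)"
      by (intro tendsto_ennrealI tendsto_intros)
    show "\<forall>\<^sub>F \<epsilon> in at_right 0. emeasure (cone_measure \<nu>) A \<le> ennreal ((1 + \<epsilon>) ^ (DIM('a) - 2) * c)"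
      using bound eventually_at_right_less[of "0::real"] by (auto elim!: eventually_mono)
  qed simp
  then show ?thesis using real by simp
qed

text \<open>Vitali's lemma with radii so small that the cost of a cap is at most
  \<open>1 + \<epsilon>\<close> times its measure. The disjoint caps \<open>b\<close> are nearly
  optimal but do not cover; the fivefold caps \<open>b5\<close> cover at the price of a dimensional
  factor. All \<open>b\<close> avoid \<open>K\<close>, so the construction can be repeated on what
  is left.\<close>

lemma vitali_caps:
  fixes \<nu> :: "'a::euclidean_space"
  assumes \<nu>: "norm \<nu> = 1" and d: "DIM('a) \<ge> 2" and \<epsilon>: "0 < \<epsilon>" "\<epsilon> \<le> 1" and \<delta>: "0 < \<delta>" and K: "closed K"
  obtains b b5 :: "nat \<Rightarrow> 'a set" where
    "\<And>n. closed (b n)" "disjoint_family b" "\<And>n. b n \<inter> K = {}"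
    "\<And>n. bounded (b n) \<and> diameter (b n) \<le> \<delta>" "\<And>n. bounded (b5 n) \<and> diameter (b5 n) \<le> \<delta>"
    "\<And>n. hcost (DIM('a) - 2) (b n) \<le> ennreal (1 + \<epsilon>) * emeasure (cone_measure \<nu>) (b n)"
    "\<And>n. hcost (DIM('a) - 2) (b5 n) = ennreal (5 ^ (DIM('a) - 2)) * hcost (DIM('a) - 2) (b n)"
    "\<And>n. emeasure (cone_measure \<nu>) (b5 n) \<le> ennreal (2 * 10 ^ (DIM('a) - 2)) * emeasure (cone_measure \<nu>) (b n)"
    "\<And>n. b5 n \<in> sets borel"
    "equator \<nu> - K \<subseteq> (\<Union>n. b5 n)"
proof -
  let ?m = "DIM('a) - 2"
  have "((\<lambda>s::real. (1 + \<epsilon>) * (1 / sqrt (1 + s\<^sup>2)) ^ (DIM('a) - 1)) \<longlongrightarrow> (1 + \<epsilon>) * (1 / sqrt (1 + 0\<^sup>2)) ^ (DIM('a) - 1)) (at_right 0)"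
    by (intro tendsto_intros) auto
  then have "\<forall>\<^sub>F s in at_right (0::real). 1 < (1 + \<epsilon>) * (1 / sqrt (1 + s\<^sup>2)) ^ (DIM('a) - 1)"
    by (rule order_tendstoD) (use \<epsilon> in auto)
  then obtain sb where sb: "sb > 0" "\<And>s. 0 < s \<Longrightarrow> s < sb \<Longrightarrow> 1 < (1 + \<epsilon>) * (1 / sqrt (1 + s\<^sup>2)) ^ (DIM('a) - 1)"
    unfolding eventually_at_right_field by auto
  \<comment> \<open>\<open>\<delta> / 10\<close> bounds the diameter of fivefold caps by
    \<open>\<delta>\<close>; \<open>1/60\<close> bounds it by \<open>1/6\<close>, where the
    isodiametric estimate holds with distortion 2; below \<open>sb\<close> the loss in the lower cap
    estimate is absorbed by \<open>1 + \<epsilon>\<close>.\<close>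
  define s0 where "s0 = min (min (1/60) (\<delta> / 10)) (sb / 2)"
  have s0: "s0 > 0" "s0 \<le> 1/60" "s0 \<le> \<delta> / 10" "s0 < sb" using \<delta> sb by (auto simp: s0_def)
  have low: "ennreal (unit_ball_vol (real ?m) * s ^ ?m) \<le> ennreal (1 + \<epsilon>) * emeasure (cone_measure \<nu>) (cball w s)"
    if w: "w \<in> equator \<nu>" and s: "0 < s" "s \<le> s0" for w s
  proof -
    define k where "k = 1 / sqrt (1 + s\<^sup>2)"
    have k: "k \<ge> 0" by (simp add: k_def)
    have "1 < (1 + \<epsilon>) * k ^ (DIM('a) - 1)" unfolding k_def using sb(2) s s0 by auto
    then have "1 * (unit_ball_vol (real ?m) * s ^ ?m) \<le> (1 + \<epsilon>) * k ^ (DIM('a) - 1) * (unit_ball_vol (real ?m) * s ^ ?m)"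
      using s by (intro mult_right_mono) auto
    then have "ennreal (unit_ball_vol (real ?m) * s ^ ?m) \<le> ennreal ((1 + \<epsilon>) * (k ^ (DIM('a) - 1) * (unit_ball_vol (real ?m) * s ^ ?m)))"
      by (intro ennreal_leI) (simp add: mult.assoc)
    also have "\<dots> = ennreal (1 + \<epsilon>) * ennreal (k ^ (DIM('a) - 1) * (unit_ball_vol (real ?m) * s ^ ?m))"
      using \<epsilon> by (intro ennreal_mult') auto
    also have "\<dots> \<le> ennreal (1 + \<epsilon>) * emeasure (cone_measure \<nu>) (cball w s)"
      unfolding k_def by (intro mult_left_mono emeasure_cone_measure_cball_ge) (use \<nu> d w s in \<open>auto simp: equator_def\<close>)
    finally show ?thesis .
  qed
  \<comment> \<open>In \<open>2 * 10 ^ m\<close> the 10 is distortion 2 times radius factor 5, and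
    the leading 2 bounds \<open>1 + \<epsilon>\<close>.\<close>
  have up: "emeasure (cone_measure \<nu>) (cball w (5 * s)) \<le> ennreal (2 * 10 ^ ?m) * emeasure (cone_measure \<nu>) (cball w s)"
    if w: "w \<in> equator \<nu>" and s: "0 < s" "s \<le> s0" for w s
  proof -
    have "w \<in> cball w (5 * s) \<inter> equator \<nu>" using w s by auto
    then have wne: "cball w (5 * s) \<inter> equator \<nu> \<noteq> {}" by blast
    have "emeasure (cone_measure \<nu>) (cball w (5 * s)) = emeasure (cone_measure \<nu>) (cball w (5 * s) \<inter> equator \<nu>)"
      by (rule emeasure_cone_measure_Int_equator[symmetric]) (use \<nu> d in auto)
    also have "\<dots> \<le> ennreal ((1 + 1) ^ ?m * (unit_ball_vol (real ?m) * ((10 * s) / 2) ^ ?m))"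
    proof (rule emeasure_cone_measure_le_diameter[where \<delta>="1/6"])
      fix a b assume ab: "a \<in> cball w (5 * s) \<inter> equator \<nu>" "b \<in> cball w (5 * s) \<inter> equator \<nu>"
      have "dist a b \<le> dist w a + dist w b" by (metis dist_commute dist_triangle)
      with ab show "dist a b \<le> 10 * s" by auto
    qed (use \<nu> d wne s s0 in \<open>auto simp: equator_def\<close>)
    also have "(1 + 1) ^ ?m * (unit_ball_vol (real ?m) * ((10 * s) / 2) ^ ?m) = 10 ^ ?m * (unit_ball_vol (real ?m) * s ^ ?m)"
    proof -
      have "(1 + 1) ^ ?m * ((10 * s) / 2) ^ ?m = (10 * s) ^ ?m"
        unfolding power_mult_distrib[symmetric] by simp
      then show ?thesis by (simp add: power_mult_distrib mult_ac)
    qed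
    also have "ennreal (10 ^ ?m * (unit_ball_vol (real ?m) * s ^ ?m)) = ennreal (10 ^ ?m) * ennreal (unit_ball_vol (real ?m) * s ^ ?m)"
      by (rule ennreal_mult') simp
    also have "\<dots> \<le> ennreal (10 ^ ?m) * (ennreal 2 * emeasure (cone_measure \<nu>) (cball w s))"
    proof (intro mult_left_mono order_trans[OF low[OF w s]] mult_right_mono)
      show "ennreal (1 + \<epsilon>) \<le> ennreal 2" using \<epsilon> by (intro ennreal_leI) auto
    qed auto
    also have "\<dots> = ennreal (2 * 10 ^ ?m) * emeasure (cone_measure \<nu>) (cball w s)"
      by (simp add: ennreal_mult' mult_ac)
    finally show ?thesis .
  qed
  have "\<exists>s. 0 < s \<and> s \<le> s0 \<and> cball \<omega> s \<inter> K = {}" if "\<omega> \<in> equator \<nu> - K" for \<omega>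
  proof -
    have "open (- K)" "\<omega> \<in> - K" using K that by auto
    then obtain e where e: "e > 0" "cball \<omega> e \<subseteq> - K" using open_contains_cball[of "- K"] by meson
    have "cball \<omega> (min e s0) \<subseteq> cball \<omega> e" by (rule subset_cball) simp
    then have "cball \<omega> (min e s0) \<inter> K = {}" using e(2) by blast
    then show ?thesis using s0(1) e(1) by (intro exI[of _ "min e s0"]) simp
  qed
  then obtain r where r: "\<And>\<omega>. \<omega> \<in> equator \<nu> - K \<Longrightarrow> 0 < r \<omega> \<and> r \<omega> \<le> s0 \<and> cball \<omega> (r \<omega>) \<inter> K = {}" by metis
  have cov: "equator \<nu> - K \<subseteq> (\<Union>i\<in>equator \<nu> - K. cball i (r i))"
  proof
    fix x assume "x \<in> equator \<nu> - K"
    moreover from this have "x \<in> cball x (r x)" using r[of x] by simp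
    ultimately show "x \<in> (\<Union>i\<in>equator \<nu> - K. cball i (r i))" by blast
  qed
  have rB: "0 < r i \<and> r i \<le> s0" if "i \<in> equator \<nu> - K" for i using r[OF that] by blast
  obtain C where C: "countable C" "C \<subseteq> equator \<nu> - K"
     "pairwise (\<lambda>i j. disjnt (cball i (r i)) (cball j (r j))) C"
     "equator \<nu> - K \<subseteq> (\<Union>i\<in>C. cball i (5 * r i))"
    by (rule Vitali_covering_lemma_cballs[OF cov rB])
  \<comment> \<open>The covering lemma yields a countable index set while Hausdorff covers are
    sequences; indices outside \<open>I\<close> receive empty caps, which are free.\<close>
  define I where "I = to_nat_on C ` C"
  define e where "e = from_nat_into C"
  have e_to: "e (to_nat_on C i) = i" if "i \<in> C" for i
    using that C(1) by (simp add: e_def)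
  have eC: "e n \<in> C" if "n \<in> I" for n using that e_to by (auto simp: I_def)
  have e_inj: "n = n'" if "n \<in> I" "n' \<in> I" "e n = e n'" for n n' using that e_to by (auto simp: I_def)
  define b where "b n = (if n \<in> I then cball (e n) (r (e n)) else {})" for n
  define b5 where "b5 n = (if n \<in> I then cball (e n) (5 * r (e n)) else {})" for n
  have rr: "e n \<in> equator \<nu>" "0 < r (e n)" "r (e n) \<le> s0" "cball (e n) (r (e n)) \<inter> K = {}" if "n \<in> I" for n
    using eC[OF that] C(2) r by blast+
  show thesis
  proof (rule that[of b b5])
    show "closed (b n)" "b5 n \<in> sets borel" for n by (auto simp: b_def b5_def)
    show "disjoint_family b"
      unfolding disjoint_family_on_def
    proof (intro ballI impI)
      fix n n' :: nat assume "n \<noteq> n'"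
      then show "b n \<inter> b n' = {}"
        using C(3) eC[of n] eC[of n'] e_inj[of n n'] unfolding b_def pairwise_def disjnt_def by simp metis
    qed
    show "b n \<inter> K = {}" for n using rr by (auto simp: b_def)
    show "bounded (b n) \<and> diameter (b n) \<le> \<delta>" "bounded (b5 n) \<and> diameter (b5 n) \<le> \<delta>" for n
      using rr[of n] s0 \<delta> by (auto simp: b_def b5_def)
    show "hcost ?m (b n) \<le> ennreal (1 + \<epsilon>) * emeasure (cone_measure \<nu>) (b n)" for n
      using rr[of n] low[of "e n" "r (e n)"] by (auto simp: b_def hcost_def)
    show "hcost ?m (b5 n) = ennreal (5 ^ ?m) * hcost ?m (b n)" for n
      using rr[of n] by (auto simp: b_def b5_def hcost_def power_mult_distrib ennreal_mult'[symmetric] mult_ac)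
    show "emeasure (cone_measure \<nu>) (b5 n) \<le> ennreal (2 * 10 ^ ?m) * emeasure (cone_measure \<nu>) (b n)" for n
      using rr[of n] up[of "e n" "r (e n)"] by (auto simp: b_def b5_def)
    show "equator \<nu> - K \<subseteq> (\<Union>n. b5 n)"
    proof
      fix x assume "x \<in> equator \<nu> - K"
      then obtain i where i: "i \<in> C" "x \<in> cball i (5 * r i)" using C(4) by blast
      then have "x \<in> b5 (to_nat_on C i)" using e_to by (auto simp: b5_def I_def)
      then show "x \<in> (\<Union>n. b5 n)" by blast
    qed
  qed
qed

text \<open>Start of the iteration: covering by the fivefold caps alone costs \<open>5 ^ m\<close>
  times the cost of disjoint caps, hence at most \<open>5 ^ m * 2\<close> times the measure, where
  \<open>m = DIM('a) - 2\<close>.\<close>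

lemma hausdorff_pre_equator_crude:
  fixes \<nu> :: "'a::euclidean_space"
  assumes \<nu>: "norm \<nu> = 1" and d: "DIM('a) \<ge> 2" and \<delta>: "0 < \<delta>" and K: "closed K"
  shows "hausdorff_pre (DIM('a) - 2) \<delta> (equator \<nu> - K) \<le> ennreal (5 ^ (DIM('a) - 2) * 2) * emeasure (cone_measure \<nu>) (equator \<nu> - K)"
proof -
  let ?m = "DIM('a) - 2"
  obtain b b5 :: "nat \<Rightarrow> 'a set" where b:
    "\<And>n. closed (b n)" "disjoint_family b" "\<And>n. b n \<inter> K = {}"
    "\<And>n. bounded (b5 n) \<and> diameter (b5 n) \<le> \<delta>"
    "\<And>n. hcost ?m (b n) \<le> ennreal (1 + 1) * emeasure (cone_measure \<nu>) (b n)"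
    "\<And>n. hcost ?m (b5 n) = ennreal (5 ^ ?m) * hcost ?m (b n)"
    "equator \<nu> - K \<subseteq> (\<Union>n. b5 n)"
    using vitali_caps[OF \<nu> d _ _ \<delta> K, of 1] by (metis zero_less_one order_refl)
  have bs: "b n \<in> sets (cone_measure \<nu>)" for n using b(1) by (simp add: borel_closed)
  have Ks: "- K \<in> sets borel" using K by (intro borel_open) auto
  have "hausdorff_pre ?m \<delta> (equator \<nu> - K) \<le> (\<Sum>n. hcost ?m (b5 n))"
    by (rule hausdorff_pre_le) (use b in \<open>auto simp: hcover_def\<close>)
  also have "\<dots> \<le> (\<Sum>n. ennreal (5 ^ ?m * 2) * emeasure (cone_measure \<nu>) (b n))"
  proof (rule suminf_le)
    show "hcost ?m (b5 n) \<le> ennreal (5 ^ ?m * 2) * emeasure (cone_measure \<nu>) (b n)" for n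
      using mult_left_mono[OF b(5)[of n], of "ennreal (5 ^ ?m)"] b(6)[of n]
      by (simp add: ennreal_mult' mult.assoc)
  qed auto
  also have "\<dots> = ennreal (5 ^ ?m * 2) * emeasure (cone_measure \<nu>) (\<Union>n. b n)"
    using bs b(2) by (subst suminf_emeasure[symmetric]) auto
  also have "\<dots> \<le> ennreal (5 ^ ?m * 2) * emeasure (cone_measure \<nu>) (- K)"
    using b(3) Ks by (intro mult_left_mono emeasure_mono) auto
  also have "emeasure (cone_measure \<nu>) (- K) = emeasure (cone_measure \<nu>) (equator \<nu> - K)"
    using emeasure_cone_measure_Int_equator[OF \<nu> d Ks] by (simp add: Diff_eq Int_commute)
  finally show ?thesis .
qed

text \<open>Finitely many disjoint caps, of almost optimal cost, exhaust a fixed fraction \<open>c\<close> of the measure;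
  the hypothesis handles the rest, which is again the complement of a closed set. Iterating drives
  the constant \<open>\<kappa>\<close> down to \<open>1 + \<epsilon>\<close>.\<close>
lemma hausdorff_pre_equator_improve:
  fixes \<nu> :: "'a::euclidean_space"
  assumes \<nu>: "norm \<nu> = 1" and d: "DIM('a) \<ge> 2" and \<delta>: "0 < \<delta>" and \<epsilon>: "0 < \<epsilon>" "\<epsilon> \<le> 1"
    and \<kappa>: "\<kappa> \<ge> 1 + \<epsilon>"
    and IH: "\<And>K. closed K \<Longrightarrow> hausdorff_pre (DIM('a) - 2) \<delta> (equator \<nu> - K) \<le> ennreal (\<kappa> * measure (cone_measure \<nu>) (equator \<nu> - K))"
    and K: "closed K" and c: "c = 1 / (4 * 10 ^ (DIM('a) - 2))"
  shows "hausdorff_pre (DIM('a) - 2) \<delta> (equator \<nu> - K) \<le> ennreal (((1 - c) * \<kappa> + c * (1 + \<epsilon>)) * measure (cone_measure \<nu>) (equator \<nu> - K))"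
proof -
  let ?m = "DIM('a) - 2"
  let ?M = "cone_measure \<nu>"
  interpret finite_measure ?M by (rule finite_measure_cone_measure) fact
  have c0: "0 < c" "c \<le> 1" unfolding c using one_le_power[of "10::real" ?m] by (simp, subst divide_le_eq_1_pos) (simp, linarith)
  obtain b b5 :: "nat \<Rightarrow> 'a set" where b:
    "\<And>n. closed (b n)" "disjoint_family b" "\<And>n. b n \<inter> K = {}"
    "\<And>n. bounded (b n) \<and> diameter (b n) \<le> \<delta>"
    "\<And>n. hcost ?m (b n) \<le> ennreal (1 + \<epsilon>) * emeasure ?M (b n)"
    "\<And>n. emeasure ?M (b5 n) \<le> ennreal (2 * 10 ^ ?m) * emeasure ?M (b n)" "\<And>n. b5 n \<in> sets borel"
    "equator \<nu> - K \<subseteq> (\<Union>n. b5 n)"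
    using vitali_caps[OF \<nu> d \<epsilon> \<delta> K] by metis
  have bs [measurable]: "b n \<in> sets ?M" for n using b(1) by (simp add: borel_closed)
  have Ks: "- K' \<in> sets borel" "equator \<nu> - K' \<in> sets borel" if "closed K'" for K'
    using that by (auto intro!: borel_open borel_comp sets.Diff borel_closed equator_sets)
  define a where "a = measure ?M (equator \<nu> - K)"
  have a: "emeasure ?M (equator \<nu> - K) = ennreal a" by (simp add: a_def emeasure_eq_measure)
  have a0: "a \<ge> 0" by (simp add: a_def)
  show ?thesis
  proof (cases "a = 0")
    case True
    then show ?thesis using IH[OF K] by (simp add: a_def)
  next
    case False
    then have apos: "a > 0" using a0 by simp
    have "ennreal a \<le> emeasure ?M (\<Union>n. b5 n)"
      unfolding a[symmetric] using b(7,8) by (intro emeasure_mono) auto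
    also have "\<dots> \<le> (\<Sum>n. emeasure ?M (b5 n))"
      using b(7) by (intro emeasure_subadditive_countably) auto
    also have "\<dots> \<le> (\<Sum>n. ennreal (2 * 10 ^ ?m) * emeasure ?M (b n))"
      by (intro suminf_le b) auto
    also have "\<dots> = ennreal (2 * 10 ^ ?m) * (\<Sum>n. emeasure ?M (b n))" by simp
    also have "(\<Sum>n. emeasure ?M (b n)) = emeasure ?M (\<Union>n. b n)"
      using b(1,2) by (intro suminf_emeasure) (auto intro: borel_closed)
    also have "\<dots> = ennreal (measure ?M (\<Union>n. b n))" by (rule emeasure_eq_measure)
    finally have "ennreal a \<le> ennreal (2 * 10 ^ ?m * measure ?M (\<Union>n. b n))" by (simp add: ennreal_mult')
    then have "a \<le> 2 * 10 ^ ?m * measure ?M (\<Union>n. b n)" by (subst (asm) ennreal_le_iff) auto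
    then have "2 * c * a \<le> measure ?M (\<Union>n. b n)" by (simp add: c field_simps)
    \<comment> \<open>The disjoint caps carry at least \<open>2 * c * a\<close>, since their
      fivefold copies cover. The constant \<open>c\<close> is half of what this gives, so that
      finitely many caps still carry more than \<open>c * a\<close>; finiteness keeps their union
      closed.\<close>
    then have lt: "c * a < measure ?M (\<Union>n. b n)" using mult_pos_pos[OF c0(1) apos] by linarith
    have "(\<lambda>n. measure ?M (b n)) sums measure ?M (\<Union>n. b n)"
      using b(1,2) by (intro finite_measure_UNION) (auto intro: borel_closed)
    then have "(\<lambda>N. \<Sum>n<N. measure ?M (b n)) \<longlonglongrightarrow> measure ?M (\<Union>n. b n)" by (simp add: sums_def)
    then have "\<forall>\<^sub>F N in sequentially. c * a < (\<Sum>n<N. measure ?M (b n))" using lt by (rule order_tendstoD)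
    then obtain N where N: "c * a < (\<Sum>n<N. measure ?M (b n))" by (auto simp: eventually_sequentially)
    define U where "U = (\<Union>n<N. b n)"
    define \<sigma> where "\<sigma> = measure ?M U"
    have Uc: "closed U" unfolding U_def using b(1) by auto
    have \<sigma>: "\<sigma> = (\<Sum>n<N. measure ?M (b n))"
      unfolding \<sigma>_def U_def using b(2)
      using b(1) by (intro finite_measure_finite_Union) (auto simp: disjoint_family_on_def intro: borel_closed)
    have UK: "U \<inter> K = {}" using b(3) by (auto simp: U_def)
    have Us: "U \<in> sets borel" using Uc by (rule borel_closed)
    have mU: "measure ?M (U \<inter> equator \<nu>) = \<sigma>"
      unfolding \<sigma>_def measure_def using emeasure_cone_measure_Int_equator[OF \<nu> d Us] by simp
    have split: "a = \<sigma> + measure ?M (equator \<nu> - (K \<union> U))"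
    proof -
      have "equator \<nu> - K = (U \<inter> equator \<nu>) \<union> (equator \<nu> - (K \<union> U))" using UK by auto
      then have "a = measure ?M ((U \<inter> equator \<nu>) \<union> (equator \<nu> - (K \<union> U)))" by (simp add: a_def)
      also have "\<dots> = measure ?M (U \<inter> equator \<nu>) + measure ?M (equator \<nu> - (K \<union> U))"
        using Us Ks[of "K \<union> U"] K Uc by (intro finite_measure_Union) auto
      finally show ?thesis by (simp add: mU)
    qed
    have hU: "hausdorff_pre ?m \<delta> U \<le> ennreal ((1 + \<epsilon>) * \<sigma>)"
    proof -
      define b' where "b' n = (if n < N then b n else {})" for n
      have "hausdorff_pre ?m \<delta> U \<le> (\<Sum>n. hcost ?m (b' n))"
        by (rule hausdorff_pre_le) (use b(4) \<delta> in \<open>force simp: hcover_def b'_def U_def\<close>)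
      also have "\<dots> = (\<Sum>n<N. hcost ?m (b' n))"
        by (rule suminf_finite) (auto simp: b'_def hcost_def)
      also have "\<dots> \<le> (\<Sum>n<N. ennreal ((1 + \<epsilon>) * measure ?M (b n)))"
        using b(5) \<epsilon> by (intro sum_mono) (auto simp: b'_def emeasure_eq_measure ennreal_mult')
      also have "\<dots> = ennreal ((1 + \<epsilon>) * \<sigma>)"
        using \<epsilon> by (subst sum_ennreal) (auto simp: \<sigma> sum_distrib_left)
      finally show ?thesis .
    qed
    have "hausdorff_pre ?m \<delta> (equator \<nu> - K) \<le> hausdorff_pre ?m \<delta> (U \<union> (equator \<nu> - (K \<union> U)))"
      by (rule hausdorff_pre_mono) auto
    also have "\<dots> \<le> hausdorff_pre ?m \<delta> U + hausdorff_pre ?m \<delta> (equator \<nu> - (K \<union> U))"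
      using \<delta> by (intro hausdorff_pre_subadditive) auto
    also have "\<dots> \<le> ennreal ((1 + \<epsilon>) * \<sigma>) + ennreal (\<kappa> * measure ?M (equator \<nu> - (K \<union> U)))"
      using K Uc by (intro add_mono hU IH) auto
    also have "\<dots> = ennreal ((1 + \<epsilon>) * \<sigma> + \<kappa> * measure ?M (equator \<nu> - (K \<union> U)))"
      using \<epsilon> \<kappa> by (intro ennreal_plus[symmetric]) (auto simp: \<sigma>_def)
    also have "\<dots> \<le> ennreal (((1 - c) * \<kappa> + c * (1 + \<epsilon>)) * a)"
    proof (rule ennreal_leI)
      \<comment> \<open>As \<open>\<kappa> \<ge> 1 + \<epsilon>\<close>, the total bound decreases
        in \<open>\<sigma>\<close>, which may therefore be replaced by its lower bound
        \<open>c * a\<close>.\<close>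
      have "(\<kappa> - (1 + \<epsilon>)) * (c * a) \<le> (\<kappa> - (1 + \<epsilon>)) * \<sigma>"
        using \<kappa> N by (intro mult_left_mono) (auto simp: \<sigma>)
      then have "(1 + \<epsilon>) * \<sigma> + \<kappa> * (a - \<sigma>) \<le> ((1 - c) * \<kappa> + c * (1 + \<epsilon>)) * a"
        by (simp add: algebra_simps)
      moreover have "measure ?M (equator \<nu> - (K \<union> U)) = a - \<sigma>" using split by simp
      ultimately show "(1 + \<epsilon>) * \<sigma> + \<kappa> * measure ?M (equator \<nu> - (K \<union> U)) \<le> ((1 - c) * \<kappa> + c * (1 + \<epsilon>)) * a"
        by simp
    qed
    finally show ?thesis by (simp add: a_def)
  qed
qed

lemma hausdorff_outer_equator_le:
  fixes \<nu> :: "'a::euclidean_space"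
  assumes \<nu>: "norm \<nu> = 1" and d: "DIM('a) \<ge> 2"
  shows "hausdorff_outer (DIM('a) - 2) (equator \<nu>) \<le> emeasure (cone_measure \<nu>) (equator \<nu>)"
proof -
  let ?m = "DIM('a) - 2"
  let ?M = "cone_measure \<nu>"
  interpret finite_measure ?M by (rule finite_measure_cone_measure) fact
  have pre: "hausdorff_pre ?m \<delta> (equator \<nu>) \<le> ennreal ((1 + \<epsilon>) * measure ?M (equator \<nu>))"
    if \<delta>: "\<delta> > 0" and \<epsilon>: "0 < \<epsilon>" "\<epsilon> \<le> 1" for \<delta> \<epsilon>
  proof -
    define c :: real where "c = 1 / (4 * 10 ^ ?m)"
    have c0: "0 < c" "c < 1" unfolding c_def using one_le_power[of "10::real" ?m] by (simp, subst divide_less_eq_1_pos) (simp, linarith)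
    \<comment> \<open>Solution of the recursion in which \<open>\<kappa> (Suc n)\<close> is
      \<open>(1 - c) * \<kappa> n + c * (1 + \<epsilon>)\<close>, started at the crude constant; it
      tends to \<open>1 + \<epsilon>\<close>.\<close>
    define \<kappa> where "\<kappa> n = (1 + \<epsilon>) + (1 - c) ^ n * (5 ^ ?m * 2 - (1 + \<epsilon>))" for n
    have five: "(1::real) \<le> 5 ^ ?m" by simp
    have "hausdorff_pre ?m \<delta> (equator \<nu> - K) \<le> ennreal (\<kappa> n * measure ?M (equator \<nu> - K))" if "closed K" for n K
      using that
    proof (induction n arbitrary: K)
      case 0
      have "0 \<le> (5::real) ^ ?m * 2" by simp
      then show ?case using hausdorff_pre_equator_crude[OF \<nu> d \<delta> 0]
        by (simp add: \<kappa>_def emeasure_eq_measure ennreal_mult'[symmetric])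
    next
      case (Suc n)
      have k: "\<kappa> n \<ge> 1 + \<epsilon>"
      proof -
        have "0 \<le> (5::real) ^ ?m * 2 - (1 + \<epsilon>)" using five \<epsilon> by linarith
        then have "0 \<le> (1 - c) ^ n * (5 ^ ?m * 2 - (1 + \<epsilon>))" using c0 by (intro mult_nonneg_nonneg) auto
        then show ?thesis unfolding \<kappa>_def by linarith
      qed
      have "hausdorff_pre ?m \<delta> (equator \<nu> - K) \<le> ennreal (((1 - c) * \<kappa> n + c * (1 + \<epsilon>)) * measure ?M (equator \<nu> - K))"
        by (rule hausdorff_pre_equator_improve[OF \<nu> d \<delta> \<epsilon> k Suc.IH Suc.prems c_def])
      also have "(1 - c) * \<kappa> n + c * (1 + \<epsilon>) = \<kappa> (Suc n)"
        by (simp add: \<kappa>_def algebra_simps)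
      finally show ?case .
    qed
    from this[of "{}"] have "hausdorff_pre ?m \<delta> (equator \<nu>) \<le> ennreal (\<kappa> n * measure ?M (equator \<nu>))" for n by simp
    moreover have "(\<lambda>n. ennreal (\<kappa> n * measure ?M (equator \<nu>))) \<longlonglongrightarrow> ennreal (((1 + \<epsilon>) + 0 * (5 ^ ?m * 2 - (1 + \<epsilon>))) * measure ?M (equator \<nu>))"
      unfolding \<kappa>_def using c0 by (intro tendsto_ennrealI tendsto_intros LIMSEQ_realpow_zero) auto
    ultimately show ?thesis by (intro LIMSEQ_le_const) auto
  qed
  have "hausdorff_pre ?m \<delta> (equator \<nu>) \<le> ennreal ((1 + 0) * measure ?M (equator \<nu>))" if \<delta>: "\<delta> > 0" for \<delta>
  proof (rule tendsto_lowerbound)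
    show "((\<lambda>\<epsilon>. ennreal ((1 + \<epsilon>) * measure ?M (equator \<nu>))) \<longlongrightarrow> ennreal ((1 + 0) * measure ?M (equator \<nu>))) (at_right 0)"
      by (intro tendsto_ennrealI tendsto_intros)
    have "\<forall>\<^sub>F \<epsilon> in at_right (0::real). 0 < \<epsilon> \<and> \<epsilon> \<le> 1"
      unfolding eventually_at_right_field by (intro exI[of _ 1]) auto
    then show "\<forall>\<^sub>F \<epsilon> in at_right 0. hausdorff_pre ?m \<delta> (equator \<nu>) \<le> ennreal ((1 + \<epsilon>) * measure ?M (equator \<nu>))"
      by eventually_elim (use pre \<delta> in auto)
  qed simp
  then show ?thesis unfolding hausdorff_outer_def by (intro SUP_least) (auto simp: emeasure_eq_measure)
qed

text \<open>On Borel subsets of the equator the Hausdorff measure dominates the cone measure, while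
  its total mass is no larger. An excess on \<open>A\<close> would need a deficit on the complement,
  so the two agree.\<close>

theorem hausdorff_measure_equator:
  fixes \<nu> :: "'a::euclidean_space"
  assumes \<nu>: "norm \<nu> = 1" and d: "DIM('a) \<ge> 2"
  shows "density (hausdorff_measure (DIM('a) - 2)) (indicator (equator \<nu>)) = cone_measure \<nu>"
proof (rule measure_eqI)
  let ?H = "hausdorff_measure (DIM('a) - 2) :: 'a measure"
  let ?M = "cone_measure \<nu>"
  interpret finite_measure ?M by (rule finite_measure_cone_measure) fact
  have H: "emeasure ?H B = hausdorff_outer (DIM('a) - 2) B" if "B \<in> sets borel" for B :: "'a set"
    using that by (rule emeasure_hausdorff_measure)
  fix A assume "A \<in> sets (density ?H (indicator (equator \<nu>)))"
  then have [measurable]: "A \<in> sets borel" by simp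
  have eS: "emeasure ?H (equator \<nu>) \<le> emeasure ?M (equator \<nu>)"
    using hausdorff_outer_equator_le[OF \<nu> d] by (simp add: H)
  have ge: "emeasure ?M B \<le> emeasure ?H B" if "B \<in> sets borel" "B \<subseteq> equator \<nu>" for B
    using cone_measure_le_hausdorff_outer[OF \<nu> d that] that by (simp add: H)
  have addH: "emeasure ?H (A \<inter> equator \<nu>) + emeasure ?H (equator \<nu> - A) = emeasure ?H (equator \<nu>)"
    by (subst plus_emeasure) (auto intro!: arg_cong2[where f=emeasure])
  have addM: "emeasure ?M (A \<inter> equator \<nu>) + emeasure ?M (equator \<nu> - A) = emeasure ?M (equator \<nu>)"
    by (subst plus_emeasure) (auto intro!: arg_cong2[where f=emeasure])
  have "emeasure ?H (A \<inter> equator \<nu>) + emeasure ?M (equator \<nu> - A) \<le> emeasure ?M (A \<inter> equator \<nu>) + emeasure ?M (equator \<nu> - A)"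
    using add_left_mono[OF ge[of "equator \<nu> - A"], of "emeasure ?H (A \<inter> equator \<nu>)"] addH eS addM
    by (auto intro: order_trans)
  then have "emeasure ?H (A \<inter> equator \<nu>) \<le> emeasure ?M (A \<inter> equator \<nu>)"
    using emeasure_finite[of "equator \<nu> - A"] by (simp add: ennreal_add_left_cancel_le add.commute)
  then have "emeasure ?H (A \<inter> equator \<nu>) = emeasure ?M (A \<inter> equator \<nu>)"
    using ge[of "A \<inter> equator \<nu>"] by (simp add: antisym)
  also have "\<dots> = emeasure ?M A" by (rule emeasure_cone_measure_Int_equator) (use \<nu> d in auto)
  finally show "emeasure (density ?H (indicator (equator \<nu>))) A = emeasure ?M A"
    by (subst emeasure_density) (auto simp: indicator_inter_arith[symmetric] Int_commute)
qed auto

section \<open>Second-order expansion of the deformed boundary\<close>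


lemma vector_derivative_bound:
  fixes F :: "real \<Rightarrow> 'b::real_normed_vector"
  assumes "a \<le> b" and F: "\<And>t. a \<le> t \<Longrightarrow> t \<le> b \<Longrightarrow> (F has_vector_derivative F' t) (at t)"
    and B: "\<And>t. a \<le> t \<Longrightarrow> t \<le> b \<Longrightarrow> norm (F' t) \<le> B"
  shows "norm (F b - F a) \<le> B * (b - a)"
proof -
  have "norm (F b - F a) \<le> B * norm (b - a)"
  proof (rule differentiable_bound[where S="{a..b}" and f'="\<lambda>t h. h *\<^sub>R F' t"])
    fix t assume t: "t \<in> {a..b}"
    then show "(F has_derivative (\<lambda>h. h *\<^sub>R F' t)) (at t within {a..b})"
      using F[of t] by (auto simp: has_vector_derivative_def intro: has_derivative_at_withinI)
    show "onorm (\<lambda>h. h *\<^sub>R F' t) \<le> B"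
      using B[of t] t by (intro onorm_le) (simp add: mult.commute[of B] mult_left_mono)
  qed (use \<open>a \<le> b\<close> in auto)
  with \<open>a \<le> b\<close> show ?thesis by simp
qed

text \<open>The quadratic term uses a fixed form \<open>B\<close> and not \<open>F'' p\<close>:
  \<open>B = 0\<close> serves the near-identity diffeomorphisms, whose second derivative is small,
  and \<open>B = f'' 0\<close> serves \<open>f\<close> expanded at base points near 0. A derivative
  bound is integrated twice along the segment.\<close>

lemma C2_taylor:
  fixes F :: "'a::euclidean_space \<Rightarrow> 'b::euclidean_space"
  assumes F: "C2_with F F' F''" and B: "\<And>t. 0 \<le> t \<Longrightarrow> t \<le> 1 \<Longrightarrow> norm (F'' (p + t *\<^sub>R k) - B) \<le> e"
  shows "norm (F (p + k) - F p - F' p k - (1/2) *\<^sub>R B k k) \<le> e * (norm k)\<^sup>2"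
proof -
  have dF: "(F has_derivative F' y) (at y)" and dF': "(F' has_derivative F'' y) (at y)" for y
    using F by (auto simp: C2_with_def)
  have e0: "e \<ge> 0" using B[of 0] norm_ge_zero[of "F'' (p + 0 *\<^sub>R k) - B"] by linarith
  have line: "((\<lambda>t. p + t *\<^sub>R k) has_derivative (\<lambda>h. h *\<^sub>R k)) (at t)" for t
    by (auto intro!: derivative_eq_intros)
  have vF: "((\<lambda>t. F (p + t *\<^sub>R k)) has_vector_derivative F' (p + t *\<^sub>R k) k) (at t)" for t
    using has_derivative_compose[OF line dF]
    by (simp add: has_vector_derivative_def blinfun.scaleR_right)
  have vF': "((\<lambda>t. F' (p + t *\<^sub>R k)) has_vector_derivative F'' (p + t *\<^sub>R k) k) (at t)" for t
    using has_derivative_compose[OF line dF']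
    by (simp add: has_vector_derivative_def blinfun.scaleR_right)
  have b1: "norm (F' (p + t *\<^sub>R k) - F' p - t *\<^sub>R B k) \<le> e * norm k * t" if t: "0 \<le> t" "t \<le> 1" for t
  proof -
    have "norm ((F' (p + t *\<^sub>R k) - t *\<^sub>R B k) - (F' (p + 0 *\<^sub>R k) - 0 *\<^sub>R B k)) \<le> (e * norm k) * (t - 0)"
    proof (rule vector_derivative_bound)
      fix s assume s: "0 \<le> s" "s \<le> t"
      show "((\<lambda>s. F' (p + s *\<^sub>R k) - s *\<^sub>R B k) has_vector_derivative F'' (p + s *\<^sub>R k) k - B k) (at s)"
        by (auto intro!: derivative_eq_intros vF')
      have "norm (F'' (p + s *\<^sub>R k) k - B k) = norm ((F'' (p + s *\<^sub>R k) - B) k)" by (simp add: blinfun.diff_left)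
      also have "\<dots> \<le> norm (F'' (p + s *\<^sub>R k) - B) * norm k" by (rule norm_blinfun)
      also have "\<dots> \<le> e * norm k" using s t by (intro mult_right_mono B) auto
      finally show "norm (F'' (p + s *\<^sub>R k) k - B k) \<le> e * norm k" .
    qed (use t in auto)
    then show ?thesis by (simp add: algebra_simps)
  qed
  have "norm ((F (p + 1 *\<^sub>R k) - 1 *\<^sub>R F' p k - (1\<^sup>2 / 2) *\<^sub>R B k k) - (F (p + 0 *\<^sub>R k) - 0 *\<^sub>R F' p k - (0\<^sup>2 / 2) *\<^sub>R B k k))
     \<le> (e * (norm k)\<^sup>2) * (1 - 0)"
  proof (rule vector_derivative_bound)
    fix t :: real assume t: "0 \<le> t" "t \<le> 1"
    show "((\<lambda>t. F (p + t *\<^sub>R k) - t *\<^sub>R F' p k - (t\<^sup>2 / 2) *\<^sub>R B k k) has_vector_derivative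
        F' (p + t *\<^sub>R k) k - F' p k - t *\<^sub>R B k k) (at t)"
      by (auto intro!: derivative_eq_intros vF simp: has_real_derivative_iff_has_vector_derivative[symmetric])
    have "norm (F' (p + t *\<^sub>R k) k - F' p k - t *\<^sub>R B k k) = norm ((F' (p + t *\<^sub>R k) - F' p - t *\<^sub>R B k) k)"
      by (simp add: blinfun.diff_left blinfun.scaleR_left)
    also have "\<dots> \<le> norm (F' (p + t *\<^sub>R k) - F' p - t *\<^sub>R B k) * norm k" by (rule norm_blinfun)
    also have "\<dots> \<le> (e * norm k * t) * norm k" using t by (intro mult_right_mono b1) auto
    also have "\<dots> \<le> (e * norm k * 1) * norm k" using t e0 by (intro mult_right_mono mult_left_mono) auto
    finally show "norm (F' (p + t *\<^sub>R k) k - F' p k - t *\<^sub>R B k k) \<le> e * (norm k)\<^sup>2"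
      by (simp add: power2_eq_square mult_ac)
  qed auto
  then show ?thesis by (simp add: algebra_simps)
qed

lemma C2_near_id_diff:
  fixes \<Phi> :: "'a::euclidean_space \<Rightarrow> 'a"
  assumes \<Phi>: "C2_with \<Phi> \<Phi>' \<Phi>''" and e: "\<And>y. norm (\<Phi>' y - id_blinfun) \<le> e"
  shows "norm ((\<Phi> (w + k) - \<Phi> w) - k) \<le> e * norm k"
proof -
  have "norm ((\<Phi> (w + k) - (w + k)) - (\<Phi> w - w)) \<le> e * norm ((w + k) - w)"
  proof (rule differentiable_bound[where S=UNIV and f'="\<lambda>y. blinfun_apply (\<Phi>' y - id_blinfun)"])
    show "((\<lambda>y. \<Phi> y - y) has_derivative blinfun_apply (\<Phi>' y - id_blinfun)) (at y within UNIV)" for y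
    proof -
      have "(\<Phi> has_derivative \<Phi>' y) (at y)" using \<Phi> by (simp add: C2_with_def)
      then show ?thesis by (auto intro!: derivative_eq_intros simp: blinfun.diff_left fun_eq_iff)
    qed
    show "onorm (blinfun_apply (\<Phi>' y - id_blinfun)) \<le> e" for y
      using e[of y] by (simp add: norm_blinfun.rep_eq)
  qed auto
  then show ?thesis by (simp add: algebra_simps)
qed

section \<open>A defining function of \<open>F r\<close> near \<open>x\<close>\<close>

lemma local_graph_mem_iff:
  assumes "norm \<nu> = 1" "y \<in> ball x \<rho>"
    and "E \<inter> ball x \<rho> = {x + z + t *\<^sub>R \<nu> | z t. z \<bullet> \<nu> = 0 \<and> t \<le> f z} \<inter> ball x \<rho>"
  shows "y \<in> E \<longleftrightarrow> (y - x) \<bullet> \<nu> - f (perp \<nu> (y - x)) \<le> 0"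
proof -
  have "y \<in> E \<longleftrightarrow> y \<in> {x + z + t *\<^sub>R \<nu> | z t. z \<bullet> \<nu> = 0 \<and> t \<le> f z}" using assms by blast
  also have "\<dots> \<longleftrightarrow> (y - x) \<bullet> \<nu> - f (perp \<nu> (y - x)) \<le> 0"
  proof
    assume "y \<in> {x + z + t *\<^sub>R \<nu> | z t. z \<bullet> \<nu> = 0 \<and> t \<le> f z}"
    then obtain z t where y: "y = x + z + t *\<^sub>R \<nu>" "z \<bullet> \<nu> = 0" "t \<le> f z" by blast
    have "perp \<nu> (y - x) = z" using y assms(1) by (simp add: perp_add perp_scaleR perp_self perp_id)
    moreover have "(y - x) \<bullet> \<nu> = t" using y assms(1) by (simp add: inner_add_left dot_square_norm)
    ultimately show "(y - x) \<bullet> \<nu> - f (perp \<nu> (y - x)) \<le> 0" using y by simp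
  next
    assume "(y - x) \<bullet> \<nu> - f (perp \<nu> (y - x)) \<le> 0"
    moreover have "y = x + perp \<nu> (y - x) + ((y - x) \<bullet> \<nu>) *\<^sub>R \<nu>" by (simp add: perp_def)
    ultimately show "y \<in> {x + z + t *\<^sub>R \<nu> | z t. z \<bullet> \<nu> = 0 \<and> t \<le> f z}"
      using perp_inner[OF assms(1), of "y - x"] by fastforce
  qed
  finally show ?thesis .
qed

lemma linear_functional_inner:
  fixes l :: "'a::euclidean_space \<Rightarrow> real"
  assumes "linear l"
  obtains a where "\<And>h. l h = a \<bullet> h"
proof -
  have "l h = (\<Sum>b\<in>Basis. l b *\<^sub>R b) \<bullet> h" for h
  proof -
    have "l h = l (\<Sum>b\<in>Basis. (h \<bullet> b) *\<^sub>R b)" by (simp add: euclidean_representation)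
    also have "\<dots> = (\<Sum>b\<in>Basis. (h \<bullet> b) * l b)"
      by (simp add: linear_sum[OF assms] linear_scale[OF assms])
    finally show ?thesis by (simp add: inner_sum_left inner_sum_right inner_commute mult.commute)
  qed
  then show ?thesis using that by blast
qed

text \<open>Membership in \<open>F r\<close> is membership of the preimage in \<open>E\<close>, so
  \<open>v\<close> is the defining function of \<open>E\<close> composed with the inverse
  \<open>\<Psi>\<close>. Only derivatives of \<open>\<Phi> r\<close> are controlled uniformly in
  \<open>r\<close>, so \<open>\<Psi>\<close> is expanded indirectly, by inverting the Taylor
  expansion of \<open>\<Phi> r\<close>. The radius \<open>\<delta>\<close> is fixed before
  \<open>r\<close>.\<close>

lemma convC_expansion:
  fixes E :: "'a::euclidean_space set"
  assumes lg: "local_graph E x \<nu> f f' f''" and conv: "convC F E"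
    and Fc: "\<forall>r>0. F r \<in> classC" and Fx: "\<forall>r>0. x \<in> frontier (F r)" and \<epsilon>: "\<epsilon> > 0"
  shows "\<exists>\<delta>>0. \<forall>\<^sub>F r in at_right 0. \<exists>a v. norm (a - \<nu>) \<le> \<epsilon> \<and>
     (\<forall>h. norm h < \<delta> \<longrightarrow> (x + h \<in> F r \<longleftrightarrow> v h \<le> 0) \<and>
        \<bar>v h - (a \<bullet> h - f'' 0 (perp \<nu> h) (perp \<nu> h) / 2)\<bar> \<le> \<epsilon> * (norm h)\<^sup>2)"
proof -
  have \<nu>: "norm \<nu> = 1" and f: "C2_with f f' f''" and f0: "f' 0 = 0" using lg by (auto simp: local_graph_def)
  obtain \<rho> where \<rho>: "\<rho> > 0" "E \<inter> ball x \<rho> = {x + z + t *\<^sub>R \<nu> | z t. z \<bullet> \<nu> = 0 \<and> t \<le> f z} \<inter> ball x \<rho>"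
    using lg by (auto simp: local_graph_def)
  have df: "(f has_derivative f' y) (at y)" and df': "(f' has_derivative f'' y) (at y)" for y
    using f by (auto simp: C2_with_def)
  have cf'': "continuous_on UNIV f''" using f by (simp add: C2_with_def)
  define M where "M = norm (f'' 0)"
  have M0: "M \<ge> 0" by (simp add: M_def)
  have "isCont f'' 0" using cf'' by (simp add: continuous_on_eq_continuous_at)
  then obtain \<delta>1 where \<delta>1: "\<delta>1 > 0" "\<And>y. norm y < \<delta>1 \<Longrightarrow> norm (f'' y - f'' 0) < \<epsilon> / 8"
    using \<epsilon> unfolding continuous_at_eps_delta by (auto dest!: spec[of _ "\<epsilon> / 8"] simp: dist_norm)
  have "isCont f' 0" using df' by (rule has_derivative_continuous)
  then obtain \<delta>2 where \<delta>2: "\<delta>2 > 0" "\<And>y. norm y < \<delta>2 \<Longrightarrow> norm (f' y) < min 1 (\<epsilon> / 4)"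
    using \<epsilon> unfolding continuous_at_eps_delta by (auto dest!: spec[of _ "min 1 (\<epsilon> / 4)"] simp: dist_norm f0)
  \<comment> \<open>\<open>1/2\<close> makes the inverse differential bounded by 2;
    \<open>\<rho> / 2\<close> keeps preimages where \<open>E\<close> is a graph; the bounds by
    \<open>\<delta>1\<close> and \<open>\<delta>2\<close> keep base point and segments where
    \<open>f''\<close> and \<open>f'\<close> vary little; \<open>16 + 3 * M\<close> collects the
    final error coefficients \<open>8 + 8 + 6 * M / 2\<close>; \<open>\<epsilon> / 4\<close> serves
    the estimate of \<open>a - \<nu>\<close>.\<close>
  define e where "e = Min {1/2, \<rho> / 2, \<delta>1 / 4, \<delta>2 / 2, \<epsilon> / (2 * (16 + 3 * M)), \<epsilon> / 4}"
  have e: "e > 0" "e \<le> 1/2" "e \<le> \<rho> / 2" "e \<le> \<delta>1 / 4" "e \<le> \<delta>2 / 2" "e \<le> \<epsilon> / (2 * (16 + 3 * M))" "e \<le> \<epsilon> / 4"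
  proof -
    have "0 < \<epsilon> / (2 * (16 + 3 * M))" using \<epsilon> M0 by (intro divide_pos_pos) auto
    then show "e > 0" unfolding e_def using \<rho>(1) \<delta>1(1) \<delta>2(1) \<epsilon> by (subst Min_gr_iff) auto
  qed (unfold e_def, (rule Min_le; simp)+)
  have eM: "e * (16 + 3 * M) \<le> \<epsilon> / 2" using e(6) M0 by (subst (asm) pos_le_divide_eq) (auto simp: algebra_simps)
  define \<delta> where "\<delta> = min (\<rho> / 2) (\<delta>1 / 4)"
  have \<delta>: "\<delta> > 0" "\<delta> \<le> \<rho> / 2" "\<delta> \<le> \<delta>1 / 4" using \<rho>(1) \<delta>1(1) by (auto simp: \<delta>_def)
  obtain \<Phi> \<Phi>' \<Phi>'' where ev1: "\<forall>\<^sub>F r in at_right 0. C2_diffeo (\<Phi> r) (\<Phi>' r) (\<Phi>'' r) \<and> \<Phi> r ` E = F r"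
    and ev2: "\<forall>\<epsilon>>0. \<forall>\<^sub>F r in at_right 0. \<forall>y. norm (\<Phi> r y - y) \<le> \<epsilon> \<and> norm (\<Phi>' r y - id_blinfun) \<le> \<epsilon> \<and> norm (\<Phi>'' r y) \<le> \<epsilon>"
    using conv unfolding convC_def by blast
  have ev3: "\<forall>\<^sub>F r in at_right 0. \<forall>y. norm (\<Phi> r y - y) \<le> e \<and> norm (\<Phi>' r y - id_blinfun) \<le> e \<and> norm (\<Phi>'' r y) \<le> e"
    using ev2 e(1) by blast
  have ev0: "\<forall>\<^sub>F r in at_right (0::real). r > 0" by (rule eventually_at_right_less)
  show ?thesis
  proof (intro exI[of _ \<delta>] conjI \<delta>(1))
    show "\<forall>\<^sub>F r in at_right 0. \<exists>a v. norm (a - \<nu>) \<le> \<epsilon> \<and>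
     (\<forall>h. norm h < \<delta> \<longrightarrow> (x + h \<in> F r \<longleftrightarrow> v h \<le> 0) \<and>
        \<bar>v h - (a \<bullet> h - f'' 0 (perp \<nu> h) (perp \<nu> h) / 2)\<bar> \<le> \<epsilon> * (norm h)\<^sup>2)"
      using ev0 ev1 ev3
    proof eventually_elim
      case (elim r)
      have \<Phi>: "C2_with (\<Phi> r) (\<Phi>' r) (\<Phi>'' r)" using elim(2) by (simp add: C2_diffeo_def)
      have b0: "norm (\<Phi> r y - y) \<le> e" and b1: "norm (\<Phi>' r y - id_blinfun) \<le> e" and b2: "norm (\<Phi>'' r y) \<le> e" for y
        using elim(3) by auto
      obtain \<Psi> \<Psi>' \<Psi>'' where \<Psi>: "C2_with \<Psi> \<Psi>' \<Psi>''" and inv: "\<And>y. \<Psi> (\<Phi> r y) = y" "\<And>y. \<Phi> r (\<Psi> y) = y"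
        using elim(2) by (auto simp: C2_diffeo_def)
      have d\<Phi>: "(\<Phi> r has_derivative \<Phi>' r y) (at y)" for y using \<Phi> by (simp add: C2_with_def)
      have d\<Psi>: "(\<Psi> has_derivative \<Psi>' y) (at y)" for y using \<Psi> by (simp add: C2_with_def)
      \<comment> \<open>\<open>\<Phi> r\<close> moves \<open>w0\<close> to \<open>x\<close>. In
        general \<open>w0\<close> differs from \<open>x\<close>, so the expansions of
        \<open>\<Phi> r\<close> and \<open>f\<close> are centred there and not at
        \<open>x\<close>.\<close>
      define w0 where "w0 = \<Psi> x"
      have \<Phi>w0: "\<Phi> r w0 = x" by (simp add: w0_def inv)
      define A where "A = \<Psi>' x"
      have \<Phi>A: "\<Phi>' r w0 (A h) = h" for h
      proof -
        have "((\<lambda>y. \<Phi> r (\<Psi> y)) has_derivative (\<lambda>h. \<Phi>' r w0 (A h))) (at x)"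
          using has_derivative_compose[OF d\<Psi>[of x] d\<Phi>] by (simp add: w0_def A_def)
        then have "((\<lambda>y. y) has_derivative (\<lambda>h. \<Phi>' r w0 (A h))) (at x)" by (simp add: inv)
        from has_derivative_unique[OF this has_derivative_ident] show ?thesis by (simp add: fun_eq_iff)
      qed
      have A\<Phi>: "A (\<Phi>' r w0 h) = h" for h
      proof -
        have "((\<lambda>y. \<Psi> (\<Phi> r y)) has_derivative (\<lambda>h. \<Psi>' (\<Phi> r w0) (\<Phi>' r w0 h))) (at w0)"
          using has_derivative_compose[OF d\<Phi>[of w0] d\<Psi>] by simp
        then have "((\<lambda>y. y) has_derivative (\<lambda>h. A (\<Phi>' r w0 h))) (at w0)" by (simp add: inv \<Phi>w0 A_def)
        from has_derivative_unique[OF this has_derivative_ident] show ?thesis by (simp add: fun_eq_iff)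
      qed
      have hA: "norm (A h - h) \<le> e * norm (A h)" for h
      proof -
        have "h - A h = (\<Phi>' r w0 - id_blinfun) (A h)" by (simp add: blinfun.diff_left \<Phi>A)
        then have "norm (h - A h) \<le> norm (\<Phi>' r w0 - id_blinfun) * norm (A h)" by (metis norm_blinfun)
        also have "\<dots> \<le> e * norm (A h)" by (intro mult_right_mono b1) auto
        finally show ?thesis by (simp add: norm_minus_commute)
      qed
      have A2: "norm (A h) \<le> 2 * norm h" for h
      proof -
        have "norm (A h) \<le> norm h + norm (A h - h)" by (metis norm_triangle_sub)
        also have "\<dots> \<le> norm h + (1/2) * norm (A h)"
          using hA[of h] mult_right_mono[OF e(2) norm_ge_zero[of "A h"]] by linarith
        finally show ?thesis by simp
      qed
      have hA': "norm (A h - h) \<le> 2 * e * norm h" for h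
      proof -
        have "norm (A h - h) \<le> e * norm (A h)" by (rule hA)
        also have "\<dots> \<le> e * (2 * norm h)" using e(1) by (intro mult_left_mono A2) auto
        finally show ?thesis by simp
      qed
      define u where "u y = (y - x) \<bullet> \<nu> - f (perp \<nu> (y - x))" for y
      define v where "v h = u (\<Psi> (x + h))" for h
      have near: "norm (\<Psi> y - y) \<le> e" for y
        using b0[of "\<Psi> y"] by (simp add: inv norm_minus_commute)
      have memF: "y \<in> F r \<longleftrightarrow> \<Psi> y \<in> E" for y
      proof -
        have "F r = \<Phi> r ` E" using elim(2) by simp
        then show ?thesis using inv by (metis image_iff)
      qed
      have mem: "x + h \<in> F r \<longleftrightarrow> v h \<le> 0" if h: "norm h < \<rho> / 2" for h
      proof -
        have "dist x (\<Psi> (x + h)) \<le> dist x (x + h) + dist (x + h) (\<Psi> (x + h))" by (rule dist_triangle)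
        also have "\<dots> \<le> norm h + e" using near[of "x + h"] by (simp add: dist_norm norm_minus_commute)
        also have "\<dots> < \<rho>" using h e(3) by linarith
        finally have "\<Psi> (x + h) \<in> ball x \<rho>" by simp
        from local_graph_mem_iff[OF \<nu> this \<rho>(2)] show ?thesis by (simp add: memF v_def u_def)
      qed
      have contv: "continuous_on UNIV v"
      proof -
        have cf: "continuous_on UNIV f" by (intro continuous_at_imp_continuous_on ballI has_derivative_continuous[OF df])
        have c\<Psi>: "continuous_on UNIV \<Psi>" by (intro continuous_at_imp_continuous_on ballI has_derivative_continuous[OF d\<Psi>])
        show ?thesis unfolding v_def u_def perp_def
          by (intro continuous_intros continuous_on_compose2[OF cf] continuous_on_compose2[OF c\<Psi>]) auto
      qed
      \<comment> \<open>\<open>x\<close> lies in the closed set \<open>F r\<close>, so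
        \<open>v 0 \<le> 0\<close>; a negative value would put a whole ball around \<open>x\<close>
        into \<open>F r\<close>, against \<open>x\<close> being a frontier point.\<close>
      have v0: "v 0 = 0"
      proof -
        have fr: "x \<in> frontier (F r)" using Fx elim(1) by blast
        have "closed (F r)" using Fc elim(1) by (auto simp: classC_def)
        then have "x \<in> F r" using fr frontier_subset_closed by blast
        then have le: "v 0 \<le> 0" using mem[of 0] \<rho>(1) by simp
        show ?thesis
        proof (rule ccontr)
          assume "v 0 \<noteq> 0"
          then have "v 0 < 0" using le by simp
          moreover have "isCont v 0" using contv by (simp add: continuous_on_eq_continuous_at)
          ultimately obtain d where d: "d > 0" "\<And>h. norm h < d \<Longrightarrow> dist (v h) (v 0) < - v 0"
            unfolding continuous_at_eps_delta by (auto dest!: spec[of _ "- v 0"] simp: dist_norm)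
          have "ball x (min d (\<rho> / 2)) \<subseteq> F r"
          proof
            fix y assume "y \<in> ball x (min d (\<rho> / 2))"
            then have y: "norm (y - x) < d" "norm (y - x) < \<rho> / 2" by (auto simp: dist_norm norm_minus_commute)
            have "v (y - x) < 0" using d(2)[OF y(1)] by (auto simp: dist_real_def)
            then show "y \<in> F r" using mem[OF y(2)] by simp
          qed
          then have "x \<in> interior (F r)" using d(1) \<rho>(1) by (intro interiorI[of "ball x (min d (\<rho> / 2))"]) auto
          then show False using fr by (simp add: frontier_def)
        qed
      qed
      \<comment> \<open>The base point for \<open>f\<close>: its gradient \<open>f' p\<close> is no
        longer zero, only small, and this tilts the normal from \<open>\<nu>\<close> to
        \<open>a\<close>.\<close>
      define p where "p = perp \<nu> (w0 - x)"
      have np: "norm p \<le> e"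
        unfolding p_def using near[of x] norm_perp_le[OF \<nu>, of "w0 - x"] by (simp add: w0_def)
      have f'p: "norm (f' p) < min 1 (\<epsilon> / 4)" by (rule \<delta>2(2)) (use np e(1,5) \<delta>2(1) in linarith)
      \<comment> \<open>The differential of \<open>v\<close> at 0 by the chain rule;
        \<open>a\<close> is its gradient.\<close>
      define l where "l h = A h \<bullet> \<nu> - f' p (perp \<nu> (A h))" for h
      have "linear l"
        unfolding l_def by (auto intro!: linearI simp: blinfun.add_right blinfun.scaleR_right perp_add perp_scaleR inner_add_left algebra_simps)
      then obtain a where a: "\<And>h. l h = a \<bullet> h" using linear_functional_inner by blast
      have la: "\<bar>l h - \<nu> \<bullet> h\<bar> \<le> \<epsilon> * norm h" for h
      proof -
        have "l h - \<nu> \<bullet> h = (A h - h) \<bullet> \<nu> - f' p (perp \<nu> (A h))" by (simp add: l_def inner_diff_left inner_diff_right inner_commute)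
        also have "\<bar>\<dots>\<bar> \<le> \<bar>(A h - h) \<bullet> \<nu>\<bar> + \<bar>f' p (perp \<nu> (A h))\<bar>" by (rule abs_triangle_ineq4)
        also have "\<bar>(A h - h) \<bullet> \<nu>\<bar> \<le> 2 * e * norm h"
          using Cauchy_Schwarz_ineq2[of "A h - h" \<nu>] hA'[of h] \<nu> by simp
        also have "\<bar>f' p (perp \<nu> (A h))\<bar> \<le> norm (f' p) * norm (perp \<nu> (A h))"
          using norm_blinfun[of "f' p" "perp \<nu> (A h)"] by simp
        also have "\<dots> \<le> (\<epsilon> / 4) * (2 * norm h)"
          using f'p \<epsilon> by (intro mult_mono order_trans[OF norm_perp_le[OF \<nu>] A2]) auto
        finally have "\<bar>l h - \<nu> \<bullet> h\<bar> \<le> 2 * e * norm h + (\<epsilon> / 4) * (2 * norm h)" by simp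
        also have "\<dots> \<le> 2 * (\<epsilon> / 4) * norm h + (\<epsilon> / 4) * (2 * norm h)"
          using e(7) by (intro add_right_mono mult_right_mono) auto
        finally show ?thesis by simp
      qed
      have an: "norm (a - \<nu>) \<le> \<epsilon>"
      proof (cases "a = \<nu>")
        case False
        have "(norm (a - \<nu>))\<^sup>2 = l (a - \<nu>) - \<nu> \<bullet> (a - \<nu>)"
          by (simp add: a power2_norm_eq_inner inner_diff_left)
        also have "\<dots> \<le> \<epsilon> * norm (a - \<nu>)" using la[of "a - \<nu>"] by linarith
        finally show ?thesis using False by (simp add: power2_eq_square)
      qed (use \<epsilon> in auto)
      have exp: "\<bar>v h - (a \<bullet> h - f'' 0 (perp \<nu> h) (perp \<nu> h) / 2)\<bar> \<le> \<epsilon> * (norm h)\<^sup>2" if h: "norm h < \<delta>" for h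
      proof -
        define k where "k = \<Psi> (x + h) - w0"
        have hk: "\<Phi> r (w0 + k) - \<Phi> r w0 = h" by (simp add: k_def inv \<Phi>w0)
        have hk1: "norm (h - k) \<le> e * norm k"
          using C2_near_id_diff[OF \<Phi> b1, of w0 k] by (simp add: hk)
        have k2: "norm k \<le> 2 * norm h"
        proof -
          have "norm k \<le> norm h + norm (h - k)" by (metis norm_minus_commute norm_triangle_sub)
          also have "\<dots> \<le> norm h + (1/2) * norm k"
            using hk1 mult_right_mono[OF e(2) norm_ge_zero[of k]] by linarith
          finally show ?thesis by simp
        qed
        have k4: "(norm k)\<^sup>2 \<le> 4 * (norm h)\<^sup>2"
          using power_mono[OF k2, of 2] by (simp add: power_mult_distrib)
        have hk2: "norm (h - k) \<le> 2 * e * norm h"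
        proof -
          have "e * norm k \<le> e * (2 * norm h)" using k2 e(1) by (intro mult_left_mono) auto
          with hk1 show ?thesis by simp
        qed
        \<comment> \<open>Taylor with \<open>B = 0\<close> for \<open>\<Phi> r\<close>. Applying
          \<open>A\<close>, the inverse of the differential at \<open>w0\<close>, turns it into a
          second-order expansion of \<open>\<Psi>\<close> without any bound on the second derivative
          of \<open>\<Psi>\<close>.\<close>
        have tay: "norm (h - \<Phi>' r w0 k) \<le> e * (norm k)\<^sup>2"
          using C2_taylor[OF \<Phi>, of w0 k 0 e] b2 by (simp add: hk blinfun.zero_left)
        have kA: "norm (k - A h) \<le> 8 * e * (norm h)\<^sup>2"
        proof -
          have "A h - k = A (h - \<Phi>' r w0 k)" by (simp add: blinfun.diff_right A\<Phi>)
          then have "norm (A h - k) \<le> 2 * norm (h - \<Phi>' r w0 k)" using A2 by metis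
          also have "\<dots> \<le> 2 * (e * (4 * (norm h)\<^sup>2))"
            using tay mult_left_mono[OF k4, of e] e(1) by linarith
          finally show ?thesis by (simp add: norm_minus_commute)
        qed
        define z where "z = perp \<nu> h"
        define \<kappa> where "\<kappa> = perp \<nu> k"
        have n\<kappa>: "norm \<kappa> \<le> 2 * norm h" "norm z \<le> norm h"
          unfolding \<kappa>_def z_def using norm_perp_le[OF \<nu>] k2 order_trans by blast+
        have zk: "norm (z - \<kappa>) \<le> 2 * e * norm h"
        proof -
          have "z - \<kappa> = perp \<nu> (h - k)" by (simp add: z_def \<kappa>_def perp_def algebra_simps)
          then show ?thesis using norm_perp_le[OF \<nu>, of "h - k"] hk2 by simp
        qed
        have tayf: "\<bar>f (p + \<kappa>) - f p - f' p \<kappa> - f'' 0 \<kappa> \<kappa> / 2\<bar> \<le> \<epsilon> / 8 * (norm \<kappa>)\<^sup>2"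
        proof -
          have "norm (f (p + \<kappa>) - f p - f' p \<kappa> - (1/2) *\<^sub>R f'' 0 \<kappa> \<kappa>) \<le> \<epsilon> / 8 * (norm \<kappa>)\<^sup>2"
          proof (rule C2_taylor[OF f])
            fix t :: real assume t: "0 \<le> t" "t \<le> 1"
            have "norm (p + t *\<^sub>R \<kappa>) \<le> norm p + \<bar>t\<bar> * norm \<kappa>" by (metis norm_scaleR norm_triangle_ineq)
            also have "\<dots> \<le> norm p + norm \<kappa>" using t by (simp add: mult_left_le_one_le)
            also have "\<dots> < \<delta>1" using np n\<kappa>(1) h \<delta>(3) e(4) \<delta>1(1) by linarith
            finally show "norm (f'' (p + t *\<^sub>R \<kappa>) - f'' 0) \<le> \<epsilon> / 8" using \<delta>1(2) less_imp_le by blast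
          qed
          then show ?thesis by simp
        qed
        have vh: "v h = k \<bullet> \<nu> - (f (p + \<kappa>) - f p)"
        proof -
          have xh: "\<Psi> (x + h) - x = (w0 - x) + k" by (simp add: k_def)
          have "v h = (w0 - x) \<bullet> \<nu> + k \<bullet> \<nu> - f (p + \<kappa>)"
            unfolding v_def u_def xh p_def \<kappa>_def perp_add inner_add_left ..
          moreover have "0 = (w0 - x) \<bullet> \<nu> - f p" using v0 by (simp add: v_def u_def p_def w0_def)
          ultimately show ?thesis by simp
        qed
        \<comment> \<open>Four errors remain: the quadratic error of \<open>\<Psi>\<close> seen by
          \<open>\<nu>\<close> and by \<open>f' p\<close>, the change of argument from
          \<open>\<kappa>\<close> to \<open>z\<close> in the quadratic form, and the Taylor
          remainder \<open>R1\<close> of \<open>f\<close>.\<close>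
        define R1 where "R1 = f (p + \<kappa>) - f p - f' p \<kappa> - f'' 0 \<kappa> \<kappa> / 2"
        have e1: "v h - (a \<bullet> h - f'' 0 z z / 2) =
           (k - A h) \<bullet> \<nu> - f' p (perp \<nu> (k - A h)) - (f'' 0 \<kappa> \<kappa> - f'' 0 z z) / 2 - R1"
        proof -
          have pk: "perp \<nu> (k - A h) = \<kappa> - perp \<nu> (A h)" by (simp add: \<kappa>_def perp_def algebra_simps)
          show ?thesis
            unfolding vh a[symmetric] l_def R1_def pk blinfun.diff_right inner_diff_left
            by (simp add: field_simps)
        qed
        have q: "\<bar>f'' 0 \<kappa> \<kappa> - f'' 0 z z\<bar> \<le> 6 * e * M * (norm h)\<^sup>2"
        proof -
          have bil: "\<bar>f'' 0 y y'\<bar> \<le> M * norm y * norm y'" for y y'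
          proof -
            have "\<bar>f'' 0 y y'\<bar> \<le> norm (f'' 0 y) * norm y'" using norm_blinfun[of "f'' 0 y" y'] by simp
            also have "\<dots> \<le> M * norm y * norm y'" unfolding M_def by (intro mult_right_mono norm_blinfun) auto
            finally show ?thesis .
          qed
          have "f'' 0 \<kappa> \<kappa> - f'' 0 z z = - (f'' 0 (z - \<kappa>) \<kappa> + f'' 0 z (z - \<kappa>))"
            by (simp add: blinfun.diff_right blinfun.diff_left)
          then have "\<bar>f'' 0 \<kappa> \<kappa> - f'' 0 z z\<bar> \<le> \<bar>f'' 0 (z - \<kappa>) \<kappa>\<bar> + \<bar>f'' 0 z (z - \<kappa>)\<bar>" by simp
          also have "\<dots> \<le> M * norm (z - \<kappa>) * norm \<kappa> + M * norm z * norm (z - \<kappa>)" by (intro add_mono bil)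
          also have "\<dots> \<le> M * (2 * e * norm h) * (2 * norm h) + M * norm h * (2 * e * norm h)"
            using n\<kappa> zk M0 e(1) by (intro add_mono mult_mono) auto
          also have "\<dots> = 6 * e * M * (norm h)\<^sup>2" by (simp add: power2_eq_square)
          finally show ?thesis .
        qed
        have abs4: "\<bar>b1\<bar> \<le> c1 \<Longrightarrow> \<bar>b2\<bar> \<le> c2 \<Longrightarrow> \<bar>b4\<bar> \<le> c4 \<Longrightarrow> \<bar>b3\<bar> \<le> c3 \<Longrightarrow> \<bar>b1 - b2 - b3 / 2 - b4\<bar> \<le> c1 + c2 + c3 / 2 + c4"
          for b1 b2 b3 b4 c1 c2 c3 c4 :: real by arith
        have "\<bar>(k - A h) \<bullet> \<nu>\<bar> \<le> 8 * e * (norm h)\<^sup>2"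
          using Cauchy_Schwarz_ineq2[of "k - A h" \<nu>] kA \<nu> by simp
        moreover have "\<bar>f' p (perp \<nu> (k - A h))\<bar> \<le> 8 * e * (norm h)\<^sup>2"
        proof -
          have "\<bar>f' p (perp \<nu> (k - A h))\<bar> \<le> norm (f' p) * norm (perp \<nu> (k - A h))"
            using norm_blinfun[of "f' p" "perp \<nu> (k - A h)"] by simp
          also have "\<dots> \<le> 1 * norm (k - A h)" using f'p by (intro mult_mono norm_perp_le \<nu>) auto
          finally show ?thesis using kA by simp
        qed
        moreover have "\<bar>R1\<bar> \<le> \<epsilon> / 2 * (norm h)\<^sup>2"
        proof -
          have "(norm \<kappa>)\<^sup>2 \<le> 4 * (norm h)\<^sup>2" using power_mono[OF n\<kappa>(1), of 2] by (simp add: power_mult_distrib)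
          then have "\<epsilon> / 8 * (norm \<kappa>)\<^sup>2 \<le> \<epsilon> / 8 * (4 * (norm h)\<^sup>2)" using \<epsilon> by (intro mult_left_mono) auto
          with tayf show ?thesis unfolding R1_def by simp
        qed
        ultimately have "\<bar>v h - (a \<bullet> h - f'' 0 z z / 2)\<bar> \<le> 8 * e * (norm h)\<^sup>2 + 8 * e * (norm h)\<^sup>2 + (6 * e * M * (norm h)\<^sup>2) / 2 + \<epsilon> / 2 * (norm h)\<^sup>2"
          unfolding e1 using q abs4 by blast
        also have "\<dots> = (e * (16 + 3 * M) + \<epsilon> / 2) * (norm h)\<^sup>2" by (simp add: algebra_simps)
        also have "\<dots> \<le> \<epsilon> * (norm h)\<^sup>2" using eM by (intro mult_right_mono) auto
        finally show ?thesis by (simp add: z_def)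
      qed
      show ?case
      proof (intro exI[of _ a] exI[of _ v] conjI allI impI an)
        fix h :: 'a assume h: "norm h < \<delta>"
        then show "(x + h \<in> F r) = (v h \<le> 0)" using \<delta>(2) by (intro mem) linarith
        show "\<bar>v h - (a \<bullet> h - f'' 0 (perp \<nu> h) (perp \<nu> h) / 2)\<bar> \<le> \<epsilon> * (norm h)\<^sup>2" by (rule exp) fact
      qed
    qed
  qed
qed

section \<open>Kernel estimates\<close>


lemma kr_eq_max: "kr d s r t = max t r powr (-(real d + s))"
  by (auto simp: kr_def max_def)

lemma kr_measurable [measurable]: "kr d s r \<in> borel_measurable borel"
  unfolding kr_def by measurable

lemma kr_pos: "r > 0 \<Longrightarrow> kr d s r t > 0"
  by (auto simp: kr_eq_max)

lemma kr_antimono: "r > 0 \<Longrightarrow> s \<ge> 1 \<Longrightarrow> t \<le> t' \<Longrightarrow> kr d s r t' \<le> kr d s r t"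
  unfolding kr_eq_max by (intro powr_mono2') auto

text \<open>\<open>kr\<close> is a negative power of \<open>max t r\<close>, and stretching
  \<open>t\<close> by \<open>1 + \<theta>\<close> stretches this maximum by at most the same factor,
  whichever argument dominates. Hence the loss is uniform in \<open>r\<close>.\<close>

lemma kr_stretch:
  assumes r: "r > 0" and s: "s \<ge> 1" and \<theta>: "\<theta> \<ge> 0" and t: "0 \<le> t" "t' \<le> (1 + \<theta>) * t"
  shows "(1 + \<theta>) powr (-(real d + s)) * kr d s r t \<le> kr d s r t'"
proof -
  have "(1 + \<theta>) powr (-(real d + s)) * kr d s r t = ((1 + \<theta>) * max t r) powr (-(real d + s))"
    unfolding kr_eq_max using r t \<theta> by (subst powr_mult) auto
  also have "\<dots> \<le> max t' r powr (-(real d + s))"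
  proof (rule powr_mono2')
    have "r \<le> (1 + \<theta>) * r" using r \<theta> by simp
    also have "\<dots> \<le> (1 + \<theta>) * max t r" using \<theta> by (intro mult_left_mono) auto
    finally have "r \<le> (1 + \<theta>) * max t r" .
    moreover have "t' \<le> (1 + \<theta>) * max t r"
      using t(2) \<theta> by (intro order_trans[OF t(2)] mult_left_mono) auto
    ultimately show "max t' r \<le> (1 + \<theta>) * max t r" by simp
  qed (use r s in auto)
  finally show ?thesis by (simp add: kr_eq_max)
qed

text \<open>Closed form of the integral of \<open>\<rho> ^ d * kr d s r \<rho>\<close> over
  \<open>0 < \<rho> < \<delta>\<close>. The first summand is the core \<open>\<rho> \<le> r\<close>,
  where the kernel is constant; the second is the tail, where the integrand is
  \<open>\<rho> powr (- s)\<close>.\<close>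

definition radial_moment :: "nat \<Rightarrow> real \<Rightarrow> real \<Rightarrow> real \<Rightarrow> real" where
  "radial_moment d s \<delta> r = r powr (1 - s) / (real d + 1) +
     (if s = 1 then ln \<delta> - ln r else (r powr (1 - s) - \<delta> powr (1 - s)) / (s - 1))"

lemma nn_integral_radial_moment:
  assumes r: "0 < r" "r < \<delta>" and s: "s \<ge> 1" and d: "d \<ge> 2"
  shows "(\<integral>\<^sup>+\<rho>. ennreal (\<rho> ^ (d - 2)) * indicator {0..} \<rho> * (ennreal (\<rho>\<^sup>2 * kr d s r \<rho>) * indicator {..<\<delta>} \<rho>) \<partial>lborel)
    = ennreal (radial_moment d s \<delta> r)"
proof -
  define p where "p = real d + s"
  have "(\<integral>\<^sup>+\<rho>. ennreal (\<rho> ^ (d - 2)) * indicator {0..} \<rho> * (ennreal (\<rho>\<^sup>2 * kr d s r \<rho>) * indicator {..<\<delta>} \<rho>) \<partial>lborel)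
    = (\<integral>\<^sup>+\<rho>. ennreal (\<rho> ^ d * r powr (-p)) * indicator {0..r} \<rho> + ennreal (\<rho> powr (-s)) * indicator {r..\<delta>} \<rho> \<partial>lborel)"
  proof (rule nn_integral_cong_AE)
    have "AE \<rho> in lborel. \<rho> \<noteq> r \<and> \<rho> \<noteq> \<delta>"
      using AE_lborel_singleton[of r] AE_lborel_singleton[of \<delta>] by auto
    then show "AE \<rho> in lborel. ennreal (\<rho> ^ (d - 2)) * indicator {0..} \<rho> * (ennreal (\<rho>\<^sup>2 * kr d s r \<rho>) * indicator {..<\<delta>} \<rho>)
       = ennreal (\<rho> ^ d * r powr (-p)) * indicator {0..r} \<rho> + ennreal (\<rho> powr (-s)) * indicator {r..\<delta>} \<rho>"
    proof eventually_elim
      case (elim \<rho>)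
      have pw: "\<rho> ^ (d - 2) * \<rho>\<^sup>2 = \<rho> ^ d" using d by (simp only: power_add[symmetric] le_add_diff_inverse2)
      consider "\<rho> < 0" | "0 \<le> \<rho>" "\<rho> < r" | "r < \<rho>" "\<rho> < \<delta>" | "\<rho> > \<delta>" using elim r by linarith
      then show ?case
      proof cases
        case 2
        then have "ennreal (\<rho> ^ (d - 2)) * ennreal (\<rho>\<^sup>2 * kr d s r \<rho>) = ennreal (\<rho> ^ d * r powr (-p))"
          using pw by (simp add: ennreal_mult'[symmetric] mult.assoc[symmetric] kr_def p_def)
        with 2 r show ?thesis by (auto simp: indicator_def)
      next
        case 3
        have "\<rho> ^ d * \<rho> powr (-p) = \<rho> powr (-s)"
          using 3 r by (simp add: p_def powr_realpow[symmetric] powr_add[symmetric])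
        then have "ennreal (\<rho> ^ (d - 2)) * ennreal (\<rho>\<^sup>2 * kr d s r \<rho>) = ennreal (\<rho> powr (-s))"
          using pw 3 r by (simp add: ennreal_mult'[symmetric] mult.assoc[symmetric] kr_def p_def)
        with 3 r show ?thesis by (auto simp: indicator_def)
      qed (use r in \<open>auto simp: indicator_def\<close>)
    qed
  qed
  also have "\<dots> = (\<integral>\<^sup>+\<rho>. ennreal (\<rho> ^ d * r powr (-p)) * indicator {0..r} \<rho> \<partial>lborel) + (\<integral>\<^sup>+\<rho>. ennreal (\<rho> powr (-s)) * indicator {r..\<delta>} \<rho> \<partial>lborel)"
    by (rule nn_integral_add) auto
  also have "(\<integral>\<^sup>+\<rho>. ennreal (\<rho> ^ d * r powr (-p)) * indicator {0..r} \<rho> \<partial>lborel)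
    = ennreal (r ^ Suc d * r powr (-p) / real (Suc d) - 0 ^ Suc d * r powr (-p) / real (Suc d))"
  proof (rule nn_integral_FTC_Icc)
    fix x :: real
    have "((\<lambda>x. x ^ Suc d) has_real_derivative real (Suc d) * x ^ d) (at x)"
      using DERIV_pow[of "Suc d" x UNIV] by simp
    then have "((\<lambda>x. x ^ Suc d * (r powr (-p) / real (Suc d))) has_real_derivative real (Suc d) * x ^ d * (r powr (-p) / real (Suc d))) (at x)"
      by (rule DERIV_cmult_right)
    then show "((\<lambda>x. x ^ Suc d * r powr (-p) / real (Suc d)) has_real_derivative x ^ d * r powr (-p)) (at x)"
      by (simp add: field_simps del: power_Suc of_nat_Suc)
  qed (use r in auto)
  also have "r ^ Suc d * r powr (-p) / real (Suc d) - 0 ^ Suc d * r powr (-p) / real (Suc d) = r powr (1 - s) / (real d + 1)"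
  proof -
    have "r ^ Suc d * r powr (-p) = r powr (1 - s)"
      using r unfolding p_def powr_realpow[symmetric, OF r(1)] powr_add[symmetric] by simp
    then show ?thesis by (simp add: add.commute)
  qed
  also have "(\<integral>\<^sup>+\<rho>. ennreal (\<rho> powr (-s)) * indicator {r..\<delta>} \<rho> \<partial>lborel)
    = ennreal (if s = 1 then ln \<delta> - ln r else (r powr (1 - s) - \<delta> powr (1 - s)) / (s - 1))"
  proof (cases "s = 1")
    case True
    have "(\<integral>\<^sup>+\<rho>. ennreal (\<rho> powr (-s)) * indicator {r..\<delta>} \<rho> \<partial>lborel) = ennreal (ln \<delta> - ln r)"
    proof (rule nn_integral_FTC_Icc[where F=ln])
      fix x :: real assume "x \<in> {r..\<delta>}"
      then show "(ln has_real_derivative x powr (-s)) (at x)"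
        using r True by (auto intro!: derivative_eq_intros simp: powr_minus divide_inverse)
    qed (use r in auto)
    with True show ?thesis by simp
  next
    case False
    have "(\<integral>\<^sup>+\<rho>. ennreal (\<rho> powr (-s)) * indicator {r..\<delta>} \<rho> \<partial>lborel) = ennreal (\<delta> powr (1 - s) / (1 - s) - r powr (1 - s) / (1 - s))"
    proof (rule nn_integral_FTC_Icc[where F="\<lambda>x. x powr (1 - s) / (1 - s)"])
      fix x :: real assume "x \<in> {r..\<delta>}"
      then have "((\<lambda>x. x powr (1 - s)) has_real_derivative (1 - s) * x powr (1 - s - 1)) (at x)"
        using r by (intro has_real_derivative_powr) auto
      from DERIV_cdivide[OF this, of "1 - s"] False
      show "((\<lambda>x. x powr (1 - s) / (1 - s)) has_real_derivative x powr (-s)) (at x)" by simp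
    qed (use r in auto)
    also have "\<delta> powr (1 - s) / (1 - s) - r powr (1 - s) / (1 - s) = (r powr (1 - s) - \<delta> powr (1 - s)) / (s - 1)"
      by (metis diff_divide_distrib minus_diff_eq minus_divide_divide)
    finally show ?thesis using False by simp
  qed
  also have "ennreal (r powr (1 - s) / (real d + 1)) + ennreal (if s = 1 then ln \<delta> - ln r else (r powr (1 - s) - \<delta> powr (1 - s)) / (s - 1))
     = ennreal (radial_moment d s \<delta> r)"
    unfolding radial_moment_def
  proof (rule ennreal_plus[symmetric])
    have "\<delta> powr (1 - s) \<le> r powr (1 - s)" using r s by (intro powr_mono2') auto
    then show "0 \<le> (if s = 1 then ln \<delta> - ln r else (r powr (1 - s) - \<delta> powr (1 - s)) / (s - 1))"
      using r s by (auto intro: divide_nonneg_nonneg)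
  qed auto
  finally show ?thesis .
qed

section \<open>Asymptotics of the radial moment\<close>

lemma sigma_s_at_top:
  assumes s: "s \<ge> 1"
  shows "filterlim (sigma_s d s) at_top (at_right 0)"
proof (cases "s = 1")
  case True
  have "filterlim (\<lambda>r::real. - ln r) at_top (at_right 0)"
    using ln_at_0 by (simp add: filterlim_uminus_at_top)
  then show ?thesis
  proof (rule filterlim_at_top_mono)
    show "\<forall>\<^sub>F r in at_right 0. - ln r \<le> sigma_s d s r"
      by (intro always_eventually allI) (simp add: True sigma_s_def abs_ge_minus_self)
  qed
next
  case False
  then have s1: "s > 1" using s by simp
  have "filterlim (\<lambda>r::real. - ln r) at_top (at_right 0)"
    using ln_at_0 by (simp add: filterlim_uminus_at_top)
  then have "filterlim (\<lambda>r::real. (s - 1) * - ln r) at_top (at_right 0)"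
    using s1 by (intro filterlim_tendsto_pos_mult_at_top[OF tendsto_const]) auto
  then have "filterlim (\<lambda>r::real. exp ((s - 1) * - ln r)) at_top (at_right 0)"
    by (rule filterlim_compose[OF exp_at_top])
  moreover have "(s - 1) * - ln r = (1 - s) * ln r" for r :: real by (simp add: algebra_simps)
  ultimately have "filterlim (\<lambda>r::real. exp ((1 - s) * ln r)) at_top (at_right 0)" by simp
  then have "filterlim (\<lambda>r::real. r powr (1 - s)) at_top (at_right 0)"
    by (rule filterlim_mono_eventually)
       (auto simp: powr_def eventually_at_right_less eventually_at_filter)
  then have "filterlim (\<lambda>r::real. ((real d + s) / (real d + 1) / (s - 1)) * r powr (1 - s)) at_top (at_right 0)"
    using s1 by (intro filterlim_tendsto_pos_mult_at_top[OF tendsto_const]) (auto intro!: divide_pos_pos)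
  then show ?thesis using False by (simp add: sigma_s_def[abs_def] field_simps)
qed

text \<open>For \<open>s > 1\<close>,
  \<open>1 / (d + 1) + 1 / (s - 1) = (d + s) / ((d + 1) * (s - 1))\<close>. The difference to
  \<open>sigma_s\<close> does not depend on \<open>r\<close> and is negligible since
  \<open>sigma_s\<close> tends to infinity.\<close>

lemma radial_moment_sigma:
  assumes s: "s \<ge> 1" and r: "0 < r" "r < 1"
  shows "radial_moment d s \<delta> r = sigma_s d s r + (if s = 1 then 1 / (real d + 1) + ln \<delta> else - (\<delta> powr (1 - s) / (s - 1)))"
proof (cases "s = 1")
  case True
  then show ?thesis using r by (simp add: radial_moment_def sigma_s_def)
next
  case False
  then have "s - 1 \<noteq> 0" "real d + 1 \<noteq> 0" by auto
  then have "r powr (1 - s) / (real d + 1) + r powr (1 - s) / (s - 1) = (real d + s) / (real d + 1) * r powr (1 - s) / (s - 1)"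
    by (simp add: divide_simps) (simp add: algebra_simps)
  then show ?thesis using False by (simp add: radial_moment_def sigma_s_def diff_divide_distrib)
qed

lemma radial_moment_ratio:
  assumes s: "s \<ge> 1"
  shows "((\<lambda>r. radial_moment d s \<delta> r / sigma_s d s r) \<longlongrightarrow> 1) (at_right 0)"
proof -
  define c where "c = (if s = 1 then 1 / (real d + 1) + ln \<delta> else - (\<delta> powr (1 - s) / (s - 1)))"
  have "((\<lambda>r. 1 + c / sigma_s d s r) \<longlongrightarrow> 1 + 0) (at_right 0)"
    by (intro tendsto_add tendsto_const tendsto_divide_0[OF tendsto_const] filterlim_at_top_imp_at_infinity sigma_s_at_top s)
  moreover have "\<forall>\<^sub>F r in at_right 0. 1 + c / sigma_s d s r = radial_moment d s \<delta> r / sigma_s d s r"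
  proof -
    have "\<forall>\<^sub>F r in at_right (0::real). r < 1" by (auto simp: eventually_at_right_field intro: exI[of _ 1])
    moreover have "\<forall>\<^sub>F r in at_right 0. sigma_s d s r > 0"
      using sigma_s_at_top[OF s, of d] by (simp add: filterlim_at_top_dense)
    ultimately show ?thesis using eventually_at_right_less[of "0::real"]
    proof eventually_elim
      case (elim r)
      then show ?case using radial_moment_sigma[OF s elim(3,1), of d \<delta>] by (simp add: c_def[symmetric] field_simps)
    qed
  qed
  ultimately show ?thesis by (simp add: tendsto_cong)
qed

text \<open>For \<open>r < \<delta>\<close> the kernel at distance at least \<open>\<delta>\<close>
  does not depend on \<open>r\<close> and decays like an integrable power. The far part thus stays
  bounded and disappears after division by \<open>sigma_s\<close>.\<close>

lemma nn_integral_far_kernel: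
  fixes g :: "'a::euclidean_space \<Rightarrow> real"
  assumes [measurable]: "g \<in> borel_measurable borel" and g: "\<And>\<omega>. 0 \<le> g \<omega>" "\<And>\<omega>. g \<omega> \<le> Bg"
    and s: "s \<ge> 1" and \<delta>: "\<delta> > 0"
  shows "\<exists>C\<ge>0. \<forall>r. 0 < r \<longrightarrow> r < \<delta> \<longrightarrow>
     (\<integral>\<^sup>+h. ennreal (g (sgn h) * kr DIM('a) s r (norm h)) * indicator {h. \<delta> \<le> norm h} h \<partial>lborel) \<le> ennreal C"
proof -
  let ?d = "DIM('a)"
  define I where "I = (\<integral>\<^sup>+h. ennreal (norm h powr (-(real ?d + s))) * indicator {h::'a. \<delta> \<le> norm h} h \<partial>lborel)"
  have Bg: "Bg \<ge> 0" using g order_trans by blast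
  have "I = (\<integral>\<^sup>+h. ennreal (norm h powr (-(real ?d + s))) * indicator {\<delta>..} (norm (h::'a)) \<partial>lborel)"
    unfolding I_def by (rule nn_integral_cong) (auto simp: indicator_def)
  also have "\<dots> = (\<integral>\<^sup>+\<rho>. ennreal (unit_ball_vol (real ?d)) * (ennreal (real ?d * \<rho> ^ (?d - 1)) * indicator {0..} \<rho>) *
       (ennreal (\<rho> powr (-(real ?d + s))) * indicator {\<delta>..} \<rho>) \<partial>lborel)"
  proof (rule nn_integral_radial)
    fix c :: real assume c: "c > 0"
    have "{x \<in> space lborel. norm x \<le> c} = cball (0::'a) c" by (auto simp: dist_norm)
    then show "emeasure lborel {x \<in> space (lborel :: 'a measure). norm x \<le> c} = ennreal (unit_ball_vol (real ?d) * c ^ ?d)"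
      using c by (simp add: emeasure_cball)
  qed auto
  also have "\<dots> = (\<integral>\<^sup>+\<rho>. ennreal (unit_ball_vol (real ?d) * real ?d) * (ennreal (\<rho> powr (-1 - s)) * indicator {\<delta>..} \<rho>) \<partial>lborel)"
  proof (rule nn_integral_cong)
    fix \<rho> :: real
    show "ennreal (unit_ball_vol (real ?d)) * (ennreal (real ?d * \<rho> ^ (?d - 1)) * indicator {0..} \<rho>) *
       (ennreal (\<rho> powr (-(real ?d + s))) * indicator {\<delta>..} \<rho>) = ennreal (unit_ball_vol (real ?d) * real ?d) * (ennreal (\<rho> powr (-1 - s)) * indicator {\<delta>..} \<rho>)"
    proof (cases "\<delta> \<le> \<rho>")
      case True
      then have \<rho>: "\<rho> > 0" using \<delta> by simp
      have "\<rho> ^ (?d - 1) * \<rho> powr (-(real ?d + s)) = \<rho> powr (-1 - s)"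
        unfolding powr_realpow[OF \<rho>, symmetric] powr_add[symmetric] by (simp add: of_nat_diff Suc_leI)
      then have "unit_ball_vol (real ?d) * (real ?d * \<rho> ^ (?d - 1)) * \<rho> powr (-(real ?d + s)) = unit_ball_vol (real ?d) * real ?d * \<rho> powr (-1 - s)"
        by (simp add: mult.assoc)
      with True \<rho> show ?thesis by (simp add: ennreal_mult'[symmetric] mult.assoc)
    qed simp
  qed
  also have "\<dots> = ennreal (unit_ball_vol (real ?d) * real ?d) * (\<integral>\<^sup>+\<rho>. ennreal (\<rho> powr (-1 - s)) * indicator {\<delta>..} \<rho> \<partial>lborel)"
    by (rule nn_integral_cmult) measurable
  also have "(\<integral>\<^sup>+\<rho>. ennreal (\<rho> powr (-1 - s)) * indicator {\<delta>..} \<rho> \<partial>lborel) = ennreal (0 - (- (\<delta> powr (-s) / s)))"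
  proof (rule nn_integral_FTC_atLeast)
    fix x assume "\<delta> \<le> x"
    then show "((\<lambda>x. - (x powr (-s) / s)) has_real_derivative x powr (-1 - s)) (at x)"
      using \<delta> s by (auto intro!: derivative_eq_intros simp: powr_diff powr_minus field_simps)
  next
    have "((\<lambda>x::real. x powr (-s)) \<longlongrightarrow> 0) at_top"
      using s by (intro tendsto_neg_powr filterlim_ident) auto
    from tendsto_divide[OF this tendsto_const, of s] s
    show "((\<lambda>x. - (x powr (-s) / s)) \<longlongrightarrow> 0) at_top" by (simp add: tendsto_minus_cancel_left[symmetric])
  qed auto
  finally have I: "I = ennreal (unit_ball_vol (real ?d) * real ?d * (\<delta> powr (-s) / s))"
    by (simp add: ennreal_mult'[symmetric])
  show ?thesis
  proof (intro exI[of _ "Bg * (unit_ball_vol (real ?d) * real ?d * (\<delta> powr (-s) / s))"] conjI allI impI)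
    show "0 \<le> Bg * (unit_ball_vol (real ?d) * real ?d * (\<delta> powr (-s) / s))" using Bg s by simp
    fix r :: real assume r: "0 < r" "r < \<delta>"
    have "(\<integral>\<^sup>+h. ennreal (g (sgn h) * kr ?d s r (norm h)) * indicator {h. \<delta> \<le> norm h} h \<partial>lborel)
      \<le> (\<integral>\<^sup>+h. ennreal Bg * (ennreal (norm h powr (-(real ?d + s))) * indicator {h::'a. \<delta> \<le> norm h} h) \<partial>lborel)"
    proof (rule nn_integral_mono)
      fix h :: 'a
      show "ennreal (g (sgn h) * kr ?d s r (norm h)) * indicator {h. \<delta> \<le> norm h} h \<le>
         ennreal Bg * (ennreal (norm h powr (-(real ?d + s))) * indicator {h::'a. \<delta> \<le> norm h} h)"
      proof (cases "\<delta> \<le> norm h")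
        case True
        then have "kr ?d s r (norm h) = norm h powr (-(real ?d + s))" using r by (simp add: kr_def)
        then show ?thesis using True g Bg by (auto simp: ennreal_mult'[symmetric] intro!: ennreal_leI mult_right_mono)
      qed simp
    qed
    also have "\<dots> = ennreal Bg * I" unfolding I_def by (rule nn_integral_cmult) measurable
    finally show "(\<integral>\<^sup>+h. ennreal (g (sgn h) * kr ?d s r (norm h)) * indicator {h. \<delta> \<le> norm h} h \<partial>lborel)
      \<le> ennreal (Bg * (unit_ball_vol (real ?d) * real ?d * (\<delta> powr (-s) / s)))"
      unfolding I ennreal_mult'[OF Bg, symmetric] .
  qed
qed

lemma integrable_kernel:
  fixes g :: "'a::euclidean_space \<Rightarrow> real"
  assumes [measurable]: "g \<in> borel_measurable borel" and g: "\<And>\<omega>. 0 \<le> g \<omega>" "\<And>\<omega>. g \<omega> \<le> Bg"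
    and s: "s \<ge> 1" and r: "r > 0"
  shows "integrable lborel (\<lambda>h. g (sgn h) * kr DIM('a) s r (norm h))"
proof (rule integrableI_nonneg)
  let ?k = "\<lambda>h. g (sgn h) * kr DIM('a) s r (norm h)"
  have Bg: "Bg \<ge> 0" using g order_trans by blast
  obtain C where C: "(\<integral>\<^sup>+h. ennreal (?k h) * indicator {h. 2 * r \<le> norm h} h \<partial>lborel) \<le> ennreal C"
    using nn_integral_far_kernel[OF assms(1) g s, of "2 * r"] r by fastforce
  have "(\<integral>\<^sup>+h. ennreal (?k h) \<partial>lborel) \<le> (\<integral>\<^sup>+h. ennreal (Bg * r powr (-(real DIM('a) + s))) * indicator (cball 0 (2 * r)) h + ennreal (?k h) * indicator {h. 2 * r \<le> norm h} h \<partial>lborel)"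
  proof (rule nn_integral_mono)
    fix h :: 'a
    show "ennreal (?k h) \<le> ennreal (Bg * r powr (-(real DIM('a) + s))) * indicator (cball 0 (2 * r)) h + ennreal (?k h) * indicator {h. 2 * r \<le> norm h} h"
    proof (cases "2 * r \<le> norm h")
      case False
      have "max (norm h) r powr (-(real DIM('a) + s)) \<le> r powr (-(real DIM('a) + s))"
        using r s by (intro powr_mono2') auto
      then have "?k h \<le> Bg * r powr (-(real DIM('a) + s))"
        using g Bg by (intro mult_mono) (auto simp: kr_eq_max)
      then show ?thesis using False by (auto simp: indicator_def intro: ennreal_leI)
    qed auto
  qed
  also have "\<dots> = (\<integral>\<^sup>+h. ennreal (Bg * r powr (-(real DIM('a) + s))) * indicator (cball 0 (2 * r)) h \<partial>(lborel :: 'a measure)) + (\<integral>\<^sup>+h. ennreal (?k h) * indicator {h. 2 * r \<le> norm h} h \<partial>lborel)"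
  proof (rule nn_integral_add)
    have [measurable]: "(\<lambda>h. ennreal (?k h)) \<in> borel_measurable lborel" by measurable
    have [measurable]: "{h::'a. 2 * r \<le> norm h} \<in> sets borel" by measurable
    show "(\<lambda>h. ennreal (?k h) * indicator {h. 2 * r \<le> norm h} h) \<in> borel_measurable lborel"
      by (intro borel_measurable_times_ennreal borel_measurable_indicator) measurable
    show "(\<lambda>h. ennreal (Bg * r powr (-(real DIM('a) + s))) * indicator (cball (0::'a) (2 * r)) h) \<in> borel_measurable lborel"
      by (intro borel_measurable_times_ennreal borel_measurable_indicator borel_measurable_const) auto
  qed
  also have "\<dots> \<le> ennreal (Bg * r powr (-(real DIM('a) + s))) * emeasure lborel (cball (0::'a) (2 * r)) + ennreal C"
    using C by (subst nn_integral_cmult_indicator) (auto intro: add_left_mono)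
  also have "\<dots> < \<infinity>"
    using r by (subst emeasure_cball) (auto simp: ennreal_mult_less_top)
  finally show "(\<integral>\<^sup>+h. ennreal (?k h) \<partial>lborel) < \<infinity>" .
  show "AE h in lborel. 0 \<le> ?k h"
    using g kr_pos[OF r] by (intro AE_I2 mult_nonneg_nonneg) (auto intro: less_imp_le)
qed measurable

text \<open>The kernel is frozen at \<open>perp \<nu> h\<close>, so along \<open>\<nu>\<close> only
  the length \<open>2 * v z / (a \<bullet> \<nu>)\<close> of the wedge counts. Homogeneity of
  \<open>v\<close> separates direction and radius for polar coordinates. That \<open>g\<close>
  vanishes off the unit sphere keeps the angular factor bounded everywhere.\<close>

lemma nn_integral_wedge:
  fixes g v :: "'a::euclidean_space \<Rightarrow> real"
  assumes [measurable]: "g \<in> borel_measurable borel" "v \<in> borel_measurable borel"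
    and g: "\<And>\<omega>. 0 \<le> g \<omega>" "\<And>\<omega>. g \<omega> \<le> Bg" "\<And>\<omega>. norm \<omega> \<noteq> 1 \<Longrightarrow> g \<omega> = 0"
    and v: "\<And>z. 0 \<le> v z" "\<And>z. v z = (norm z)\<^sup>2 * v (sgn z)" "\<And>\<omega>. norm \<omega> = 1 \<Longrightarrow> v \<omega> \<le> M"
    and \<nu>: "norm \<nu> = 1" and d: "DIM('a) \<ge> 2" and s: "s \<ge> 1" and r: "0 < r" "r < \<delta>" and a: "a \<bullet> \<nu> > 0"
  shows "(\<integral>\<^sup>+h. ennreal (g (sgn (perp \<nu> h)) * kr DIM('a) s r (norm (perp \<nu> h))) *
       (if norm (perp \<nu> h) < \<delta> \<and> \<bar>a \<bullet> h\<bar> < v (perp \<nu> h) then 1 else 0) \<partial>lborel) =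
     ennreal (2 / (a \<bullet> \<nu>) * radial_moment DIM('a) s \<delta> r) * (\<integral>\<^sup>+\<omega>. ennreal (v \<omega> * g \<omega>) \<partial>cone_measure \<nu>)"
proof -
  let ?d = "DIM('a)"
  have pp: "perp \<nu> (perp \<nu> h + t *\<^sub>R \<nu>) = perp \<nu> h" for h t
    using \<nu> by (simp add: perp_add perp_scaleR perp_self perp_id perp_inner)
  have krp: "kr ?d s r t > 0" for t using r by (intro kr_pos) auto
  have "(\<integral>\<^sup>+h. ennreal (g (sgn (perp \<nu> h)) * kr ?d s r (norm (perp \<nu> h))) *
       (if norm (perp \<nu> h) < \<delta> \<and> \<bar>a \<bullet> h\<bar> < v (perp \<nu> h) then 1 else 0) \<partial>lborel) =
    (\<integral>\<^sup>+h. indicator (slab \<nu>) h * (\<integral>\<^sup>+t. ennreal (g (sgn (perp \<nu> h)) * kr ?d s r (norm (perp \<nu> h))) *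
       (if norm (perp \<nu> h) < \<delta> \<and> \<bar>a \<bullet> (perp \<nu> h + t *\<^sub>R \<nu>)\<bar> < v (perp \<nu> h) then 1 else 0) \<partial>lborel) \<partial>lborel)"
    by (subst nn_integral_slice[OF _ \<nu>]) (auto simp: pp)
  also have "\<dots> = (\<integral>\<^sup>+h. ennreal (2 / (a \<bullet> \<nu>)) * (indicator (slab \<nu>) h * (ennreal (v (sgn (perp \<nu> h)) * g (sgn (perp \<nu> h))) *
       (ennreal ((norm (perp \<nu> h))\<^sup>2 * kr ?d s r (norm (perp \<nu> h))) * indicator {..<\<delta>} (norm (perp \<nu> h))))) \<partial>lborel)"
  proof (rule nn_integral_cong)
    fix h :: 'a
    define z where "z = perp \<nu> h"
    define kz where "kz = g (sgn z) * kr ?d s r (norm z)"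
    have kz: "kz \<ge> 0" unfolding kz_def using g krp by (intro mult_nonneg_nonneg) (auto intro: less_imp_le)
    have "(\<integral>\<^sup>+t. ennreal kz * (if norm z < \<delta> \<and> \<bar>a \<bullet> (z + t *\<^sub>R \<nu>)\<bar> < v z then 1 else 0) \<partial>lborel) =
       (\<integral>\<^sup>+t. (ennreal kz * indicator {..<\<delta>} (norm z)) * indicator {(- v z - a \<bullet> z) / (a \<bullet> \<nu>) <..< (v z - a \<bullet> z) / (a \<bullet> \<nu>)} t \<partial>lborel)"
    proof (rule nn_integral_cong)
      fix t :: real
      have "\<bar>a \<bullet> (z + t *\<^sub>R \<nu>)\<bar> < v z \<longleftrightarrow> t \<in> {(- v z - a \<bullet> z) / (a \<bullet> \<nu>) <..< (v z - a \<bullet> z) / (a \<bullet> \<nu>)}"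
        using a by (auto simp: inner_add_right pos_divide_less_eq pos_less_divide_eq abs_less_iff)
      then show "ennreal kz * (if norm z < \<delta> \<and> \<bar>a \<bullet> (z + t *\<^sub>R \<nu>)\<bar> < v z then 1 else 0) =
        (ennreal kz * indicator {..<\<delta>} (norm z)) * indicator {(- v z - a \<bullet> z) / (a \<bullet> \<nu>) <..< (v z - a \<bullet> z) / (a \<bullet> \<nu>)} t"
        by (simp add: indicator_def)
    qed
    also have "\<dots> = (ennreal kz * indicator {..<\<delta>} (norm z)) * emeasure lborel {(- v z - a \<bullet> z) / (a \<bullet> \<nu>) <..< (v z - a \<bullet> z) / (a \<bullet> \<nu>)}"
      by (rule nn_integral_cmult_indicator) simp
    also have "emeasure lborel {(- v z - a \<bullet> z) / (a \<bullet> \<nu>) <..< (v z - a \<bullet> z) / (a \<bullet> \<nu>)} = ennreal (2 / (a \<bullet> \<nu>) * v z)"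
    proof -
      have "(- v z - a \<bullet> z) / (a \<bullet> \<nu>) \<le> (v z - a \<bullet> z) / (a \<bullet> \<nu>)" using a v(1)[of z] by (intro divide_right_mono) auto
      moreover have "(v z - a \<bullet> z) / (a \<bullet> \<nu>) - (- v z - a \<bullet> z) / (a \<bullet> \<nu>) = 2 / (a \<bullet> \<nu>) * v z"
        by (simp add: diff_divide_distrib[symmetric])
      ultimately show ?thesis by simp
    qed
    also have "(ennreal kz * indicator {..<\<delta>} (norm z)) * ennreal (2 / (a \<bullet> \<nu>) * v z) =
      ennreal (2 / (a \<bullet> \<nu>)) * (ennreal (v (sgn z) * g (sgn z)) * (ennreal ((norm z)\<^sup>2 * kr ?d s r (norm z)) * indicator {..<\<delta>} (norm z)))"
    proof -
      have "kz * (2 / (a \<bullet> \<nu>) * v z) = 2 / (a \<bullet> \<nu>) * ((v (sgn z) * g (sgn z)) * ((norm z)\<^sup>2 * kr ?d s r (norm z)))"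
        unfolding kz_def using v(2)[of z] by simp
      note eq = this
      have "ennreal kz * ennreal (2 / (a \<bullet> \<nu>) * v z) =
         ennreal (2 / (a \<bullet> \<nu>)) * (ennreal (v (sgn z) * g (sgn z)) * ennreal ((norm z)\<^sup>2 * kr ?d s r (norm z)))"
      proof -
        have B0: "0 \<le> v (sgn z) * g (sgn z)" using v(1) g(1) by simp
        have A0: "0 \<le> 2 / (a \<bullet> \<nu>)" using a by simp
        show ?thesis
          unfolding ennreal_mult'[OF kz, symmetric] ennreal_mult'[OF B0, symmetric] ennreal_mult'[OF A0, symmetric] eq ..
      qed
      then show ?thesis by (simp add: indicator_def)
    qed
    finally show "indicator (slab \<nu>) h * (\<integral>\<^sup>+t. ennreal (g (sgn (perp \<nu> h)) * kr ?d s r (norm (perp \<nu> h))) *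
       (if norm (perp \<nu> h) < \<delta> \<and> \<bar>a \<bullet> (perp \<nu> h + t *\<^sub>R \<nu>)\<bar> < v (perp \<nu> h) then 1 else 0) \<partial>lborel) =
      ennreal (2 / (a \<bullet> \<nu>)) * (indicator (slab \<nu>) h * (ennreal (v (sgn (perp \<nu> h)) * g (sgn (perp \<nu> h))) *
       (ennreal ((norm (perp \<nu> h))\<^sup>2 * kr ?d s r (norm (perp \<nu> h))) * indicator {..<\<delta>} (norm (perp \<nu> h)))))"
      by (simp add: z_def kz_def mult.left_commute)
  qed
  also have "\<dots> = ennreal (2 / (a \<bullet> \<nu>)) * (\<integral>\<^sup>+h. (indicator (slab \<nu>) h * (ennreal (v (sgn (perp \<nu> h)) * g (sgn (perp \<nu> h))) *
       (ennreal ((norm (perp \<nu> h))\<^sup>2 * kr ?d s r (norm (perp \<nu> h))) * indicator {..<\<delta>} (norm (perp \<nu> h))))) \<partial>lborel)"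
    by (rule nn_integral_cmult) measurable
  also have "(\<integral>\<^sup>+h. (indicator (slab \<nu>) h * (ennreal (v (sgn (perp \<nu> h)) * g (sgn (perp \<nu> h))) *
       (ennreal ((norm (perp \<nu> h))\<^sup>2 * kr ?d s r (norm (perp \<nu> h))) * indicator {..<\<delta>} (norm (perp \<nu> h))))) \<partial>lborel) =
     (\<integral>\<^sup>+\<omega>. ennreal (v \<omega> * g \<omega>) \<partial>cone_measure \<nu>) *
     (\<integral>\<^sup>+\<rho>. ennreal (\<rho> ^ (?d - 2)) * indicator {0..} \<rho> * (ennreal (\<rho>\<^sup>2 * kr ?d s r \<rho>) * indicator {..<\<delta>} \<rho>) \<partial>lborel)"
  proof (rule nn_integral_polar[where \<psi>="\<lambda>\<omega>. ennreal (v \<omega> * g \<omega>)" and \<kappa>="\<lambda>\<rho>. ennreal (\<rho>\<^sup>2 * kr ?d s r \<rho>) * indicator {..<\<delta>} \<rho>" and B="max 0 (M * Bg)"])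
    fix \<omega>
    show "ennreal (v \<omega> * g \<omega>) \<le> ennreal (max 0 (M * Bg))"
    proof (cases "norm \<omega> = 1")
      case True
      then have "v \<omega> * g \<omega> \<le> M * Bg" using v(1)[of \<omega>] v(3)[of \<omega>] g(1,2) by (intro mult_mono) (auto intro: order_trans)
      then show ?thesis by (intro ennreal_leI) auto
    qed (use g(3) in auto)
  qed (use \<nu> d in auto)
  also have "(\<integral>\<^sup>+\<rho>. ennreal (\<rho> ^ (?d - 2)) * indicator {0..} \<rho> * (ennreal (\<rho>\<^sup>2 * kr ?d s r \<rho>) * indicator {..<\<delta>} \<rho>) \<partial>lborel) = ennreal (radial_moment ?d s \<delta> r)"
    by (rule nn_integral_radial_moment) (use r s d in auto)
  finally show ?thesis
    using a by (subst ennreal_mult') (auto simp: mult_ac)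
qed

text \<open>Near the hyperplane \<open>h\<close> and \<open>perp \<nu> h\<close> have nearly the
  same direction and length. The positive lower bound \<open>gm\<close> turns uniform continuity of
  \<open>g\<close> into a relative error, and the power law does this for the radial factor
  uniformly in \<open>r\<close>.\<close>

lemma kernel_near_hyperplane:
  fixes g :: "'a::euclidean_space \<Rightarrow> real"
  assumes g: "continuous_on (sphere 0 1) g" "\<And>\<omega>. norm \<omega> = 1 \<Longrightarrow> gm \<le> g \<omega>" "gm > 0"
    and \<nu>: "norm \<nu> = 1" and s: "s \<ge> 1" and e: "0 < e" "e \<le> 1"
  shows "\<exists>\<theta>>0. \<theta> < 1 \<and> (\<forall>r h. 0 < r \<longrightarrow> perp \<nu> h \<noteq> 0 \<longrightarrow> \<bar>h \<bullet> \<nu>\<bar> \<le> \<theta> * norm (perp \<nu> h) \<longrightarrow>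
     (1 - e) * (g (sgn (perp \<nu> h)) * kr DIM('a) s r (norm (perp \<nu> h))) \<le> g (sgn h) * kr DIM('a) s r (norm h) \<and>
     g (sgn h) * kr DIM('a) s r (norm h) \<le> (1 + e) * (g (sgn (perp \<nu> h)) * kr DIM('a) s r (norm (perp \<nu> h))))"
proof -
  let ?p = "real DIM('a) + s"
  have "uniformly_continuous_on (sphere 0 1) g"
    by (rule compact_uniformly_continuous) (use g in auto)
  then obtain \<theta>1 where \<theta>1: "\<theta>1 > 0" "\<And>\<omega> \<omega>'. norm \<omega> = 1 \<Longrightarrow> norm \<omega>' = 1 \<Longrightarrow> dist \<omega>' \<omega> < \<theta>1 \<Longrightarrow> dist (g \<omega>') (g \<omega>) < e / 2 * gm"
    unfolding uniformly_continuous_on_def using e g(3)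
    by (auto dest!: spec[of _ "e / 2 * gm"])
  have "((\<lambda>\<theta>::real. (1 + \<theta>) powr (-?p)) \<longlongrightarrow> (1 + 0) powr (-?p)) (at_right 0)"
    by (intro tendsto_intros) auto
  then have "\<forall>\<^sub>F \<theta> in at_right (0::real). 1 - e / 2 < (1 + \<theta>) powr (-?p)"
    by (rule order_tendstoD) (use e in auto)
  then obtain b where b: "b > 0" "\<And>\<theta>. 0 < \<theta> \<Longrightarrow> \<theta> < b \<Longrightarrow> 1 - e / 2 < (1 + \<theta>) powr (-?p)"
    unfolding eventually_at_right_field by auto
  define \<theta> where "\<theta> = min (min (1/2) (b / 2)) (\<theta>1 / 4)"
  have \<theta>: "\<theta> > 0" "\<theta> < 1" "\<theta> < b" "2 * \<theta> < \<theta>1" using b(1) \<theta>1(1) by (auto simp: \<theta>_def)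
  show ?thesis
  proof (intro exI[of _ \<theta>] conjI \<theta>(1,2) allI impI)
    fix r :: real and h :: 'a
    assume r: "0 < r" and z0: "perp \<nu> h \<noteq> 0" and t: "\<bar>h \<bullet> \<nu>\<bar> \<le> \<theta> * norm (perp \<nu> h)"
    define z where "z = perp \<nu> h"
    define k where "k = kr DIM('a) s r"
    have z: "norm z > 0" using z0 by (simp add: z_def)
    have zh: "norm z \<le> norm h" unfolding z_def by (rule norm_perp_le) fact
    have hz: "h - z = (h \<bullet> \<nu>) *\<^sub>R \<nu>" by (simp add: z_def perp_def)
    then have nhz: "norm (h - z) \<le> \<theta> * norm z" using t \<nu> by (simp add: z_def)
    have hz1: "norm h \<le> (1 + \<theta>) * norm z"
      using norm_triangle_sub[of h z] nhz by (simp add: algebra_simps)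
    have h0: "h \<noteq> 0" using z zh by auto
    have dg: "dist (sgn h) (sgn z) < \<theta>1"
    proof -
      \<comment> \<open>The change of direction is the displacement plus the renormalization of
        length; each contributes at most \<open>\<theta>\<close>.\<close>
      have "sgn h - sgn z = (1 / norm z) *\<^sub>R (h - z) - ((norm h - norm z) / norm z) *\<^sub>R sgn h"
        using z h0 by (simp add: sgn_div_norm algebra_simps diff_divide_distrib) (simp add: divide_inverse mult.commute)
      then have "norm (sgn h - sgn z) \<le> norm ((1 / norm z) *\<^sub>R (h - z)) + norm (((norm h - norm z) / norm z) *\<^sub>R sgn h)"
        by (metis norm_triangle_ineq4)
      also have "\<dots> = norm (h - z) / norm z + (norm h - norm z) / norm z"
        using h0 zh by (simp add: norm_sgn)
      also have "\<dots> \<le> \<theta> + \<theta>"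
        using nhz hz1 z by (intro add_mono) (auto simp: pos_divide_le_eq algebra_simps)
      finally show ?thesis using \<theta>(4) by (simp add: dist_norm)
    qed
    have ns: "norm (sgn h) = 1" "norm (sgn z) = 1" using h0 z by (auto simp: norm_sgn)
    have "dist (g (sgn h)) (g (sgn z)) < e / 2 * gm" using \<theta>1(2)[OF ns(2,1) dg] .
    then have gg: "\<bar>g (sgn h) - g (sgn z)\<bar> < e / 2 * gm" by (simp add: dist_real_def)
    have gz: "gm \<le> g (sgn z)" using g(2) ns by blast
    then have "e / 2 * gm \<le> e / 2 * g (sgn z)" using e by (intro mult_left_mono) auto
    then have "\<bar>g (sgn h) - g (sgn z)\<bar> \<le> e / 2 * g (sgn z)" using gg by linarith
    then have g1: "(1 - e / 2) * g (sgn z) \<le> g (sgn h)" "g (sgn h) \<le> (1 + e / 2) * g (sgn z)"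
      unfolding abs_le_iff left_diff_distrib distrib_right by linarith+
    have kp: "k t > 0" for t unfolding k_def using r by (rule kr_pos)
    have k1: "k (norm h) \<le> k (norm z)" unfolding k_def using r s zh by (rule kr_antimono)
    have "(1 + \<theta>) powr (-?p) * k (norm z) \<le> k (norm h)"
      unfolding k_def by (rule kr_stretch) (use r s \<theta> hz1 in auto)
    moreover have "(1 - e / 2) * k (norm z) \<le> (1 + \<theta>) powr (-?p) * k (norm z)"
      using b(2)[OF \<theta>(1,3)] kp by (intro mult_right_mono) (auto intro: less_imp_le)
    ultimately have k2: "(1 - e / 2) * k (norm z) \<le> k (norm h)" by linarith
    have gz0: "g (sgn z) > 0" using gz g(3) by linarith
    have "(1 - e) * (g (sgn z) * k (norm z)) \<le> (1 - e / 2) * (1 - e / 2) * (g (sgn z) * k (norm z))"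
      using gz0 kp[of "norm z"] e by (intro mult_right_mono) (auto simp: algebra_simps)
    also have "\<dots> = ((1 - e / 2) * g (sgn z)) * ((1 - e / 2) * k (norm z))" by simp
    also have "\<dots> \<le> g (sgn h) * k (norm h)"
      using g1(1) k2 gz0 kp[of "norm z"] e g(2)[OF ns(1)] g(3) by (intro mult_mono) (auto intro: less_imp_le)
    finally show "(1 - e) * (g (sgn (perp \<nu> h)) * kr DIM('a) s r (norm (perp \<nu> h))) \<le> g (sgn h) * kr DIM('a) s r (norm h)"
      by (simp add: z_def k_def)
    have "g (sgn h) * k (norm h) \<le> ((1 + e / 2) * g (sgn z)) * k (norm z)"
      using g1(2) k1 kp gz0 e by (intro mult_mono) (auto intro: less_imp_le)
    also have "\<dots> \<le> ((1 + e) * g (sgn z)) * k (norm z)"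
      using gz0 kp[of "norm z"] e by (intro mult_right_mono) (auto intro: less_imp_le)
    finally show "g (sgn h) * kr DIM('a) s r (norm h) \<le> (1 + e) * (g (sgn (perp \<nu> h)) * kr DIM('a) s r (norm (perp \<nu> h)))"
      by (simp add: z_def k_def mult.assoc)
  qed
qed


text \<open>Up to ties this is the average of the signs of \<open>L + v\<close> and
  \<open>- L + v\<close>: the even part of a sign whose linear part \<open>L\<close> changes sign
  under reflection while \<open>v\<close> does not.\<close>

definition wedge_sign :: "real \<Rightarrow> real \<Rightarrow> real" where
  "wedge_sign L v = (if \<bar>L\<bar> < v then 1 else 0) - (if \<bar>L\<bar> < - v then 1 else 0)"

text \<open>For \<open>t = h \<bullet> \<nu>\<close>, \<open>a \<bullet> h\<close> is
  \<open>t\<close> plus an error of at most \<open>\<bar>t\<bar> / 2\<close> and one of at most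
  \<open>\<eta> * norm (perp \<nu> h)\<close>. Absorbing the half gives the factor 2. So the wedge
  hugs the hyperplane, where the kernel may be frozen.\<close>

lemma wedge_height_bound:
  fixes \<nu> a h :: "'a::euclidean_space"
  assumes \<nu>: "norm \<nu> = 1" and a: "norm (a - \<nu>) \<le> \<eta>" "\<eta> \<le> 1/2" and z: "norm (perp \<nu> h) < \<delta>" and M: "M \<ge> 0"
    and L: "\<bar>a \<bullet> h\<bar> < M * (norm (perp \<nu> h))\<^sup>2"
  shows "\<bar>h \<bullet> \<nu>\<bar> \<le> 2 * (\<eta> + M * \<delta>) * norm (perp \<nu> h)"
proof -
  define z where "z = perp \<nu> h"
  define t where "t = h \<bullet> \<nu>"
  have h: "h = z + t *\<^sub>R \<nu>" by (simp add: z_def t_def perp_def)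
  have zn: "z \<bullet> \<nu> = 0" unfolding z_def by (rule perp_inner) fact
  have nn: "\<nu> \<bullet> \<nu> = 1" using \<nu> by (simp add: dot_square_norm)
  have arith: "\<bar>t\<bar> \<le> \<bar>t\<bar> / 2 + A + B"
    if "x = t + u + w" "\<bar>u\<bar> \<le> A" "\<bar>w\<bar> \<le> \<bar>t\<bar> * (1/2)" "m \<le> B" "\<bar>x\<bar> < m" for x u w m A B :: real
    using that by arith
  have "a \<bullet> h = t + (a - \<nu>) \<bullet> z + t * ((a - \<nu>) \<bullet> \<nu>)"
    using zn nn by (simp add: h inner_add_right inner_diff_left inner_commute algebra_simps)
  moreover have "\<bar>(a - \<nu>) \<bullet> z\<bar> \<le> \<eta> * norm z"
    using Cauchy_Schwarz_ineq2[of "a - \<nu>" z] mult_right_mono[OF a(1) norm_ge_zero[of z]] by linarith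
  moreover have "\<bar>t * ((a - \<nu>) \<bullet> \<nu>)\<bar> \<le> \<bar>t\<bar> * (1/2)"
  proof -
    have "\<bar>(a - \<nu>) \<bullet> \<nu>\<bar> \<le> 1/2" using Cauchy_Schwarz_ineq2[of "a - \<nu>" \<nu>] a \<nu> by simp
    then show ?thesis unfolding abs_mult by (intro mult_left_mono) auto
  qed
  moreover have "M * (norm z)\<^sup>2 \<le> M * \<delta> * norm z"
    unfolding power2_eq_square using z M by (simp add: z_def mult.assoc mult_left_mono mult_right_mono)
  ultimately have "\<bar>t\<bar> \<le> \<bar>t\<bar> / 2 + \<eta> * norm z + M * \<delta> * norm z"
    using L unfolding z_def[symmetric] by (rule arith)
  then show ?thesis by (simp add: z_def t_def algebra_simps)
qed

text \<open>Uniform in \<open>a\<close> and \<open>S\<close> because both depend on \<open>r\<close>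
  in the application. Inside a small cylinder \<open>S\<close> is controlled by the wedge sign,
  outside it only by 1, where the kernel has bounded mass. The one-sided form is applied to an even
  sign and to its negative.\<close>

lemma kernel_upper_bound:
  fixes g Q :: "'a::euclidean_space \<Rightarrow> real"
  assumes gm [measurable]: "g \<in> borel_measurable borel" and Qm [measurable]: "Q \<in> borel_measurable borel"
    and g: "\<And>\<omega>. 0 \<le> g \<omega>" "\<And>\<omega>. g \<omega> \<le> Bg" "\<And>\<omega>. norm \<omega> \<noteq> 1 \<Longrightarrow> g \<omega> = 0"
      "continuous_on (sphere 0 1) g" "\<And>\<omega>. norm \<omega> = 1 \<Longrightarrow> gm \<le> g \<omega>" "gm > 0"
    and Q: "\<And>z. Q z = (norm z)\<^sup>2 * Q (sgn z)" "\<And>\<omega>. norm \<omega> = 1 \<Longrightarrow> \<bar>Q \<omega>\<bar> \<le> M"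
    and \<nu>: "norm \<nu> = 1" and d: "DIM('a) \<ge> 2" and s: "s \<ge> 1" and \<epsilon>: "\<epsilon> > 0"
  shows "\<exists>\<eta>>0. \<forall>\<delta>. 0 < \<delta> \<longrightarrow> \<delta> < \<eta> \<longrightarrow> (\<forall>\<^sub>F r in at_right 0. \<forall>a S. norm (a - \<nu>) \<le> \<eta> \<longrightarrow>
      S \<in> borel_measurable borel \<longrightarrow> (\<forall>h. \<bar>S h\<bar> \<le> 1) \<longrightarrow>
      (\<forall>h. h \<noteq> 0 \<longrightarrow> norm (perp \<nu> h) < \<delta> \<longrightarrow> \<bar>h \<bullet> \<nu>\<bar> < \<delta> \<longrightarrow> S h \<le> wedge_sign (a \<bullet> h) (Q (perp \<nu> h))) \<longrightarrow>
      (\<integral>h. S h * (g (sgn h) * kr DIM('a) s r (norm h)) \<partial>lborel) \<le>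
        (2 * (\<integral>\<omega>. Q \<omega> * g \<omega> \<partial>cone_measure \<nu>) + \<epsilon>) * sigma_s DIM('a) s r)"
proof -
  let ?d = "DIM('a)"
  let ?M = "cone_measure \<nu>"
  interpret finite_measure ?M by (rule finite_measure_cone_measure) fact
  \<comment> \<open>Wedges have nonnegative height, so \<open>Q\<close> is split:
    \<open>wedge_sign\<close> is the indicator of the wedge of \<open>v1\<close> minus that of
    \<open>v2\<close>.\<close>
  define v1 where "v1 z = max (Q z) 0" for z
  define v2 where "v2 z = max (- Q z) 0" for z
  have [measurable]: "v1 \<in> borel_measurable borel" "v2 \<in> borel_measurable borel"
    unfolding v1_def v2_def by measurable
  have hom: "v1 z = (norm z)\<^sup>2 * v1 (sgn z)" "v2 z = (norm z)\<^sup>2 * v2 (sgn z)" for z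
    using Q(1)[of z] zero_le_power2[of "norm z"]
    by (auto simp: v1_def v2_def max_def mult_le_0_iff zero_le_mult_iff)
  have v0: "0 \<le> v1 z" "0 \<le> v2 z" for z by (auto simp: v1_def v2_def)
  have M0: "M \<ge> 0" using Q(2)[OF \<nu>] by simp
  have vM: "v1 \<omega> \<le> M" "v2 \<omega> \<le> M" if "norm \<omega> = 1" for \<omega> using Q(2)[OF that] M0 by (auto simp: v1_def v2_def)
  have Bg: "0 \<le> Bg" using g(1,2) order_trans by blast
  have int: "integrable ?M (\<lambda>\<omega>. v \<omega> * g \<omega>)"
    if [measurable]: "v \<in> borel_measurable borel" and v: "\<And>\<omega>. norm \<omega> = 1 \<Longrightarrow> \<bar>v \<omega>\<bar> \<le> M" for v
  proof (rule integrable_const_bound[where B="M * Bg"])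
    show "AE \<omega> in ?M. norm (v \<omega> * g \<omega>) \<le> M * Bg"
    proof (rule AE_I2)
      fix \<omega>
      show "norm (v \<omega> * g \<omega>) \<le> M * Bg"
      proof (cases "norm \<omega> = 1")
        case True
        then show ?thesis using v g(1,2) M0 by (auto simp: abs_mult intro!: mult_mono)
      qed (use g(3) M0 Bg in auto)
    qed
  qed measurable
  define X1 where "X1 = (\<integral>\<omega>. v1 \<omega> * g \<omega> \<partial>?M)"
  define X2 where "X2 = (\<integral>\<omega>. v2 \<omega> * g \<omega> \<partial>?M)"
  have i1: "integrable ?M (\<lambda>\<omega>. v1 \<omega> * g \<omega>)" "integrable ?M (\<lambda>\<omega>. v2 \<omega> * g \<omega>)"
    using v0 vM by (auto intro!: int)
  have X0: "X1 \<ge> 0" "X2 \<ge> 0" unfolding X1_def X2_def using v0 g(1) by (auto intro!: integral_nonneg_AE)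
  have nX: "(\<integral>\<^sup>+\<omega>. ennreal (v1 \<omega> * g \<omega>) \<partial>?M) = ennreal X1" "(\<integral>\<^sup>+\<omega>. ennreal (v2 \<omega> * g \<omega>) \<partial>?M) = ennreal X2"
    unfolding X1_def X2_def using i1 v0 g(1) by (auto intro!: nn_integral_eq_integral)
  have X: "(\<integral>\<omega>. Q \<omega> * g \<omega> \<partial>?M) = X1 - X2"
    unfolding X1_def X2_def
    by (subst Bochner_Integration.integral_diff[symmetric, OF i1])
       (auto intro!: Bochner_Integration.integral_cong simp: v1_def v2_def max_def algebra_simps)
  define Y where "Y = X1 + X2"
  have Y0: "Y \<ge> 0" using X0 by (simp add: Y_def)
  \<comment> \<open>Error budget: comparing kernels costs \<open>2 * e1 * Y\<close>, replacing the
    radial moment over \<open>a \<bullet> \<nu>\<close> by \<open>sigma_s\<close> costs at most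
    \<open>4 * Y * \<zeta>\<close>, the far part costs \<open>C\<close> over \<open>sigma_s\<close>;
    each stays below \<open>\<epsilon> / 4\<close>. The \<open>Y + 1\<close> avoids a zero
    denominator.\<close>
  define e1 where "e1 = min (1/2) (\<epsilon> / (8 * (Y + 1)))"
  have e1: "0 < e1" "e1 \<le> 1" "2 * e1 * Y \<le> \<epsilon> / 4"
  proof -
    show "0 < e1" "e1 \<le> 1" using \<epsilon> Y0 by (auto simp: e1_def)
    have "2 * e1 * Y \<le> 2 * (\<epsilon> / (8 * (Y + 1))) * Y" using Y0 by (intro mult_right_mono mult_left_mono) (auto simp: e1_def)
    also have "\<dots> \<le> \<epsilon> / 4" using Y0 \<epsilon> by (simp add: field_simps)
    finally show "2 * e1 * Y \<le> \<epsilon> / 4" .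
  qed
  define \<zeta> where "\<zeta> = \<epsilon> / (16 * (Y + 1))"
  have \<zeta>: "\<zeta> > 0" "4 * Y * \<zeta> \<le> \<epsilon> / 4" using \<epsilon> Y0 by (auto simp: \<zeta>_def field_simps)
  obtain \<theta> where \<theta>: "\<theta> > 0" "\<theta> < 1" and cmp: "\<And>r h. 0 < r \<Longrightarrow> perp \<nu> h \<noteq> 0 \<Longrightarrow> \<bar>h \<bullet> \<nu>\<bar> \<le> \<theta> * norm (perp \<nu> h) \<Longrightarrow>
     (1 - e1) * (g (sgn (perp \<nu> h)) * kr ?d s r (norm (perp \<nu> h))) \<le> g (sgn h) * kr ?d s r (norm h) \<and>
     g (sgn h) * kr ?d s r (norm h) \<le> (1 + e1) * (g (sgn (perp \<nu> h)) * kr ?d s r (norm (perp \<nu> h)))"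
    using kernel_near_hyperplane[OF g(4,5,6) \<nu> s e1(1,2)] by blast
  \<comment> \<open>For \<open>\<delta> < \<eta>\<close> this gives
    \<open>2 * (\<eta> + M * \<delta>) \<le> \<theta>\<close>, so the wedge lies where the kernel
    comparison holds; \<open>1/2\<close> keeps \<open>a \<bullet> \<nu>\<close> at least
    \<open>1/2\<close>.\<close>
  define \<eta> where "\<eta> = min (min (1/2) (\<zeta> / 4)) (\<theta> / (2 * (1 + M)))"
  have \<eta>: "\<eta> > 0" "\<eta> \<le> 1/2" "\<eta> \<le> \<zeta> / 4" "2 * (1 + M) * \<eta> \<le> \<theta>"
  proof -
    show "\<eta> > 0" using \<zeta> \<theta> M0 by (auto simp: \<eta>_def)
    show "\<eta> \<le> 1/2" unfolding \<eta>_def by (rule min.coboundedI1[OF min.coboundedI1[OF order_refl]])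
    show "\<eta> \<le> \<zeta> / 4" unfolding \<eta>_def by (rule min.coboundedI1[OF min.coboundedI2[OF order_refl]])
    have "\<eta> \<le> \<theta> / (2 * (1 + M))" by (simp add: \<eta>_def)
    then show "2 * (1 + M) * \<eta> \<le> \<theta>" using M0 by (subst (asm) pos_le_divide_eq) (auto simp: mult.commute)
  qed
  show ?thesis
  proof (intro exI[of _ \<eta>] conjI \<eta>(1) allI impI)
    fix \<delta> :: real assume \<delta>: "0 < \<delta>" "\<delta> < \<eta>"
    obtain C where C: "C \<ge> 0" "\<And>r. 0 < r \<Longrightarrow> r < \<delta> \<Longrightarrow>
     (\<integral>\<^sup>+h. ennreal (g (sgn h) * kr ?d s r (norm h)) * indicator {h. \<delta> \<le> norm h} h \<partial>lborel) \<le> ennreal C"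
      using nn_integral_far_kernel[OF gm g(1,2) s \<delta>(1)] by blast
    have evr: "\<forall>\<^sub>F r in at_right 0. 0 < r \<and> r < \<delta>"
      unfolding eventually_at_right_field using \<delta> by blast
    have ev\<sigma>: "\<forall>\<^sub>F r in at_right 0. 4 * C / \<epsilon> + 1 < sigma_s ?d s r"
      using sigma_s_at_top[OF s, of ?d] by (simp add: filterlim_at_top_dense)
    have evI: "\<forall>\<^sub>F r in at_right 0. \<bar>radial_moment ?d s \<delta> r / sigma_s ?d s r - 1\<bar> < \<zeta> / 4"
      using tendstoD[OF radial_moment_ratio[OF s], of "\<zeta> / 4"] \<zeta>(1) unfolding dist_real_def by simp
    show "\<forall>\<^sub>F r in at_right 0. \<forall>a S. norm (a - \<nu>) \<le> \<eta> \<longrightarrow>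
      S \<in> borel_measurable borel \<longrightarrow> (\<forall>h. \<bar>S h\<bar> \<le> 1) \<longrightarrow>
      (\<forall>h. h \<noteq> 0 \<longrightarrow> norm (perp \<nu> h) < \<delta> \<longrightarrow> \<bar>h \<bullet> \<nu>\<bar> < \<delta> \<longrightarrow> S h \<le> wedge_sign (a \<bullet> h) (Q (perp \<nu> h))) \<longrightarrow>
      (\<integral>h. S h * (g (sgn h) * kr ?d s r (norm h)) \<partial>lborel) \<le>
        (2 * (\<integral>\<omega>. Q \<omega> * g \<omega> \<partial>cone_measure \<nu>) + \<epsilon>) * sigma_s ?d s r"
      using evr ev\<sigma> evI
    proof (eventually_elim, intro allI impI)
      fix r a S
      assume r: "0 < r \<and> r < \<delta>" and \<sigma>1: "4 * C / \<epsilon> + 1 < sigma_s ?d s r"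
        and Ir: "\<bar>radial_moment ?d s \<delta> r / sigma_s ?d s r - 1\<bar> < \<zeta> / 4"
        and a: "norm (a - \<nu>) \<le> \<eta>" and S [measurable]: "S \<in> borel_measurable borel" and S1: "\<forall>h. \<bar>S h\<bar> \<le> 1"
        and SW: "\<forall>h. h \<noteq> 0 \<longrightarrow> norm (perp \<nu> h) < \<delta> \<longrightarrow> \<bar>h \<bullet> \<nu>\<bar> < \<delta> \<longrightarrow> S h \<le> wedge_sign (a \<bullet> h) (Q (perp \<nu> h))"
      define k where "k h = g (sgn h) * kr ?d s r (norm h)" for h :: 'a
      define \<sigma> where "\<sigma> = sigma_s ?d s r"
      define I where "I = radial_moment ?d s \<delta> r"
      define \<alpha> where "\<alpha> = a \<bullet> \<nu>"
      have [measurable]: "k \<in> borel_measurable borel" unfolding k_def by measurable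
      have k0: "0 \<le> k h" for h
        unfolding k_def using g(1) r kr_pos[of r ?d s "norm h"] by (intro mult_nonneg_nonneg) auto
      have ki: "integrable lborel k"
        unfolding k_def[abs_def] using integrable_kernel[OF gm g(1,2) s, of r] r by simp
      have "\<bar>(a - \<nu>) \<bullet> \<nu>\<bar> \<le> \<eta>" using Cauchy_Schwarz_ineq2[of "a - \<nu>" \<nu>] a \<nu> by simp
      then have \<alpha>: "\<bar>\<alpha> - 1\<bar> \<le> \<eta>" using \<nu> by (simp add: \<alpha>_def inner_diff_left dot_square_norm)
      then have \<alpha>0: "\<alpha> \<ge> 1/2" using \<eta>(2) by linarith
      \<comment> \<open>On the wedge the height along \<open>\<nu>\<close> is below
        \<open>norm z\<close>, hence below \<open>\<delta>\<close>. Restricting to the cylinder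
        \<open>D\<close> therefore cuts nothing off, which the lower bound for \<open>P v2\<close>
        relies on.\<close>
      have wedge_t: "z \<noteq> 0 \<and> \<bar>h \<bullet> \<nu>\<bar> \<le> \<theta> * norm z \<and> \<bar>h \<bullet> \<nu>\<bar> < \<delta>"
        if z: "z = perp \<nu> h" "norm z < \<delta>" and v: "v = v1 \<or> v = v2" and L: "\<bar>a \<bullet> h\<bar> < v z" for h z v
      proof -
        have vz: "v z = (norm z)\<^sup>2 * v (sgn z)" using v hom by blast
        have "v1 0 = 0" "v2 0 = 0" using hom[of 0] by simp_all
        then have "z \<noteq> 0" using L v by auto
        then have "norm (sgn z) = 1" by (simp add: norm_sgn)
        then have "v (sgn z) \<le> M" using v vM by blast
        then have "v z \<le> M * (norm z)\<^sup>2" unfolding vz by (simp add: mult.commute mult_right_mono)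
        then have "\<bar>a \<bullet> h\<bar> < M * (norm (perp \<nu> h))\<^sup>2" using L z by simp
        from wedge_height_bound[OF \<nu> a \<eta>(2) _ M0 this, of \<delta>] z
        have "\<bar>h \<bullet> \<nu>\<bar> \<le> 2 * (\<eta> + M * \<delta>) * norm z" by simp
        also have "\<dots> \<le> \<theta> * norm z"
        proof (rule mult_right_mono)
          have "M * \<delta> \<le> M * \<eta>" using \<delta> M0 by (intro mult_left_mono) auto
          then show "2 * (\<eta> + M * \<delta>) \<le> \<theta>" using \<eta>(4) by (simp add: algebra_simps)
        qed simp
        finally have 1: "\<bar>h \<bullet> \<nu>\<bar> \<le> \<theta> * norm z" .
        also have "\<dots> \<le> 1 * norm z" using \<theta> by (intro mult_right_mono) auto
        finally show ?thesis using 1 z \<open>z \<noteq> 0\<close> by simp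
      qed
      define W where "W v h = k (perp \<nu> h) * (if norm (perp \<nu> h) < \<delta> \<and> \<bar>a \<bullet> h\<bar> < v (perp \<nu> h) then 1 else 0)" for v :: "'a \<Rightarrow> real" and h
      define D where "D = {h::'a. norm (perp \<nu> h) < \<delta> \<and> \<bar>h \<bullet> \<nu>\<bar> < \<delta>}"
      have [measurable]: "D \<in> sets borel" unfolding D_def by measurable
      define P where "P v h = indicator D h * (if \<bar>a \<bullet> h\<bar> < v (perp \<nu> h) then 1 else 0) * k h" for v :: "'a \<Rightarrow> real" and h
      have nnW: "(\<integral>\<^sup>+h. ennreal (W v h) \<partial>lborel) = ennreal (2 / \<alpha> * I) * (\<integral>\<^sup>+\<omega>. ennreal (v \<omega> * g \<omega>) \<partial>?M)"
        if v: "v = v1 \<or> v = v2" for v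
      proof -
        have [measurable]: "v \<in> borel_measurable borel" using v by auto
        have "(\<integral>\<^sup>+h. ennreal (W v h) \<partial>lborel) = (\<integral>\<^sup>+h. ennreal (g (sgn (perp \<nu> h)) * kr ?d s r (norm (perp \<nu> h))) *
           (if norm (perp \<nu> h) < \<delta> \<and> \<bar>a \<bullet> h\<bar> < v (perp \<nu> h) then 1 else 0) \<partial>lborel)"
          by (rule nn_integral_cong) (simp add: W_def k_def)
        also have "\<dots> = ennreal (2 / \<alpha> * I) * (\<integral>\<^sup>+\<omega>. ennreal (v \<omega> * g \<omega>) \<partial>?M)"
          unfolding \<alpha>_def I_def
        proof (rule nn_integral_wedge)
          show "0 \<le> v z" "v z = (norm z)\<^sup>2 * v (sgn z)" for z using v v0 hom by blast+
          show "norm \<omega> = 1 \<Longrightarrow> v \<omega> \<le> M" for \<omega> using v vM by blast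
          show "0 < a \<bullet> \<nu>" using \<alpha>0 by (simp add: \<alpha>_def)
        qed (use g \<nu> d s r in auto)
        finally show ?thesis .
      qed
      have Pi: "integrable lborel (P v)" if v: "v = v1 \<or> v = v2" for v
      proof (rule Bochner_Integration.integrable_bound[OF ki])
        have [measurable]: "v \<in> borel_measurable borel" using v by auto
        show "P v \<in> borel_measurable lborel" unfolding P_def[abs_def] by measurable
        show "AE h in lborel. norm (P v h) \<le> norm (k h)"
          using k0 by (intro AE_I2) (auto simp: P_def indicator_def)
      qed
      have I0: "I > 0"
      proof -
        have "r powr (1 - s) > 0" using r by auto
        moreover have "0 \<le> (if s = 1 then ln \<delta> - ln r else (r powr (1 - s) - \<delta> powr (1 - s)) / (s - 1))"
        proof -
          have "\<delta> powr (1 - s) \<le> r powr (1 - s)" using r s by (intro powr_mono2') auto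
          then show ?thesis using r s \<delta> by (auto intro!: divide_nonneg_nonneg)
        qed
        ultimately show ?thesis unfolding I_def radial_moment_def by (intro add_pos_nonneg) auto
      qed
      have p1: "0 \<le> 1 + e1" and p2: "0 \<le> 1 - e1" and p3: "0 \<le> 2 / \<alpha> * I" using e1 \<alpha>0 I0 by auto
      have up: "(\<integral>h. P v1 h \<partial>lborel) \<le> (1 + e1) * (2 / \<alpha> * I * X1)"
      proof -
        have "ennreal (\<integral>h. P v1 h \<partial>lborel) = (\<integral>\<^sup>+h. ennreal (P v1 h) \<partial>lborel)"
          by (rule nn_integral_eq_integral[symmetric]) (use Pi[of v1] in simp, use k0 in \<open>auto simp: P_def\<close>)
        also have "\<dots> \<le> (\<integral>\<^sup>+h. ennreal (1 + e1) * ennreal (W v1 h) \<partial>lborel)"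
        proof (rule nn_integral_mono)
          fix h :: 'a
          have "P v1 h \<le> (1 + e1) * W v1 h"
          proof (cases "h \<in> D \<and> \<bar>a \<bullet> h\<bar> < v1 (perp \<nu> h)")
            case True
            then have nz: "norm (perp \<nu> h) < \<delta>" by (simp add: D_def)
            from wedge_t[OF refl this, of v1] True cmp[of r h] r nz show ?thesis by (simp add: P_def W_def k_def)
          next
            case False
            then have "P v1 h = 0" by (auto simp: P_def)
            then show ?thesis using k0 e1 by (auto simp: W_def)
          qed
          then show "ennreal (P v1 h) \<le> ennreal (1 + e1) * ennreal (W v1 h)"
            unfolding ennreal_mult'[OF p1, symmetric] by (rule ennreal_leI)
        qed
        also have "\<dots> = ennreal (1 + e1) * (\<integral>\<^sup>+h. ennreal (W v1 h) \<partial>lborel)"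
          by (rule nn_integral_cmult) (unfold W_def, measurable)
        also have "\<dots> = ennreal (1 + e1) * (ennreal (2 / \<alpha> * I) * ennreal X1)"
          by (simp add: nnW nX)
        also have "\<dots> = ennreal ((1 + e1) * (2 / \<alpha> * I * X1))"
          by (simp only: ennreal_mult'[OF p1] ennreal_mult'[OF p3])
        finally show ?thesis using e1 \<alpha>0 I0 X0 by (subst (asm) ennreal_le_iff) auto
      qed
      have low: "(1 - e1) * (2 / \<alpha> * I * X2) \<le> (\<integral>h. P v2 h \<partial>lborel)"
      proof -
        have "ennreal ((1 - e1) * (2 / \<alpha> * I * X2)) = ennreal (1 - e1) * (ennreal (2 / \<alpha> * I) * ennreal X2)"
          by (simp only: ennreal_mult'[OF p2] ennreal_mult'[OF p3])
        also have "\<dots> = ennreal (1 - e1) * (\<integral>\<^sup>+h. ennreal (W v2 h) \<partial>lborel)"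
          by (simp add: nnW nX)
        also have "\<dots> = (\<integral>\<^sup>+h. ennreal (1 - e1) * ennreal (W v2 h) \<partial>lborel)"
          by (rule nn_integral_cmult[symmetric]) (unfold W_def, measurable)
        also have "\<dots> \<le> (\<integral>\<^sup>+h. ennreal (P v2 h) \<partial>lborel)"
        proof (rule nn_integral_mono)
          fix h :: 'a
          have "(1 - e1) * W v2 h \<le> P v2 h"
          proof (cases "norm (perp \<nu> h) < \<delta> \<and> \<bar>a \<bullet> h\<bar> < v2 (perp \<nu> h)")
            case True
            from wedge_t[OF refl, of h v2] True cmp[of r h] r show ?thesis by (simp add: P_def W_def k_def D_def)
          next
            case False
            then have "W v2 h = 0" by (auto simp: W_def)
            then show ?thesis using k0 by (auto simp: P_def)
          qed
          then show "ennreal (1 - e1) * ennreal (W v2 h) \<le> ennreal (P v2 h)"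
            unfolding ennreal_mult'[OF p2, symmetric] by (rule ennreal_leI)
        qed
        also have "\<dots> = ennreal (\<integral>h. P v2 h \<partial>lborel)"
          by (rule nn_integral_eq_integral) (use Pi[of v2] in simp, use k0 in \<open>auto simp: P_def\<close>)
        finally have le: "ennreal ((1 - e1) * (2 / \<alpha> * I * X2)) \<le> ennreal (\<integral>h. P v2 h \<partial>lborel)" .
        have "0 \<le> (\<integral>h. P v2 h \<partial>lborel)" by (intro integral_nonneg_AE AE_I2) (simp add: P_def k0)
        with le show ?thesis by (simp only: ennreal_le_iff)
      qed
      have oi: "integrable lborel (\<lambda>h. indicator (- D) h * k h)"
        by (rule Bochner_Integration.integrable_bound[OF ki]) (auto simp: indicator_def)
      \<comment> \<open>Both cylinder coordinates are at most \<open>norm h\<close>, so outside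
        \<open>D\<close> the norm is at least \<open>\<delta>\<close>.\<close>
      have far: "(\<integral>h. indicator (- D) h * k h \<partial>lborel) \<le> C"
      proof -
        have "ennreal (\<integral>h. indicator (- D) h * k h \<partial>lborel) = (\<integral>\<^sup>+h. ennreal (indicator (- D) h * k h) \<partial>lborel)"
          by (rule nn_integral_eq_integral[symmetric]) (use oi k0 in auto)
        also have "\<dots> \<le> (\<integral>\<^sup>+h. ennreal (g (sgn h) * kr ?d s r (norm h)) * indicator {h. \<delta> \<le> norm h} h \<partial>lborel)"
        proof (rule nn_integral_mono)
          fix h :: 'a
          have "\<delta> \<le> norm h" if "h \<notin> D"
          proof -
            have "\<bar>h \<bullet> \<nu>\<bar> \<le> norm h" using Cauchy_Schwarz_ineq2[of h \<nu>] \<nu> by simp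
            then show ?thesis using that norm_perp_le[OF \<nu>, of h] by (auto simp: D_def)
          qed
          then show "ennreal (indicator (- D) h * k h) \<le> ennreal (g (sgn h) * kr ?d s r (norm h)) * indicator {h. \<delta> \<le> norm h} h"
            by (auto simp: indicator_def k_def)
        qed
        also have "\<dots> \<le> ennreal C" using C(2) r by blast
        finally show ?thesis using C(1) by simp
      qed
      have "(\<integral>h. S h * k h \<partial>lborel) \<le> (\<integral>h. P v1 h - P v2 h + indicator (- D) h * k h \<partial>lborel)"
      proof (rule integral_mono_AE)
        show "integrable lborel (\<lambda>h. S h * k h)"
          by (rule Bochner_Integration.integrable_bound[OF ki])
             (use S1 in \<open>auto simp: abs_mult intro!: AE_I2 mult_left_le_one_le\<close>)
        show "integrable lborel (\<lambda>h. P v1 h - P v2 h + indicator (- D) h * k h)"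
          by (intro Bochner_Integration.integrable_add Bochner_Integration.integrable_diff Pi oi) auto
        have "S h * k h \<le> P v1 h - P v2 h + indicator (- D) h * k h" if "h \<noteq> 0" for h
        proof (cases "h \<in> D")
          case True
          then have "S h \<le> wedge_sign (a \<bullet> h) (Q (perp \<nu> h))" using SW that by (auto simp: D_def)
          then have "S h * k h \<le> wedge_sign (a \<bullet> h) (Q (perp \<nu> h)) * k h" using k0 by (rule mult_right_mono)
          also have "\<dots> = P v1 h - P v2 h"
            using True by (auto simp: wedge_sign_def P_def v1_def v2_def less_max_iff_disj)
          finally show ?thesis using True by simp
        next
          case False
          have "S h * k h \<le> 1 * k h" using S1 k0 by (intro mult_right_mono) (auto simp: abs_le_iff)
          then show ?thesis using False by (simp add: P_def)
        qed
        then show "AE h in lborel. S h * k h \<le> P v1 h - P v2 h + indicator (- D) h * k h"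
          using AE_lborel_singleton[of "0::'a"] by (auto elim!: eventually_mono)
      qed
      also have "\<dots> = (\<integral>h. P v1 h \<partial>lborel) - (\<integral>h. P v2 h \<partial>lborel) + (\<integral>h. indicator (- D) h * k h \<partial>lborel)"
        using Pi oi by simp
      also have "\<dots> \<le> (1 + e1) * (2 / \<alpha> * I * X1) - (1 - e1) * (2 / \<alpha> * I * X2) + C"
        using up low far by linarith
      also have "\<dots> = 2 * (I / \<alpha>) * (X1 - X2 + e1 * Y) + C"
        by (simp add: Y_def algebra_simps add_divide_distrib diff_divide_distrib)
      also have "\<dots> \<le> (2 * (X1 - X2) + \<epsilon>) * \<sigma>"
      proof -
        have \<sigma>0: "\<sigma> > 0" "C \<le> \<epsilon> / 4 * \<sigma>"
        proof -
          have "0 \<le> 4 * C / \<epsilon>" using C(1) \<epsilon> by simp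
          then show "\<sigma> > 0" using \<sigma>1 unfolding \<sigma>_def by linarith
          have "4 * C / \<epsilon> \<le> \<sigma>" using \<sigma>1 unfolding \<sigma>_def by linarith
          then show "C \<le> \<epsilon> / 4 * \<sigma>" using \<epsilon> by (simp add: field_simps)
        qed
        \<comment> \<open>The relative error of replacing \<open>I / \<alpha>\<close> by
          \<open>\<sigma>\<close>: \<open>I / \<sigma>\<close> is within \<open>\<zeta> / 4\<close>
          of 1 and \<open>\<alpha>\<close> within \<open>\<eta> \<le> \<zeta> / 4\<close>; dividing
          by \<open>\<alpha> \<ge> 1/2\<close> at most doubles the sum.\<close>
        define \<tau> where "\<tau> = I / (\<sigma> * \<alpha>) - 1"
        have "\<bar>\<tau>\<bar> \<le> \<zeta>"
        proof -
          have "\<tau> = (I / \<sigma> - \<alpha>) / \<alpha>" using \<sigma>0 \<alpha>0 by (simp add: \<tau>_def field_simps)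
          then have "\<bar>\<tau>\<bar> = \<bar>I / \<sigma> - \<alpha>\<bar> / \<alpha>" using \<alpha>0 by simp
          also have "\<dots> \<le> (\<zeta> / 4 + \<eta>) / (1/2)"
          proof (rule frac_le)
            show "\<bar>I / \<sigma> - \<alpha>\<bar> \<le> \<zeta> / 4 + \<eta>" using Ir \<alpha> unfolding I_def \<sigma>_def by linarith
          qed (use \<alpha>0 \<zeta> \<eta> in auto)
          also have "\<dots> \<le> \<zeta>" using \<eta>(3) by simp
          finally show ?thesis .
        qed
        define T where "T = X1 - X2 + e1 * Y"
        have T: "\<bar>T\<bar> \<le> 2 * Y"
        proof -
          have "\<bar>X1 - X2\<bar> \<le> Y" using X0 by (simp add: Y_def abs_le_iff)
          moreover have "0 \<le> e1 * Y" "e1 * Y \<le> Y" using e1 Y0 by (auto simp: mult_left_le_one_le)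
          ultimately show ?thesis unfolding T_def by linarith
        qed
        have "2 * (I / \<alpha>) * T + C = (2 * T + 2 * T * \<tau>) * \<sigma> + C"
          using \<sigma>0 \<alpha>0 by (simp add: \<tau>_def field_simps)
        also have "\<dots> \<le> (2 * T + \<epsilon> / 4) * \<sigma> + \<epsilon> / 4 * \<sigma>"
        proof -
          have "\<bar>2 * T * \<tau>\<bar> \<le> 2 * (2 * Y) * \<zeta>"
            unfolding abs_mult using T \<open>\<bar>\<tau>\<bar> \<le> \<zeta>\<close> Y0 by (intro mult_mono) auto
          then have "2 * T + 2 * T * \<tau> \<le> 2 * T + \<epsilon> / 4" using \<zeta>(2) by linarith
          then have "(2 * T + 2 * T * \<tau>) * \<sigma> \<le> (2 * T + \<epsilon> / 4) * \<sigma>" using \<sigma>0(1) by (intro mult_right_mono) auto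
          then show ?thesis using \<sigma>0(2) by (rule add_mono)
        qed
        also have "\<dots> = (2 * (X1 - X2) + (2 * e1 * Y + \<epsilon> / 2)) * \<sigma>" by (simp add: T_def algebra_simps)
        also have "\<dots> \<le> (2 * (X1 - X2) + \<epsilon>) * \<sigma>"
          using e1(3) \<sigma>0 \<epsilon> by (intro mult_right_mono add_left_mono) auto
        finally show ?thesis by (simp add: T_def)
      qed
      finally show "(\<integral>h. S h * (g (sgn h) * kr ?d s r (norm h)) \<partial>lborel) \<le>
        (2 * (\<integral>\<omega>. Q \<omega> * g \<omega> \<partial>cone_measure \<nu>) + \<epsilon>) * sigma_s ?d s r"
        by (simp add: X k_def \<sigma>_def)
    qed
  qed
qed

section \<open>The limit of the nonlocal curvature\<close>


text \<open>\<open>v1\<close> and \<open>v2\<close> are the defining function at \<open>h\<close>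
  and \<open>- h\<close>. Their error is quadratic in the full \<open>norm h\<close>, while the
  widening of the wedge is quadratic in \<open>norm (perp \<nu> h)\<close> only. Away from the
  hyperplane, where the widening is too weak, the linear term decides both signs and they
  cancel.\<close>

lemma symmetric_sign_bound:
  fixes \<nu> a h :: "'a::euclidean_space" and q v1 v2 :: real
  assumes \<nu>: "norm \<nu> = 1" and a: "norm (a - \<nu>) \<le> 1/10" and h: "h \<noteq> 0" "norm h < \<delta>"
    and q: "\<bar>q\<bar> \<le> M * (norm (perp \<nu> h))\<^sup>2" and M: "M \<ge> 0" and \<epsilon>: "\<epsilon> > 0" and \<delta>: "(M + 2 * \<epsilon>) * \<delta> \<le> 1/2"
    and v: "\<bar>v1 - (a \<bullet> h + q)\<bar> \<le> \<epsilon> / 4 * (norm h)\<^sup>2" "\<bar>v2 - (- (a \<bullet> h) + q)\<bar> \<le> \<epsilon> / 4 * (norm h)\<^sup>2"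
  shows "((if v1 \<le> 0 then -1 else 1) + (if v2 \<le> 0 then -1 else 1)) / 2 \<le> wedge_sign (a \<bullet> h) (q + \<epsilon> * (norm (perp \<nu> h))\<^sup>2)"
    and "- (((if v1 \<le> 0 then -1 else 1) + (if v2 \<le> 0 then -1 else 1)) / 2) \<le> wedge_sign (a \<bullet> h) (- q + \<epsilon> * (norm (perp \<nu> h))\<^sup>2)"
proof -
  define L where "L = a \<bullet> h"
  define Z where "Z = (norm (perp \<nu> h))\<^sup>2"
  define t where "t = \<bar>h \<bullet> \<nu>\<bar>"
  define e where "e = \<epsilon> / 4 * (norm h)\<^sup>2"
  have nh: "(norm h)\<^sup>2 = Z + t\<^sup>2" using norm_perp[OF \<nu>, of h] by (simp add: Z_def t_def)
  have Z0: "Z \<ge> 0" by (simp add: Z_def)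
  have v': "\<bar>v1 - (L + q)\<bar> \<le> e" "\<bar>v2 - (- L + q)\<bar> \<le> e" using v by (auto simp: L_def e_def)
  \<comment> \<open>Either the tangential part dominates and the error is smaller than the widening,
    or the normal part dominates and \<open>L\<close> beats all other terms; then the two signs are
    opposite and both wedge signs vanish. The hypothesis on \<open>\<delta>\<close> serves the
    second case, through \<open>1/2 < 4/5\<close>.\<close>
  have "(e < \<epsilon> * Z) \<or> (\<bar>q\<bar> + \<epsilon> * Z + e < \<bar>L\<bar>)"
  proof (cases "t\<^sup>2 \<le> Z")
    case True
    have "(norm h)\<^sup>2 > 0" using h by simp
    then have "Z > 0" using nh True by linarith
    then have "e \<le> \<epsilon> / 4 * (2 * Z)" unfolding e_def nh using True \<epsilon> by (intro mult_left_mono) auto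
    also have "\<dots> < \<epsilon> * Z" using \<epsilon> \<open>Z > 0\<close> by simp
    finally show ?thesis by simp
  next
    case False
    have t0: "t > 0" using False Z0 by (auto simp: t_def intro: ccontr)
    have th: "t \<le> norm h" unfolding t_def using Cauchy_Schwarz_ineq2[of h \<nu>] \<nu> by simp
    then have td: "t < \<delta>" using h by simp
    have "(norm h)\<^sup>2 \<le> (2 * t)\<^sup>2" using nh False Z0 by (simp add: power_mult_distrib)
    then have h2: "norm h \<le> 2 * t" by (rule power2_le_imp_le) (use t0 in simp)
    have "\<bar>(a - \<nu>) \<bullet> h\<bar> \<le> 1/10 * (2 * t)"
      using Cauchy_Schwarz_ineq2[of "a - \<nu>" h] mult_mono[OF a h2] by simp
    moreover have "L = h \<bullet> \<nu> + (a - \<nu>) \<bullet> h" by (simp add: L_def inner_diff_left inner_commute[of h \<nu>])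
    ultimately have "\<bar>L\<bar> \<ge> t - 1/10 * (2 * t)" unfolding t_def by arith
    then have L1: "\<bar>L\<bar> \<ge> 4/5 * t" by simp
    have "\<bar>q\<bar> \<le> M * t\<^sup>2" using q mult_left_mono[of Z "t\<^sup>2" M] False M by (simp add: Z_def)
    moreover have "\<epsilon> * Z \<le> \<epsilon> * t\<^sup>2" using False \<epsilon> by (intro mult_left_mono) auto
    moreover have "e \<le> \<epsilon> / 4 * (2 * t\<^sup>2)" unfolding e_def nh using False \<epsilon> by (intro mult_left_mono) auto
    moreover have "\<epsilon> * t\<^sup>2 \<ge> 0" using \<epsilon> by simp
    ultimately have "\<bar>q\<bar> + \<epsilon> * Z + e \<le> (M + 2 * \<epsilon>) * t\<^sup>2" by (simp add: algebra_simps)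
    also have "\<dots> \<le> (M + 2 * \<epsilon>) * \<delta> * t"
      unfolding power2_eq_square using td t0 M \<epsilon> by (simp add: mult.assoc mult_left_mono mult_right_mono)
    also have "\<dots> \<le> 1/2 * t" using \<delta> t0 by (intro mult_right_mono) auto
    also have "\<dots> < 4/5 * t" using t0 by simp
    finally show ?thesis using L1 by linarith
  qed
  moreover have "0 \<le> e" "0 \<le> \<epsilon> * Z" using \<epsilon> Z0 by (auto simp: e_def)
  ultimately have "((if v1 \<le> 0 then -1 else 1) + (if v2 \<le> 0 then -1 else 1)) / 2 \<le> wedge_sign L (q + \<epsilon> * Z)"
    and "- (((if v1 \<le> 0 then -1 else 1) + (if v2 \<le> 0 then -1 else 1)) / 2) \<le> wedge_sign L (- q + \<epsilon> * Z)"
    using v' unfolding wedge_sign_def by (auto simp: abs_if split: if_splits)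
  then show "((if v1 \<le> 0 then -1 else 1) + (if v2 \<le> 0 then -1 else 1)) / 2 \<le> wedge_sign (a \<bullet> h) (q + \<epsilon> * (norm (perp \<nu> h))\<^sup>2)"
    and "- (((if v1 \<le> 0 then -1 else 1) + (if v2 \<le> 0 then -1 else 1)) / 2) \<le> wedge_sign (a \<bullet> h) (- q + \<epsilon> * (norm (perp \<nu> h))\<^sup>2)"
    by (auto simp: L_def Z_def)
qed

section \<open>Reduction to the even part of the sign\<close>

lemma lborel_integral_translate:
  fixes f :: "'a::euclidean_space \<Rightarrow> real"
  assumes [measurable]: "f \<in> borel_measurable borel"
  shows "(\<integral>h. f (x + h) \<partial>lborel) = (\<integral>h. f h \<partial>lborel)"
proof -
  have "(\<integral>h. f h \<partial>lborel) = (\<integral>h. f h \<partial>distr lborel borel ((+) x))" by (simp add: lborel_distr_plus)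
  also have "\<dots> = (\<integral>h. f (x + h) \<partial>lborel)" by (rule integral_distr) auto
  finally show ?thesis by simp
qed

lemma lborel_integral_reflect:
  fixes f :: "'a::euclidean_space \<Rightarrow> real"
  assumes [measurable]: "f \<in> borel_measurable borel"
  shows "(\<integral>h. f (- h) \<partial>lborel) = (\<integral>h. f h \<partial>lborel)"
proof -
  have "distr lborel borel (\<lambda>x. - x) = (lborel :: 'a measure)"
    using lborel_affine[of "-1" "0::'a"] by (simp add: density_1)
  then have "(\<integral>h. f h \<partial>lborel) = (\<integral>h. f h \<partial>distr lborel borel (\<lambda>x. - x))" by simp
  also have "\<dots> = (\<integral>h. f (- h) \<partial>lborel)" by (rule integral_distr) auto
  finally show ?thesis by simp
qed

text \<open>Reflection \<open>h \<mapsto> - h\<close> preserves Lebesgue measure and the kernel, so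
  the integrand may be averaged over both. The function \<open>g\<close>, arbitrary off the sphere,
  is replaced by its extension by zero, which is a Borel function on the whole space.\<close>

lemma Kgr_symmetrized:
  fixes g :: "'a::euclidean_space \<Rightarrow> real"
  assumes gm: "(\<lambda>\<omega>. indicator (sphere 0 1) \<omega> * g \<omega>) \<in> borel_measurable borel"
    and g: "\<And>\<omega>. 0 \<le> indicator (sphere 0 1) \<omega> * g \<omega>" "\<And>\<omega>. indicator (sphere 0 1) \<omega> * g \<omega> \<le> Bg"
    and even: "\<forall>\<xi>\<in>sphere 0 1. g (- \<xi>) = g \<xi>" and F: "closed F" and s: "s \<ge> 1" and r: "r > 0"
    and \<phi>: "\<And>h. \<phi> h = indicator (- F) (x + h) - indicator F (x + h)"
  shows "Kgr g s r x F = (\<integral>h. (\<phi> h + \<phi> (- h)) / 2 * (indicator (sphere 0 1) (sgn h) * g (sgn h) * kr DIM('a) s r (norm h)) \<partial>lborel)"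
proof -
  define G where "G \<omega> = indicator (sphere 0 1) \<omega> * g \<omega>" for \<omega>
  have [measurable]: "G \<in> borel_measurable borel" using gm by (simp add: G_def[abs_def])
  have [measurable]: "F \<in> sets borel" using F by (rule borel_closed)
  define k where "k h = G (sgn h) * kr DIM('a) s r (norm h)" for h :: 'a
  have [measurable]: "k \<in> borel_measurable borel" unfolding k_def by measurable
  have [measurable]: "\<phi> \<in> borel_measurable borel" unfolding \<phi>[abs_def] by measurable
  have ki: "integrable lborel k"
    unfolding k_def[abs_def] G_def using integrable_kernel[OF gm g s r] by simp
  have keven: "k (- h) = k h" for h
  proof (cases "h = 0")
    case False
    then have "sgn h \<in> sphere 0 1" by (simp add: norm_sgn)
    then show ?thesis using even by (simp add: k_def G_def sgn_minus)
  qed simp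
  have kg: "kgr g s r (- h) = k h" if "h \<noteq> 0" for h
  proof -
    have "sgn h \<in> sphere 0 1" using that by (simp add: norm_sgn)
    moreover have "(- h) /\<^sub>R norm (- h) = - sgn h" by (simp add: sgn_div_norm)
    ultimately show ?thesis using even by (simp add: kgr_def k_def G_def)
  qed
  have c1: "\<bar>\<phi> h\<bar> \<le> 1" for h by (auto simp: \<phi> indicator_def)
  have mk: "(\<lambda>y. (indicator (- F) y - indicator F y) * k (x - y)) \<in> borel_measurable borel" by measurable
  have i: "integrable lborel (\<lambda>h. \<phi> h * k h)"
    by (rule Bochner_Integration.integrable_bound[OF ki])
       (use c1 in \<open>auto simp: abs_mult intro!: AE_I2 mult_left_le_one_le\<close>)
  have i': "integrable lborel (\<lambda>h. \<phi> (- h) * k h)"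
    by (rule Bochner_Integration.integrable_bound[OF ki])
       (use c1 in \<open>auto simp: abs_mult intro!: AE_I2 mult_left_le_one_le\<close>)
  have "Kgr g s r x F = (\<integral>y. (indicator (- F) y - indicator F y) * k (x - y) \<partial>lborel)"
    unfolding Kgr_def
  proof (rule integral_cong_AE)
    have eq: "(indicator (- F) y - indicator F y) * kgr g s r (x - y) = (indicator (- F) y - indicator F y) * k (x - y)" if "y \<noteq> x" for y
      using kg[of "y - x"] keven[of "y - x"] that by simp
    then show "AE y in lborel. (indicator (- F) y - indicator F y) * kgr g s r (x - y) = (indicator (- F) y - indicator F y) * k (x - y)"
      using AE_lborel_singleton[of x] by (auto elim!: eventually_mono)
    \<comment> \<open>Both integrands differ only at \<open>y = x\<close>, where \<open>kgr\<close>
      evaluates \<open>g\<close> at 0. A change at a single point preserves measurability, although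
      \<open>g\<close> is not assumed Borel off the sphere.\<close>
    have "(\<lambda>y. (indicator (- F) y - indicator F y) * kgr g s r (x - y)) =
      (\<lambda>y. if y = x then (indicator (- F) x - indicator F x) * kgr g s r 0 else (indicator (- F) y - indicator F y) * k (x - y))"
      using eq by auto
    then show "(\<lambda>y. (indicator (- F) y - indicator F y) * kgr g s r (x - y)) \<in> borel_measurable lborel"
      by simp
  qed measurable
  also have "\<dots> = (\<integral>h. (indicator (- F) (x + h) - indicator F (x + h)) * k (x - (x + h)) \<partial>lborel)"
    by (rule lborel_integral_translate[symmetric]) fact
  also have "\<dots> = (\<integral>h. \<phi> h * k h \<partial>lborel)" by (simp add: \<phi> keven)
  finally have K1: "Kgr g s r x F = (\<integral>h. \<phi> h * k h \<partial>lborel)" .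
  also have "\<dots> = (\<integral>h. \<phi> (- h) * k (- h) \<partial>lborel)"
    by (rule lborel_integral_reflect[symmetric]) measurable
  finally have K2: "Kgr g s r x F = (\<integral>h. \<phi> (- h) * k h \<partial>lborel)" by (simp add: keven)
  have "(\<integral>h. (\<phi> h + \<phi> (- h)) / 2 * k h \<partial>lborel) = (\<integral>h. (\<phi> h * k h + \<phi> (- h) * k h) / 2 \<partial>lborel)"
    by (simp add: algebra_simps)
  also have "\<dots> = ((\<integral>h. \<phi> h * k h \<partial>lborel) + (\<integral>h. \<phi> (- h) * k h \<partial>lborel)) / 2"
    using i i' by simp
  finally show ?thesis using K1 K2 by (simp add: k_def G_def)
qed

text \<open>Stated for an arbitrary local graph: every candidate value in the definite description
  of \<open>aniso_curv\<close> is then the limit of one and the same function, so the candidates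
  coincide.\<close>

theorem Kgr_limit_local_graph:
  fixes g :: "'a::euclidean_space \<Rightarrow> real"
  assumes d: "DIM('a) \<ge> 2"
    and gc: "continuous_on (sphere 0 1) g"
    and gp: "\<forall>\<xi>\<in>sphere 0 1. g \<xi> > 0"
    and ge: "\<forall>\<xi>\<in>sphere 0 1. g (- \<xi>) = g \<xi>"
    and s: "s \<ge> 1"
    and FC: "\<forall>r>0. F r \<in> classC"
    and conv: "convC F E"
    and Fx: "\<forall>r>0. x \<in> frontier (F r)"
    and lg: "local_graph E x \<nu> f f' f''"
  shows "((\<lambda>r. Kgr g s r x (F r) / sigma_s DIM('a) s r) \<longlongrightarrow>
     - (\<integral>\<xi>. indicator {\<xi>. norm \<xi> = 1 \<and> \<xi> \<bullet> \<nu> = 0} \<xi> * (g \<xi> * f'' 0 \<xi> \<xi>) \<partial>hausdorff_measure (DIM('a) - 2))) (at_right 0)"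
proof -
  let ?d = "DIM('a)"
  let ?M = "cone_measure \<nu>"
  have \<nu>: "norm \<nu> = 1" using lg by (simp add: local_graph_def)
  interpret finite_measure ?M by (rule finite_measure_cone_measure) fact
  \<comment> \<open>Extension of \<open>g\<close> by zero off the sphere; it also vanishes at
    \<open>sgn 0 = 0\<close>.\<close>
  define G where "G \<omega> = indicator (sphere 0 1) \<omega> * g \<omega>" for \<omega>
  have Gm [measurable]: "G \<in> borel_measurable borel"
    using borel_measurable_continuous_on_indicator[OF _ gc] by (simp add: G_def[abs_def])
  have Gs: "G \<omega> = g \<omega>" if "norm \<omega> = 1" for \<omega> using that by (simp add: G_def)
  have sne: "sphere (0::'a) 1 \<noteq> {}" using \<nu> by auto
  obtain \<omega>1 where \<omega>1: "norm \<omega>1 = 1" "\<And>\<omega>. norm \<omega> = 1 \<Longrightarrow> g \<omega>1 \<le> g \<omega>"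
    using continuous_attains_inf[OF compact_sphere sne gc] by auto
  obtain \<omega>2 where \<omega>2: "norm \<omega>2 = 1" "\<And>\<omega>. norm \<omega> = 1 \<Longrightarrow> g \<omega> \<le> g \<omega>2"
    using continuous_attains_sup[OF compact_sphere sne gc] by auto
  have g0: "g \<omega> > 0" if "norm \<omega> = 1" for \<omega> using gp that by simp
  have G0: "0 \<le> G \<omega>" "G \<omega> \<le> g \<omega>2" for \<omega>
    using g0[of \<omega>] g0[OF \<omega>2(1)] \<omega>2(2)[of \<omega>] by (auto simp: G_def indicator_def)
  have G3: "G \<omega> = 0" if "norm \<omega> \<noteq> 1" for \<omega> using that by (simp add: G_def)
  have Gc: "continuous_on (sphere 0 1) G" using gc by (rule continuous_on_cong[THEN iffD1, rotated 2]) (auto simp: Gs)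
  have G5: "g \<omega>1 \<le> G \<omega>" if "norm \<omega> = 1" for \<omega> using \<omega>1(2) that by (simp add: Gs)
  define H where "H z = f'' 0 z z" for z
  have Hc: "continuous_on UNIV H"
    unfolding H_def by (intro bounded_bilinear.continuous_on[OF bounded_bilinear_blinfun_apply] continuous_intros)
  then have [measurable]: "H \<in> borel_measurable borel" by (rule borel_measurable_continuous_onI)
  define M where "M = norm (f'' 0)"
  have M0: "M \<ge> 0" by (simp add: M_def)
  have HM: "\<bar>H z\<bar> \<le> M * (norm z)\<^sup>2" for z
  proof -
    have "\<bar>H z\<bar> \<le> norm (f'' 0 z) * norm z" unfolding H_def using norm_blinfun[of "f'' 0 z" z] by simp
    also have "\<dots> \<le> (M * norm z) * norm z" unfolding M_def by (intro mult_right_mono norm_blinfun) auto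
    finally show ?thesis by (simp add: power2_eq_square)
  qed
  have Hs: "H z = (norm z)\<^sup>2 * H (sgn z)" for z
  proof -
    have "z = norm z *\<^sub>R sgn z" by (cases "z = 0") (auto simp: sgn_div_norm)
    then have "H z = H (norm z *\<^sub>R sgn z)" by simp
    then show ?thesis by (simp add: H_def blinfun.scaleR_right blinfun.scaleR_left power2_eq_square)
  qed
  have Hm: "H (- z) = H z" for z by (simp add: H_def blinfun.minus_right blinfun.minus_left)
  define k0 where "k0 = - (\<integral>\<omega>. H \<omega> * G \<omega> \<partial>?M)"
  have target: "- (\<integral>\<xi>. indicator {\<xi>. norm \<xi> = 1 \<and> \<xi> \<bullet> \<nu> = 0} \<xi> * (g \<xi> * f'' 0 \<xi> \<xi>) \<partial>hausdorff_measure (?d - 2)) = k0"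
  proof -
    have "(\<integral>\<omega>. H \<omega> * G \<omega> \<partial>?M) = (\<integral>\<omega>. H \<omega> * G \<omega> \<partial>density (hausdorff_measure (?d - 2)) (\<lambda>\<xi>. ennreal (indicator (equator \<nu>) \<xi>)))"
      using hausdorff_measure_equator[OF \<nu> d] by (simp add: ennreal_indicator)
    also have "\<dots> = (\<integral>\<xi>. indicator (equator \<nu>) \<xi> *\<^sub>R (H \<xi> * G \<xi>) \<partial>hausdorff_measure (?d - 2))"
      by (rule integral_density) auto
    also have "\<dots> = (\<integral>\<xi>. indicator {\<xi>. norm \<xi> = 1 \<and> \<xi> \<bullet> \<nu> = 0} \<xi> * (g \<xi> * f'' 0 \<xi> \<xi>) \<partial>hausdorff_measure (?d - 2))"
      by (rule Bochner_Integration.integral_cong) (auto simp: indicator_def equator_def Gs H_def)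
    finally show ?thesis by (simp add: k0_def)
  qed
  define A where "A = (\<integral>\<omega>. (norm \<omega>)\<^sup>2 * G \<omega> \<partial>?M)"
  have A0: "A \<ge> 0" unfolding A_def using G0 by (intro integral_nonneg_AE AE_I2) auto
  have int: "integrable ?M (\<lambda>\<omega>. v \<omega> * G \<omega>)"
    if [measurable]: "v \<in> borel_measurable borel" and v: "\<And>\<omega>. norm \<omega> = 1 \<Longrightarrow> \<bar>v \<omega>\<bar> \<le> C" for v C
  proof (rule integrable_const_bound[where B="C * g \<omega>2"])
    have C0: "C \<ge> 0" using v[OF \<nu>] by simp
    show "AE \<omega> in ?M. norm (v \<omega> * G \<omega>) \<le> C * g \<omega>2"
    proof (rule AE_I2)
      fix \<omega>
      show "norm (v \<omega> * G \<omega>) \<le> C * g \<omega>2"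
      proof (cases "norm \<omega> = 1")
        case True
        then show ?thesis using v G0 C0 by (auto simp: abs_mult intro!: mult_mono)
      qed (use G3 C0 g0[OF \<omega>2(1)] in auto)
    qed
  qed measurable
  have iH: "integrable ?M (\<lambda>\<omega>. H \<omega> * G \<omega>)" by (rule int[of H M]) (use HM in \<open>auto dest: spec\<close>, metis HM mult_1_right one_power2)
  have iN: "integrable ?M (\<lambda>\<omega>. (norm \<omega>)\<^sup>2 * G \<omega>)" by (rule int[of _ 1]) auto
  have main: "\<forall>\<^sub>F r in at_right 0. \<bar>Kgr g s r x (F r) / sigma_s ?d s r - k0\<bar> \<le> (2 * A + 1) * \<epsilon>" if \<epsilon>: "\<epsilon> > 0" for \<epsilon>
  proof -
    \<comment> \<open>The quadratic part of the defining function is \<open>- H / 2\<close>.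
      \<open>Qp\<close> is this height widened by \<open>\<epsilon> * (norm z) ^ 2\<close>, and
      \<open>Qm\<close> is the widened height for the negated sign; the widening costs
      \<open>2 * \<epsilon> * A\<close> in the limit.\<close>
    define Qp where "Qp z = - H z / 2 + \<epsilon> * (norm z)\<^sup>2" for z
    define Qm where "Qm z = H z / 2 + \<epsilon> * (norm z)\<^sup>2" for z
    have [measurable]: "Qp \<in> borel_measurable borel" "Qm \<in> borel_measurable borel"
      unfolding Qp_def Qm_def by measurable
    have Qhom: "Qp z = (norm z)\<^sup>2 * Qp (sgn z)" "Qm z = (norm z)\<^sup>2 * Qm (sgn z)" for z
      using Hs[of z] by (cases "z = 0"; auto simp: Qp_def Qm_def norm_sgn algebra_simps)+
    have QM: "\<bar>Qp \<omega>\<bar> \<le> M + \<epsilon>" "\<bar>Qm \<omega>\<bar> \<le> M + \<epsilon>" if "norm \<omega> = 1" for \<omega>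
      using HM[of \<omega>] that \<epsilon> M0 by (auto simp: Qp_def Qm_def abs_le_iff)
    have IQp: "2 * (\<integral>\<omega>. Qp \<omega> * G \<omega> \<partial>?M) = k0 + 2 * \<epsilon> * A"
    proof -
      have "(\<integral>\<omega>. Qp \<omega> * G \<omega> \<partial>?M) = (\<integral>\<omega>. (- 1/2) * (H \<omega> * G \<omega>) + \<epsilon> * ((norm \<omega>)\<^sup>2 * G \<omega>) \<partial>?M)"
        by (rule Bochner_Integration.integral_cong) (auto simp: Qp_def algebra_simps)
      also have "\<dots> = (- 1/2) * (\<integral>\<omega>. H \<omega> * G \<omega> \<partial>?M) + \<epsilon> * A"
        unfolding A_def using iH iN by simp
      finally show ?thesis by (simp add: k0_def)
    qed
    have IQm: "2 * (\<integral>\<omega>. Qm \<omega> * G \<omega> \<partial>?M) = - k0 + 2 * \<epsilon> * A"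
    proof -
      have "(\<integral>\<omega>. Qm \<omega> * G \<omega> \<partial>?M) = (\<integral>\<omega>. (1/2) * (H \<omega> * G \<omega>) + \<epsilon> * ((norm \<omega>)\<^sup>2 * G \<omega>) \<partial>?M)"
        by (rule Bochner_Integration.integral_cong) (auto simp: Qm_def algebra_simps)
      also have "\<dots> = (1/2) * (\<integral>\<omega>. H \<omega> * G \<omega> \<partial>?M) + \<epsilon> * A"
        unfolding A_def using iH iN by simp
      finally show ?thesis by (simp add: k0_def)
    qed
    obtain \<eta>1 where \<eta>1: "\<eta>1 > 0" and up1: "\<And>\<delta>. 0 < \<delta> \<Longrightarrow> \<delta> < \<eta>1 \<Longrightarrow> \<forall>\<^sub>F r in at_right 0. \<forall>a S. norm (a - \<nu>) \<le> \<eta>1 \<longrightarrow>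
      S \<in> borel_measurable borel \<longrightarrow> (\<forall>h. \<bar>S h\<bar> \<le> 1) \<longrightarrow>
      (\<forall>h. h \<noteq> 0 \<longrightarrow> norm (perp \<nu> h) < \<delta> \<longrightarrow> \<bar>h \<bullet> \<nu>\<bar> < \<delta> \<longrightarrow> S h \<le> wedge_sign (a \<bullet> h) (Qp (perp \<nu> h))) \<longrightarrow>
      (\<integral>h. S h * (G (sgn h) * kr ?d s r (norm h)) \<partial>lborel) \<le>
        (2 * (\<integral>\<omega>. Qp \<omega> * G \<omega> \<partial>cone_measure \<nu>) + \<epsilon>) * sigma_s ?d s r"
      using kernel_upper_bound[of G Qp "g \<omega>2" "g \<omega>1" "M + \<epsilon>" \<nu> s \<epsilon>, OF Gm _ G0 G3 Gc G5 g0[OF \<omega>1(1)] Qhom(1) QM(1) \<nu> d s \<epsilon>]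
      by auto
    obtain \<eta>2 where \<eta>2: "\<eta>2 > 0" and up2: "\<And>\<delta>. 0 < \<delta> \<Longrightarrow> \<delta> < \<eta>2 \<Longrightarrow> \<forall>\<^sub>F r in at_right 0. \<forall>a S. norm (a - \<nu>) \<le> \<eta>2 \<longrightarrow>
      S \<in> borel_measurable borel \<longrightarrow> (\<forall>h. \<bar>S h\<bar> \<le> 1) \<longrightarrow>
      (\<forall>h. h \<noteq> 0 \<longrightarrow> norm (perp \<nu> h) < \<delta> \<longrightarrow> \<bar>h \<bullet> \<nu>\<bar> < \<delta> \<longrightarrow> S h \<le> wedge_sign (a \<bullet> h) (Qm (perp \<nu> h))) \<longrightarrow>
      (\<integral>h. S h * (G (sgn h) * kr ?d s r (norm h)) \<partial>lborel) \<le>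
        (2 * (\<integral>\<omega>. Qm \<omega> * G \<omega> \<partial>cone_measure \<nu>) + \<epsilon>) * sigma_s ?d s r"
      using kernel_upper_bound[of G Qm "g \<omega>2" "g \<omega>1" "M + \<epsilon>" \<nu> s \<epsilon>, OF Gm _ G0 G3 Gc G5 g0[OF \<omega>1(1)] Qhom(2) QM(2) \<nu> d s \<epsilon>]
      by auto
    \<comment> \<open>\<open>\<epsilon> / 4\<close> and \<open>1/10\<close> are the tolerances of
      \<open>symmetric_sign_bound\<close>; \<open>\<eta>1\<close> and \<open>\<eta>2\<close> bound
      the admissible tilt of \<open>a\<close> in the two kernel estimates.\<close>
    define \<epsilon>0 where "\<epsilon>0 = min (min (\<epsilon> / 4) (1/10)) (min \<eta>1 \<eta>2)"
    have \<epsilon>0: "\<epsilon>0 > 0" "\<epsilon>0 \<le> \<epsilon> / 4" "\<epsilon>0 \<le> 1/10" "\<epsilon>0 \<le> \<eta>1" "\<epsilon>0 \<le> \<eta>2"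
      using \<epsilon> \<eta>1 \<eta>2 unfolding \<epsilon>0_def by linarith+
    obtain \<delta>0 where \<delta>0: "\<delta>0 > 0" and ex: "\<forall>\<^sub>F r in at_right 0. \<exists>a v. norm (a - \<nu>) \<le> \<epsilon>0 \<and>
     (\<forall>h. norm h < \<delta>0 \<longrightarrow> (x + h \<in> F r \<longleftrightarrow> v h \<le> 0) \<and>
        \<bar>v h - (a \<bullet> h - f'' 0 (perp \<nu> h) (perp \<nu> h) / 2)\<bar> \<le> \<epsilon>0 * (norm h)\<^sup>2)"
      using convC_expansion[OF lg conv FC Fx \<epsilon>0(1)] by blast
    define B where "B = 1 / (2 * (M + 2 * \<epsilon>))"
    have B: "B > 0" "(M + 2 * \<epsilon>) * B = 1/2" using M0 \<epsilon> by (auto simp: B_def field_simps)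
    \<comment> \<open>Points of the cylinder of radius and half-height \<open>\<delta>\<close> have
      norm below \<open>2 * \<delta>\<close>, which must not exceed \<open>\<delta>0\<close> for the
      expansion and \<open>B\<close> for the sign bound.\<close>
    define \<delta> where "\<delta> = min (min (\<eta>1 / 2) (\<eta>2 / 2)) (min (\<delta>0 / 2) (B / 2))"
    have \<delta>: "\<delta> > 0" "\<delta> < \<eta>1" "\<delta> < \<eta>2" "2 * \<delta> \<le> \<delta>0" "2 * \<delta> \<le> B"
      using \<eta>1 \<eta>2 \<delta>0 B(1) unfolding \<delta>_def by linarith+
    have \<delta>M: "(M + 2 * \<epsilon>) * (2 * \<delta>) \<le> 1/2"
      using mult_left_mono[OF \<delta>(5), of "M + 2 * \<epsilon>"] B M0 \<epsilon> by simp
    have ev\<sigma>: "\<forall>\<^sub>F r in at_right 0. 0 < sigma_s ?d s r"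
      using sigma_s_at_top[OF s, of ?d] by (simp add: filterlim_at_top_dense)
    show ?thesis
      using eventually_at_right_less[of "0::real"] ev\<sigma> ex up1[OF \<delta>(1,2)] up2[OF \<delta>(1,3)]
    proof eventually_elim
      case (elim r)
      obtain a v where a: "norm (a - \<nu>) \<le> \<epsilon>0" and v: "\<And>h. norm h < \<delta>0 \<Longrightarrow> (x + h \<in> F r \<longleftrightarrow> v h \<le> 0) \<and>
        \<bar>v h - (a \<bullet> h - H (perp \<nu> h) / 2)\<bar> \<le> \<epsilon>0 * (norm h)\<^sup>2"
        using elim(3) unfolding H_def by blast
      have Fcl: "closed (F r)" using FC elim(1) by (auto simp: classC_def)
      then have [measurable]: "F r \<in> sets borel" by (rule borel_closed)
      define \<phi> where "\<phi> h = (indicator (- F r) (x + h) - indicator (F r) (x + h) :: real)" for h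
      have [measurable]: "\<phi> \<in> borel_measurable borel" unfolding \<phi>_def by measurable
      define S where "S h = (\<phi> h + \<phi> (- h)) / 2" for h
      have [measurable]: "S \<in> borel_measurable borel" unfolding S_def by measurable
      have S1: "\<bar>S h\<bar> \<le> 1" for h by (auto simp: S_def \<phi>_def indicator_def)
      have K: "Kgr g s r x (F r) = (\<integral>h. S h * (G (sgn h) * kr ?d s r (norm h)) \<partial>lborel)"
        unfolding S_def G_def
        by (rule Kgr_symmetrized) (use Gm G0 ge Fcl s elim(1) in \<open>auto simp: G_def[abs_def] \<phi>_def\<close>)
      have Sb: "S h \<le> wedge_sign (a \<bullet> h) (Qp (perp \<nu> h)) \<and> - S h \<le> wedge_sign (a \<bullet> h) (Qm (perp \<nu> h))"
        if h: "h \<noteq> 0" "norm (perp \<nu> h) < \<delta>" "\<bar>h \<bullet> \<nu>\<bar> < \<delta>" for h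
      proof -
        have "norm h \<le> norm (perp \<nu> h) + norm ((h \<bullet> \<nu>) *\<^sub>R \<nu>)"
          by (metis perp_decomp norm_triangle_ineq)
        then have nh: "norm h < 2 * \<delta>" using h \<nu> by simp
        then have nh0: "norm h < \<delta>0" "norm (- h) < \<delta>0" using \<delta>(4) by auto
        define q where "q = - H (perp \<nu> h) / 2"
        have pm: "perp \<nu> (- h) = - perp \<nu> h" by (simp add: perp_def)
        have qM: "\<bar>q\<bar> \<le> M * (norm (perp \<nu> h))\<^sup>2"
          using HM[of "perp \<nu> h"] M0 by (simp add: q_def)
        have le: "\<epsilon>0 * (norm h)\<^sup>2 \<le> \<epsilon> / 4 * (norm h)\<^sup>2" using \<epsilon>0(2) by (intro mult_right_mono) auto
        have e1: "\<bar>v h - (a \<bullet> h + q)\<bar> \<le> \<epsilon> / 4 * (norm h)\<^sup>2"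
          using v[OF nh0(1)] le by (simp add: q_def)
        have e2: "\<bar>v (- h) - (- (a \<bullet> h) + q)\<bar> \<le> \<epsilon> / 4 * (norm h)\<^sup>2"
          using v[OF nh0(2)] le by (simp add: q_def pm Hm)
        have ch: "\<phi> h = (if v h \<le> 0 then -1 else 1)" "\<phi> (- h) = (if v (- h) \<le> 0 then -1 else 1)"
          using v[OF nh0(1)] v[OF nh0(2)] by (auto simp: \<phi>_def indicator_def)
        note sb = symmetric_sign_bound[OF \<nu> order_trans[OF a \<epsilon>0(3)] h(1) nh qM M0 \<epsilon> \<delta>M e1 e2]
        have "Qp (perp \<nu> h) = q + \<epsilon> * (norm (perp \<nu> h))\<^sup>2" "Qm (perp \<nu> h) = - q + \<epsilon> * (norm (perp \<nu> h))\<^sup>2"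
          by (auto simp: Qp_def Qm_def q_def)
        then show ?thesis using sb unfolding S_def ch by simp
      qed
      have u1: "Kgr g s r x (F r) \<le> (k0 + 2 * \<epsilon> * A + \<epsilon>) * sigma_s ?d s r"
        using elim(4)[rule_format, of a S] S1 Sb a \<epsilon>0(4) unfolding K IQp by auto
      have "(\<integral>h. - S h * (G (sgn h) * kr ?d s r (norm h)) \<partial>lborel) \<le> (- k0 + 2 * \<epsilon> * A + \<epsilon>) * sigma_s ?d s r"
        using elim(5)[rule_format, of a "\<lambda>h. - S h"] S1 Sb a \<epsilon>0(5) unfolding IQm by auto
      then have u2: "- Kgr g s r x (F r) \<le> (- k0 + 2 * \<epsilon> * A + \<epsilon>) * sigma_s ?d s r"
        unfolding K by simp
      have "Kgr g s r x (F r) / sigma_s ?d s r \<le> k0 + 2 * \<epsilon> * A + \<epsilon>"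
        using u1 elim(2) by (simp add: pos_divide_le_eq)
      moreover have "- Kgr g s r x (F r) / sigma_s ?d s r \<le> - k0 + 2 * \<epsilon> * A + \<epsilon>"
        using u2 elim(2) by (simp only: pos_divide_le_eq)
      ultimately show ?case by (simp add: abs_le_iff algebra_simps)
    qed
  qed
  have "((\<lambda>r. Kgr g s r x (F r) / sigma_s ?d s r) \<longlongrightarrow> k0) (at_right 0)"
  proof (rule tendstoI)
    fix e :: real assume e: "e > 0"
    \<comment> \<open>The total error is \<open>(2 * A + 1) * \<epsilon>\<close>: widening
      contributes \<open>2 * A * \<epsilon>\<close> and the kernel estimate
      \<open>\<epsilon>\<close>. The halving makes the final inequality strict.\<close>
    define \<epsilon> where "\<epsilon> = e / 2 / (2 * A + 1)"
    have \<epsilon>: "\<epsilon> > 0" using e A0 by (auto simp: \<epsilon>_def)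
    have "2 * A + 1 \<noteq> 0" using A0 by linarith
    then have "(2 * A + 1) * \<epsilon> = e / 2" unfolding \<epsilon>_def by (rule nonzero_mult_div_cancel_left[of "2 * A + 1" "e / 2", folded times_divide_eq_right])
    then have le: "(2 * A + 1) * \<epsilon> < e" using e by simp
    show "\<forall>\<^sub>F r in at_right 0. dist (Kgr g s r x (F r) / sigma_s ?d s r) k0 < e"
      using main[OF \<epsilon>] by eventually_elim (use le in \<open>simp add: dist_real_def\<close>)
  qed
  then show ?thesis unfolding target .
qed

theorem theorem6p5:
  fixes g :: "'a::euclidean_space \<Rightarrow> real"
    and s :: real
    and F :: "real \<Rightarrow> 'a set"
    and E :: "'a set"
    and x :: 'a
  assumes "DIM('a) \<ge> 2"
    and "continuous_on (sphere 0 1) g"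
    and "\<forall>\<xi>\<in>sphere 0 1. g \<xi> > 0"
    and "\<forall>\<xi>\<in>sphere 0 1. g (- \<xi>) = g \<xi>"
    and "s \<ge> 1"
    and "\<forall>r>0. F r \<in> classC"
    and "E \<in> classC"
    and "convC F E"
    and "x \<in> frontier E"
    and "\<forall>r>0. x \<in> frontier (F r)"
  shows "((\<lambda>r. Kgr g s r x (F r) / sigma_s DIM('a) s r) \<longlongrightarrow> aniso_curv g x E) (at_right 0)"
proof -
  define R where "R = (\<lambda>r. Kgr g s r x (F r) / sigma_s DIM('a) s r)"
  define C where "C k \<longleftrightarrow> (\<exists>\<nu> f f' f''. local_graph E x \<nu> f f' f'' \<and>
      k = - (\<integral>\<xi>. indicator {\<xi>. norm \<xi> = 1 \<and> \<xi> \<bullet> \<nu> = 0} \<xi> *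
                  (g \<xi> * blinfun_apply (blinfun_apply (f'' 0) \<xi>) \<xi>)
             \<partial>hausdorff_measure (DIM('a) - 2)))" for k
  have lim: "(R \<longlongrightarrow> k) (at_right 0)" if "C k" for k
    using that Kgr_limit_local_graph[OF assms(1-6,8,10)] unfolding C_def R_def by blast
  obtain k where k: "C k" using assms(7,9) unfolding classC_def C_def by blast
  have "C k' \<Longrightarrow> k' = k" for k'
    using lim[of k'] lim[OF k] tendsto_unique trivial_limit_at_right_real by blast
  then have "aniso_curv g x E = k"
    unfolding aniso_curv_def C_def[symmetric] using k by (rule the_equality[rotated])
  then show ?thesis using lim[OF k] by (simp add: R_def)
qed

end
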